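(* For all $\rho\in L_n$, $T_\rho$ is a closed subvariety of $\mathcal{A}_n$ and $T_\rho^\circ$ is a locally closed subspace of $\mathcal{A}_n$, dense in $T_\rho$. Furthermore, $\{T_\rho^\circ\}_{\rho\in L_n}$ forms a stratification of $\mathcal{A}_n$.
   Context: Everything is over $\mathbb{C}$; $[k]=\{0<1<\dots<k\}$. Multiscaled lines. A multiscaled line is a tuple $(\Sigma,p_\infty,\preceq,\omega_\bullet)$ where: (1) $\Sigma$ is a connected (complete) nodal complex curve of arithmetic genus $0$ with a smooth marked point $p_\infty$; its dual graph is a tree with vertex set $V(\Sigma)$, $\Sigma_v$ is the component of $v$, and the root $v_0$ is the vertex whose component contains $p_\infty$. Write $v\subseteq u$ if $v$ lies on the simple path from $u$ to $v_0$; $u\wedge v$ is the $\subseteq$-maximal vertex common to the simple paths from $u$ and from $v$ to $v_0$; terminal vertices are the $\subseteq$-maximal ones. (2) $\preceq$ is a total preorder on $V(\Sigma)$ such that (a) each $v\neq v_0$ has a unique adjacent $w$ with $w\prec v$ (the corresponding node is the descending node of $v$), and (b) any two terminal vertices are equivalent, where $v\sim w$ means $v\preceq w$ and $w\preceq v$. (3) For each $v$, $\omega_v$ is a meromorphic differential on $\Sigma_v$ with a pole of order $2$ at the descending node of $v$ (at $p_\infty$ if $v=v_0$) and no other zeros or poles. An $n$-marked multiscaled line has in addition smooth points $p_1,\dots,p_n$ (which may coincide with each other but not with $p_\infty$) lying on terminal components. It is stable if every terminal component contains at least one $p_i$ and every nonterminal component contains at least $3$ nodes, or at least $2$ nodes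 and $p_\infty$. A complex projective isomorphism is an isomorphism of curves $f:\Sigma\to\Sigma'$ preserving preorders and all marked points, with $f^*(\omega'_v)=c_v\omega_v$ for constants $c_v\in\mathbb{C}^*$ such that $c_v=c_w$ if $v\sim w$ and $c_v=1$ if $v$ is terminal. $\mathcal{A}_n$ is the set of complex projective isomorphism classes of stable $n$-marked multiscaled lines. Dual level trees. $\Gamma(\Sigma)$ is the dual tree of $\Sigma$ with root $v_0$, preorder $\preceq$ and marking $h:\{1,\dots,n\}\to V(\Sigma)$, $h(i)=v$ if $p_i\in\Sigma_v$. A dual level tree is any marked preordered rooted tree arising this way. Its level function is the order-preserving map $\lambda: V\to V/{\sim}\cong[\ell]$; $\ell$ is its length. A contraction $\Gamma\twoheadrightarrow\Gamma'$ is a surjection $f$ on vertices, compatible with the markings, such that $v\preceq w\Rightarrow f(v)\preceq' f(w)$, adjacent vertices have equal or adjacent images, and fibers span connected subgraphs. Variety structure. $\Pi_{ij}:\mathcal{A}_n\to\mathbb{P}^1$: $\Pi_{ij}(\Sigma)=\int_{p_i}^{p_j}\omega_v$ (any path in the smooth locus of $\Sigma_v$) if $p_i,p_j$ lie on the same terminal component $\Sigma_v$, and $\Pi_{ij}(\Sigma)=\infty$ otherwise. $I_{ij}(\Sigma)=\int_{n_i}^{n_j}\omega_v$ where $v=h(i)\wedge h(j)$ in $\Gamma(\Sigma)$, and $n_i,n_j$ are $p_i,p_j$ if $h(i)=h(j)$, and otherwise the nodes of $\Sigma_v$ through which $\Sigma_v$ is connected to $\Sigma_{h(i)},\Sigma_{h(j)}$.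 For a dual level tree $\Gamma$ of length $\ell$ with marking $h$, $U_\Gamma\subset\mathcal{A}_n$ is the set of $\Sigma$ such that there is a contraction $\Gamma\twoheadrightarrow\Gamma(\Sigma)$ and $\Pi_{ij}(\Sigma)\neq0$ whenever $h(i)\neq h(j)$ in $\Gamma$. Choose, for each $0\le m\le\ell-1$, a pair $(i_m,j_m)$ such that $v_m:=h(i_m)\wedge h(j_m)$ is on level $m$ of $\Gamma$; let $v_\ell$ be any terminal vertex. For $\Sigma\in U_\Gamma$ with (unique) contraction $f:\Gamma\twoheadrightarrow\Gamma(\Sigma)$ put $s_\ell=1$, $s_m=I_{i_mj_m}(\Sigma)$ for $m<\ell$; for $1\le m\le\ell$, $t_m=s_m/s_{m-1}$ if $f(v_m)\sim f(v_{m-1})$ and $t_m=0$ otherwise; $z_{ij}=I_{ij}(\Sigma)/s_m$ if $h(i)\wedge h(j)$ is on level $m$ of $\Gamma$. With $A$ (resp. $B$) the set of pairs $i<j$ with $h(i)\ne h(j)$ (resp. $h(i)=h(j)$) in $\Gamma$, this gives a map $\psi_\Gamma=(z_{ij},t_m):U_\Gamma\to(\mathbb{C}^* )^A\times\mathbb{C}^B\times\mathbb{C}^\ell$. $\mathcal{A}_n$ carries the unique structure of algebraic variety such that all $U_\Gamma$ are Zariski open and all $\psi_\Gamma$ are closed immersions; it is smooth and proper of dimension $n-1$, and the $\Pi_{ij}:\mathcal{A}_n\to\mathbb{P}^1$ are morphisms. Collision strata. $L_n$ is the set of partitions of $\{1,\dots,n\}$; $i\sim^\rho j$ means $i,j$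 are in the same block of $\rho$. $T_\rho=\{\Sigma\in\mathcal{A}_n: i\sim^\rho j\Rightarrow p_i=p_j\}$ and $T_\rho^\circ=\{\Sigma\in\mathcal{A}_n: p_i=p_j\iff i\sim^\rho j\}$. A stratification of a space $X$ is a collection $\{S_i\}_{i\in I}$ of locally closed subspaces such that $S_i\cap S_j=\varnothing$ for $i\ne j$, $\bigcup_iS_i=X$, and $S_i\cap\overline{S_j}\neq\varnothing$ implies $S_i\subset\overline{S_j}$. *)

theory Defs
  imports
    "HOL-Complex_Analysis.Complex_Analysis"
    "HOL-Library.Disjoint_Sets"
begin

section \<open>Varieties as spaces with functions\<close>

text \<open>
  A complex algebraic variety is a space with a sheaf of complex-valued functions that has a finite
  open cover by affine varieties and is separated; irreducibility is not required.
  \<open>sreg X U f\<close> says that (the restriction to \<open>U\<close> of) \<open>f\<close> is a section over the open set \<open>U\<close>; it is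
  irrelevant for other sets \<open>U\<close>.
\<close>

record 'a fspace =
  ztop :: "'a topology"
  sreg :: "'a set \<Rightarrow> ('a \<Rightarrow> complex) \<Rightarrow> bool"

abbreviation points :: "'a fspace \<Rightarrow> 'a set" where
  "points X \<equiv> topspace (ztop X)"

definition sheaf_of_functions :: "'a fspace \<Rightarrow> bool" where
  "sheaf_of_functions X \<longleftrightarrow>
     (\<forall>U f g. openin (ztop X) U \<and> (\<forall>x\<in>U. f x = g x) \<and> sreg X U f \<longrightarrow> sreg X U g) \<and>
     (\<forall>U W f. openin (ztop X) U \<and> openin (ztop X) W \<and> W \<subseteq> U \<and> sreg X U f \<longrightarrow> sreg X W f) \<and>
     (\<forall>U f. openin (ztop X) U \<and>
        (\<forall>x\<in>U. \<exists>W. openin (ztop X) W \<and> x \<in> W \<and> W \<subseteq> U \<and> sreg X W f) \<longrightarrow> sreg X U f)"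

definition fmorphism :: "'a fspace \<Rightarrow> 'b fspace \<Rightarrow> ('a \<Rightarrow> 'b) \<Rightarrow> bool" where
  "fmorphism X Y \<phi> \<longleftrightarrow>
     continuous_map (ztop X) (ztop Y) \<phi> \<and>
     (\<forall>V g. openin (ztop Y) V \<and> sreg Y V g \<longrightarrow> sreg X {x \<in> points X. \<phi> x \<in> V} (g \<circ> \<phi>))"

definition fisomorphism :: "'a fspace \<Rightarrow> 'b fspace \<Rightarrow> ('a \<Rightarrow> 'b) \<Rightarrow> bool" where
  "fisomorphism X Y \<phi> \<longleftrightarrow>
     fmorphism X Y \<phi> \<and>
     (\<exists>\<psi>. fmorphism Y X \<psi> \<and> (\<forall>x\<in>points X. \<psi> (\<phi> x) = x) \<and> (\<forall>y\<in>points Y. \<phi> (\<psi> y) = y))"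

text \<open>
  For open \<open>S\<close> the induced structure is the open subspace; for closed \<open>S\<close> it is the reduced induced
  structure.
\<close>

definition induced :: "'a fspace \<Rightarrow> 'a set \<Rightarrow> 'a fspace" where
  "induced X S =
     \<lparr> ztop = subtopology (ztop X) S,
       sreg = (\<lambda>W f. \<forall>x\<in>W. \<exists>V g. openin (ztop X) V \<and> x \<in> V \<and> sreg X V g \<and> (\<forall>y\<in>V \<inter> W. f y = g y)) \<rparr>"

definition closed_immersion :: "'a fspace \<Rightarrow> 'b fspace \<Rightarrow> ('a \<Rightarrow> 'b) \<Rightarrow> bool" where
  "closed_immersion X Y \<phi> \<longleftrightarrow>
     closedin (ztop Y) (\<phi> ` points X) \<and> fisomorphism X (induced Y (\<phi> ` points X)) \<phi>"

inductive_set poly_funs :: "'i set \<Rightarrow> (('i \<Rightarrow> complex) \<Rightarrow> complex) set" for J :: "'i set" where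
  const: "(\<lambda>x. c) \<in> poly_funs J"
| coord: "i \<in> J \<Longrightarrow> (\<lambda>x. x i) \<in> poly_funs J"
| add: "p \<in> poly_funs J \<Longrightarrow> q \<in> poly_funs J \<Longrightarrow> (\<lambda>x. p x + q x) \<in> poly_funs J"
| mult: "p \<in> poly_funs J \<Longrightarrow> q \<in> poly_funs J \<Longrightarrow> (\<lambda>x. p x * q x) \<in> poly_funs J"

definition zariski :: "'i set \<Rightarrow> ('i \<Rightarrow> complex) topology" where
  "zariski J =
     topology (\<lambda>U. \<exists>P\<subseteq>poly_funs J. U = {x \<in> J \<rightarrow>\<^sub>E UNIV. \<exists>p\<in>P. p x \<noteq> 0})"

lemma istopology_zariski:
  "istopology (\<lambda>U. \<exists>P\<subseteq>poly_funs J. U = {x \<in> J \<rightarrow>\<^sub>E UNIV. \<exists>p\<in>P. p x \<noteq> 0})"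
  unfolding istopology_def
proof (intro conjI allI impI)
  fix S T
  assume "\<exists>P\<subseteq>poly_funs J. S = {x \<in> J \<rightarrow>\<^sub>E UNIV. \<exists>p\<in>P. p x \<noteq> 0}"
    and "\<exists>P\<subseteq>poly_funs J. T = {x \<in> J \<rightarrow>\<^sub>E UNIV. \<exists>p\<in>P. p x \<noteq> 0}"
  then obtain P Q where PQ: "P \<subseteq> poly_funs J" "S = {x \<in> J \<rightarrow>\<^sub>E UNIV. \<exists>p\<in>P. p x \<noteq> 0}"
    "Q \<subseteq> poly_funs J" "T = {x \<in> J \<rightarrow>\<^sub>E UNIV. \<exists>p\<in>Q. p x \<noteq> 0}" by blast
  let ?R = "(\<lambda>(p, q) x. p x * q x) ` (P \<times> Q)"
  have "?R \<subseteq> poly_funs J" using PQ by (auto intro!: poly_funs.mult)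
  moreover have "S \<inter> T = {x \<in> J \<rightarrow>\<^sub>E UNIV. \<exists>p\<in>?R. p x \<noteq> 0}"
    unfolding PQ(2) PQ(4) by fastforce
  ultimately show "\<exists>P\<subseteq>poly_funs J. S \<inter> T = {x \<in> J \<rightarrow>\<^sub>E UNIV. \<exists>p\<in>P. p x \<noteq> 0}" by blast
next
  fix K
  assume *: "\<forall>U\<in>K. \<exists>P\<subseteq>poly_funs J. U = {x \<in> J \<rightarrow>\<^sub>E UNIV. \<exists>p\<in>P. p x \<noteq> 0}"
  let ?P = "{p \<in> poly_funs J. \<forall>x \<in> J \<rightarrow>\<^sub>E UNIV. p x \<noteq> 0 \<longrightarrow> x \<in> \<Union>K}"
  have "\<Union>K = {x \<in> J \<rightarrow>\<^sub>E UNIV. \<exists>p\<in>?P. p x \<noteq> 0}"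
  proof (intro equalityI subsetI)
    fix x assume "x \<in> \<Union>K"
    then obtain U where U: "U \<in> K" "x \<in> U" by blast
    with * obtain P where P: "P \<subseteq> poly_funs J" "U = {x \<in> J \<rightarrow>\<^sub>E UNIV. \<exists>p\<in>P. p x \<noteq> 0}"
      by blast
    with U obtain p where p: "p \<in> P" "p x \<noteq> 0" "x \<in> J \<rightarrow>\<^sub>E UNIV" by blast
    have "y \<in> \<Union>K" if "y \<in> J \<rightarrow>\<^sub>E UNIV" "p y \<noteq> 0" for y
      using U(1) P(2) p(1) that by blast
    then have "p \<in> ?P" using p(1) P(1) by blast
    then show "x \<in> {x \<in> J \<rightarrow>\<^sub>E UNIV. \<exists>p\<in>?P. p x \<noteq> 0}" using p(2,3) by blast
  qed blast
  then show "\<exists>P\<subseteq>poly_funs J. \<Union>K = {x \<in> J \<rightarrow>\<^sub>E UNIV. \<exists>p\<in>P. p x \<noteq> 0}"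
    by (intro exI[of _ ?P]) blast
qed

text \<open>Affine space with coordinates indexed by the finite set \<open>J\<close>.\<close>

definition affine_space :: "'i set \<Rightarrow> ('i \<Rightarrow> complex) fspace" where
  "affine_space J =
     \<lparr> ztop = zariski J,
       sreg = (\<lambda>U f. \<forall>x\<in>U. \<exists>W p q. openin (zariski J) W \<and> x \<in> W \<and> W \<subseteq> U \<and>
                 p \<in> poly_funs J \<and> q \<in> poly_funs J \<and> (\<forall>y\<in>W. q y \<noteq> 0 \<and> f y = p y / q y)) \<rparr>"

definition affine_variety :: "'a fspace \<Rightarrow> bool" where
  "affine_variety X \<longleftrightarrow>
     (\<exists>k Z \<phi>. closedin (zariski {..<k::nat}) Z \<and> fisomorphism X (induced (affine_space {..<k}) Z) \<phi>)"

text \<open>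
  Separatedness: any two morphisms from an affine variety agree on a closed set. Up to isomorphism
  every affine variety is a closed subset of some affine space.
\<close>

definition separated_fspace :: "'a fspace \<Rightarrow> bool" where
  "separated_fspace X \<longleftrightarrow>
     (\<forall>k Z \<phi> \<psi>. closedin (zariski {..<k::nat}) Z \<and>
        fmorphism (induced (affine_space {..<k}) Z) X \<phi> \<and>
        fmorphism (induced (affine_space {..<k}) Z) X \<psi> \<longrightarrow>
        closedin (subtopology (zariski {..<k}) Z) {z \<in> Z. \<phi> z = \<psi> z})"

definition variety :: "'a fspace \<Rightarrow> bool" where
  "variety X \<longleftrightarrow>
     sheaf_of_functions X \<and>
     (\<exists>\<U>. finite \<U> \<and> \<Union>\<U> = points X \<and>
        (\<forall>U\<in>\<U>. openin (ztop X) U \<and> affine_variety (induced X U))) \<and>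
     separated_fspace X"

definition closed_subvariety :: "'a fspace \<Rightarrow> 'a set \<Rightarrow> bool" where
  "closed_subvariety X Z \<longleftrightarrow> closedin (ztop X) Z \<and> variety (induced X Z)"

definition locally_closed_in :: "'a topology \<Rightarrow> 'a set \<Rightarrow> bool" where
  "locally_closed_in X S \<longleftrightarrow> (\<exists>U C. openin X U \<and> closedin X C \<and> S = U \<inter> C)"

definition dense_in :: "'a topology \<Rightarrow> 'a set \<Rightarrow> 'a set \<Rightarrow> bool" where
  "dense_in X S T \<longleftrightarrow> S \<subseteq> T \<and> subtopology X T closure_of S = T"

definition stratification :: "'a topology \<Rightarrow> 'i set \<Rightarrow> ('i \<Rightarrow> 'a set) \<Rightarrow> bool" where
  "stratification X I S \<longleftrightarrow>
     (\<forall>i\<in>I. locally_closed_in X (S i)) \<and>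
     (\<forall>i\<in>I. \<forall>j\<in>I. i \<noteq> j \<longrightarrow> S i \<inter> S j = {}) \<and>
     (\<Union>i\<in>I. S i) = topspace X \<and>
     (\<forall>i\<in>I. \<forall>j\<in>I. S i \<inter> X closure_of S j \<noteq> {} \<longrightarrow> S i \<subseteq> X closure_of S j)"


section \<open>The projective line and its differentials\<close>

datatype P1 = Pt complex | Infinity

fun mobius :: "complex \<Rightarrow> complex \<Rightarrow> complex \<Rightarrow> complex \<Rightarrow> P1 \<Rightarrow> P1" where
  "mobius a b c d (Pt z) = (if c * z + d = 0 then Infinity else Pt (moebius a b c d z))"
| "mobius a b c d Infinity = (if c = 0 then Infinity else Pt (a / c))"

definition P1_aut :: "(P1 \<Rightarrow> P1) \<Rightarrow> bool" where
  "P1_aut \<mu> \<longleftrightarrow> (\<exists>a b c d. a * d - b * c \<noteq> 0 \<and> \<mu> = mobius a b c d)"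

fun affine_coord :: "P1 \<Rightarrow> complex" where
  "affine_coord (Pt z) = z"
| "affine_coord Infinity = 0"

text \<open>
  A differential on \<open>P1\<close> is given by the function \<open>\<omega>\<close> with differential \<open>\<omega>(z) dz\<close> in the affine
  coordinate \<open>z\<close>. The pullback is \<open>\<omega>(\<mu>(z)) \<mu>'(z) dz\<close>; \<open>remove_sings\<close> corrects the value at
  the preimage of infinity, where that expression is meaningless.
\<close>

definition pullback :: "(P1 \<Rightarrow> P1) \<Rightarrow> (complex \<Rightarrow> complex) \<Rightarrow> complex \<Rightarrow> complex" where
  "pullback \<mu> \<omega> =
     remove_sings (\<lambda>z. \<omega> (affine_coord (\<mu> (Pt z))) * deriv (\<lambda>w. affine_coord (\<mu> (Pt w))) z)"

text \<open>The local form at infinity, in the coordinate \<open>1 / z\<close>.\<close>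

definition at_infty :: "(complex \<Rightarrow> complex) \<Rightarrow> complex \<Rightarrow> complex" where
  "at_infty \<omega> = pullback (mobius 0 1 1 0) \<omega>"

text \<open>
  Nonzero meromorphic differentials. Requiring \<open>nicely_meromorphic_on\<close> fixes the values at poles and
  removable singularities, so that equality of differentials is equality of functions.
\<close>

definition mero_diff :: "(complex \<Rightarrow> complex) \<Rightarrow> bool" where
  "mero_diff \<omega> \<longleftrightarrow>
     \<omega> nicely_meromorphic_on UNIV \<and> at_infty \<omega> meromorphic_on {0} \<and> \<omega> \<noteq> (\<lambda>z. 0)"

fun diff_order :: "(complex \<Rightarrow> complex) \<Rightarrow> P1 \<Rightarrow> int" where
  "diff_order \<omega> (Pt z) = zorder \<omega> z"
| "diff_order \<omega> Infinity = zorder (at_infty \<omega>) 0"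

definition only_double_pole :: "(complex \<Rightarrow> complex) \<Rightarrow> P1 \<Rightarrow> bool" where
  "only_double_pole \<omega> q \<longleftrightarrow>
     mero_diff \<omega> \<and> diff_order \<omega> q = -2 \<and> (\<forall>x. x \<noteq> q \<longrightarrow> diff_order \<omega> x = 0)"

text \<open>
  The integral of \<open>\<omega>\<close> along any path from \<open>x\<close> to \<open>y\<close> avoiding \<open>q\<close>, the only pole of \<open>\<omega>\<close>. An
  automorphism \<open>\<mu>\<close> sending infinity to \<open>q\<close> identifies the complement of \<open>q\<close> with the complex plane,
  where the path is the \<open>\<mu>\<close>-image of \<open>\<gamma>\<close>.
\<close>

definition diff_integral :: "(complex \<Rightarrow> complex) \<Rightarrow> P1 \<Rightarrow> P1 \<Rightarrow> P1 \<Rightarrow> complex" where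
  "diff_integral \<omega> q x y =
     (THE I. \<forall>\<mu> \<gamma>. P1_aut \<mu> \<and> \<mu> Infinity = q \<and> valid_path \<gamma> \<and>
        \<mu> (Pt (pathstart \<gamma>)) = x \<and> \<mu> (Pt (pathfinish \<gamma>)) = y \<longrightarrow>
        (pullback \<mu> \<omega> has_contour_integral I) \<gamma>)"


section \<open>Marked preordered rooted trees\<close>

text \<open>Markings are only relevant on \<open>{1..n}\<close>.\<close>

record ltree =
  verts :: "nat set"
  adj :: "(nat \<times> nat) set"
  vroot :: nat
  pre :: "(nat \<times> nat) set"
  mark :: "nat \<Rightarrow> nat"

definition simple_path :: "('r) ltree_scheme \<Rightarrow> nat \<Rightarrow> nat \<Rightarrow> nat list \<Rightarrow> bool" where
  "simple_path T u v xs \<longleftrightarrow>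
     xs \<noteq> [] \<and> hd xs = u \<and> last xs = v \<and> distinct xs \<and> set xs \<subseteq> verts T \<and>
     successively (\<lambda>x y. (x, y) \<in> adj T) xs"

definition is_tree :: "('r) ltree_scheme \<Rightarrow> bool" where
  "is_tree T \<longleftrightarrow>
     finite (verts T) \<and> vroot T \<in> verts T \<and>
     adj T \<subseteq> verts T \<times> verts T \<and> sym (adj T) \<and> irrefl (adj T) \<and>
     (\<forall>u\<in>verts T. \<forall>v\<in>verts T. \<exists>!xs. simple_path T u v xs)"

definition on_path :: "('r) ltree_scheme \<Rightarrow> nat \<Rightarrow> nat \<Rightarrow> nat \<Rightarrow> bool" where
  "on_path T x u v \<longleftrightarrow> (\<exists>xs. simple_path T u v xs \<and> x \<in> set xs)"

definition ancestor :: "('r) ltree_scheme \<Rightarrow> nat \<Rightarrow> nat \<Rightarrow> bool" where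
  "ancestor T v u \<longleftrightarrow> on_path T v u (vroot T)"

definition meet :: "('r) ltree_scheme \<Rightarrow> nat \<Rightarrow> nat \<Rightarrow> nat" where
  "meet T u v =
     (THE m. ancestor T m u \<and> ancestor T m v \<and>
        (\<forall>w. ancestor T w u \<and> ancestor T w v \<and> ancestor T m w \<longrightarrow> w = m))"

definition terminal :: "('r) ltree_scheme \<Rightarrow> nat \<Rightarrow> bool" where
  "terminal T v \<longleftrightarrow> v \<in> verts T \<and> (\<forall>u\<in>verts T. ancestor T v u \<longrightarrow> u = v)"

definition strict :: "('r) ltree_scheme \<Rightarrow> nat \<Rightarrow> nat \<Rightarrow> bool" where
  "strict T v w \<longleftrightarrow> (v, w) \<in> pre T \<and> (w, v) \<notin> pre T"

definition equiv_rel :: "('r) ltree_scheme \<Rightarrow> (nat \<times> nat) set" where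
  "equiv_rel T = pre T \<inter> (pre T)\<inverse>"

definition level :: "('r) ltree_scheme \<Rightarrow> nat \<Rightarrow> nat" where
  "level T v = card {C \<in> verts T // equiv_rel T. \<exists>w\<in>C. strict T w v}"

definition tree_length :: "('r) ltree_scheme \<Rightarrow> nat" where
  "tree_length T = card (verts T // equiv_rel T) - 1"

definition contraction :: "nat \<Rightarrow> ltree \<Rightarrow> ltree \<Rightarrow> (nat \<Rightarrow> nat) \<Rightarrow> bool" where
  "contraction n T T' f \<longleftrightarrow>
     f ` verts T = verts T' \<and>
     (\<forall>i\<in>{1..n}. f (mark T i) = mark T' i) \<and>
     (\<forall>v\<in>verts T. \<forall>w\<in>verts T. (v, w) \<in> pre T \<longrightarrow> (f v, f w) \<in> pre T') \<and>
     (\<forall>v w. (v, w) \<in> adj T \<longrightarrow> f v = f w \<or> (f v, f w) \<in> adj T') \<and>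
     (\<forall>x\<in>verts T'. let F = {v \<in> verts T. f v = x} in
        \<forall>v\<in>F. \<forall>w\<in>F. (v, w) \<in> (adj T \<inter> F \<times> F)\<^sup>*)"


section \<open>Multiscaled lines\<close>

text \<open>
  A connected complete nodal curve of arithmetic genus 0 is a finite tree of projective lines: a copy
  \<open>\<Sigma>\<^sub>v\<close> of \<open>P1\<close> for each vertex \<open>v\<close>, glued along nodes. For adjacent \<open>v\<close>, \<open>w\<close>, the node joining \<open>\<Sigma>\<^sub>v\<close> and
  \<open>\<Sigma>\<^sub>w\<close> identifies the point \<open>node v w\<close> of \<open>\<Sigma>\<^sub>v\<close> with the point \<open>node w v\<close> of \<open>\<Sigma>\<^sub>w\<close>. The point at infinity
  is \<open>infpt\<close> in the component of the root, the \<open>i\<close>-th marked point is \<open>mpt i\<close> in the component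
  \<open>mark i\<close>.
\<close>

record mline = ltree +
  node :: "nat \<Rightarrow> nat \<Rightarrow> P1"
  infpt :: P1
  mpt :: "nat \<Rightarrow> P1"
  omega :: "nat \<Rightarrow> complex \<Rightarrow> complex"

definition nodes_on :: "mline \<Rightarrow> nat \<Rightarrow> P1 set" where
  "nodes_on S v = {node S v w | w. (v, w) \<in> adj S}"

definition desc_point :: "mline \<Rightarrow> nat \<Rightarrow> P1" where
  "desc_point S v =
     (if v = vroot S then infpt S else node S v (THE w. (v, w) \<in> adj S \<and> strict S w v))"

definition multiscaled_line :: "mline \<Rightarrow> bool" where
  "multiscaled_line S \<longleftrightarrow>
     is_tree S \<and>
     (\<forall>v\<in>verts S. inj_on (node S v) {w. (v, w) \<in> adj S}) \<and>
     infpt S \<notin> nodes_on S (vroot S) \<and>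
     preorder_on (verts S) (pre S) \<and> total_on (verts S) (pre S) \<and>
     (\<forall>v\<in>verts S. v \<noteq> vroot S \<longrightarrow> (\<exists>!w. (v, w) \<in> adj S \<and> strict S w v)) \<and>
     (\<forall>v w. terminal S v \<and> terminal S w \<longrightarrow> (v, w) \<in> equiv_rel S) \<and>
     (\<forall>v\<in>verts S. only_double_pole (omega S v) (desc_point S v))"

definition marked_line :: "nat \<Rightarrow> mline \<Rightarrow> bool" where
  "marked_line n S \<longleftrightarrow>
     multiscaled_line S \<and>
     (\<forall>i\<in>{1..n}. terminal S (mark S i) \<and> mpt S i \<notin> nodes_on S (mark S i) \<and>
        (mark S i = vroot S \<longrightarrow> mpt S i \<noteq> infpt S))"

definition stable_line :: "nat \<Rightarrow> mline \<Rightarrow> bool" where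
  "stable_line n S \<longleftrightarrow>
     marked_line n S \<and>
     (\<forall>v\<in>verts S. terminal S v \<longrightarrow> (\<exists>i\<in>{1..n}. mark S i = v)) \<and>
     (\<forall>v\<in>verts S. \<not> terminal S v \<longrightarrow>
        card (nodes_on S v) \<ge> 3 \<or> (card (nodes_on S v) \<ge> 2 \<and> v = vroot S))"

text \<open>
  An isomorphism of curves is a bijection \<open>\<phi>\<close> of components together with isomorphisms
  \<open>\<mu> v\<close> from \<open>\<Sigma>\<^sub>v\<close> to \<open>\<Sigma>'\<^sub>\<phi>\<^sub>v\<close> that are compatible with the nodes.
\<close>

definition cp_isomorphism :: "nat \<Rightarrow> mline \<Rightarrow> mline \<Rightarrow> (nat \<Rightarrow> nat) \<Rightarrow> (nat \<Rightarrow> P1 \<Rightarrow> P1) \<Rightarrow> bool" where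
  "cp_isomorphism n S S' \<phi> \<mu> \<longleftrightarrow>
     bij_betw \<phi> (verts S) (verts S') \<and>
     (\<forall>v\<in>verts S. P1_aut (\<mu> v)) \<and>
     (\<forall>v\<in>verts S. \<forall>w\<in>verts S. (v, w) \<in> adj S \<longleftrightarrow> (\<phi> v, \<phi> w) \<in> adj S') \<and>
     (\<forall>v w. (v, w) \<in> adj S \<longrightarrow> \<mu> v (node S v w) = node S' (\<phi> v) (\<phi> w)) \<and>
     (\<forall>v\<in>verts S. \<forall>w\<in>verts S. (v, w) \<in> pre S \<longleftrightarrow> (\<phi> v, \<phi> w) \<in> pre S') \<and>
     \<phi> (vroot S) = vroot S' \<and> \<mu> (vroot S) (infpt S) = infpt S' \<and>
     (\<forall>i\<in>{1..n}. \<phi> (mark S i) = mark S' i \<and> \<mu> (mark S i) (mpt S i) = mpt S' i) \<and>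
     (\<exists>c. (\<forall>v\<in>verts S. c v \<noteq> 0 \<and> pullback (\<mu> v) (omega S' (\<phi> v)) = (\<lambda>z. c v * omega S v z)) \<and>
          (\<forall>v w. (v, w) \<in> equiv_rel S \<longrightarrow> c v = c w) \<and>
          (\<forall>v. terminal S v \<longrightarrow> c v = 1))"

definition moduli :: "nat \<Rightarrow> mline set set" where
  "moduli n =
     {S. stable_line n S} //
     {(S, S'). stable_line n S \<and> stable_line n S' \<and> (\<exists>\<phi> \<mu>. cp_isomorphism n S S' \<phi> \<mu>)}"


section \<open>The variety structure on the moduli space\<close>

definition dual_tree :: "mline \<Rightarrow> ltree" where
  "dual_tree S =
     \<lparr> verts = verts S, adj = adj S, vroot = vroot S, pre = pre S, mark = mark S \<rparr>"

definition dual_level_trees :: "nat \<Rightarrow> ltree set" where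
  "dual_level_trees n = dual_tree ` {S. stable_line n S}"

definition Pi_coord :: "mline \<Rightarrow> nat \<Rightarrow> nat \<Rightarrow> P1" where
  "Pi_coord S i j =
     (if mark S i = mark S j
      then Pt (diff_integral (omega S (mark S i)) (desc_point S (mark S i)) (mpt S i) (mpt S j))
      else Infinity)"

text \<open>For \<open>u \<noteq> v\<close>, the node of \<open>\<Sigma>\<^sub>v\<close> through which \<open>\<Sigma>\<^sub>v\<close> is connected to \<open>\<Sigma>\<^sub>u\<close>.\<close>

definition node_towards :: "mline \<Rightarrow> nat \<Rightarrow> nat \<Rightarrow> P1" where
  "node_towards S v u = node S v (THE w. (v, w) \<in> adj S \<and> on_path S w v u)"

definition I_coord :: "mline \<Rightarrow> nat \<Rightarrow> nat \<Rightarrow> complex" where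
  "I_coord S i j =
     (let v = meet S (mark S i) (mark S j) in
      diff_integral (omega S v) (desc_point S v)
        (if mark S i = mark S j then mpt S i else node_towards S v (mark S i))
        (if mark S i = mark S j then mpt S j else node_towards S v (mark S j)))"

definition chart_dom :: "nat \<Rightarrow> ltree \<Rightarrow> mline set set" where
  "chart_dom n \<Gamma> =
     {C \<in> moduli n. \<forall>S\<in>C. (\<exists>f. contraction n \<Gamma> (dual_tree S) f) \<and>
        (\<forall>i\<in>{1..n}. \<forall>j\<in>{1..n}. mark \<Gamma> i \<noteq> mark \<Gamma> j \<longrightarrow> Pi_coord S i j \<noteq> Pt 0)}"

text \<open>A choice of pairs \<open>(a m, b m)\<close>, one for each nonterminal level \<open>m\<close>, and of a terminal vertex \<open>e\<close>.\<close>

definition chart_choice :: "nat \<Rightarrow> ltree \<Rightarrow> (nat \<Rightarrow> nat) \<Rightarrow> (nat \<Rightarrow> nat) \<Rightarrow> nat \<Rightarrow> bool" where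
  "chart_choice n \<Gamma> a b e \<longleftrightarrow>
     (\<forall>m<tree_length \<Gamma>. a m \<in> {1..n} \<and> b m \<in> {1..n} \<and>
        level \<Gamma> (meet \<Gamma> (mark \<Gamma> (a m)) (mark \<Gamma> (b m))) = m) \<and>
     terminal \<Gamma> e"

definition chart_vertex :: "ltree \<Rightarrow> (nat \<Rightarrow> nat) \<Rightarrow> (nat \<Rightarrow> nat) \<Rightarrow> nat \<Rightarrow> nat \<Rightarrow> nat" where
  "chart_vertex \<Gamma> a b e m =
     (if m = tree_length \<Gamma> then e else meet \<Gamma> (mark \<Gamma> (a m)) (mark \<Gamma> (b m)))"

definition chart_scale :: "ltree \<Rightarrow> (nat \<Rightarrow> nat) \<Rightarrow> (nat \<Rightarrow> nat) \<Rightarrow> mline \<Rightarrow> nat \<Rightarrow> complex" where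
  "chart_scale \<Gamma> a b S m = (if m = tree_length \<Gamma> then 1 else I_coord S (a m) (b m))"

text \<open>\<open>Zc i j\<close> and \<open>Tc m\<close> index the coordinates \<open>z\<^sub>i\<^sub>j\<close> and \<open>t\<^sub>m\<close>.\<close>

datatype chart_index = Zc nat nat | Tc nat

definition chart_indices :: "nat \<Rightarrow> ltree \<Rightarrow> chart_index set" where
  "chart_indices n \<Gamma> =
     {Zc i j | i j. i \<in> {1..n} \<and> j \<in> {1..n} \<and> i < j} \<union> {Tc m | m. m \<in> {1..tree_length \<Gamma>}}"

definition chart_target :: "nat \<Rightarrow> ltree \<Rightarrow> (chart_index \<Rightarrow> complex) fspace" where
  "chart_target n \<Gamma> =
     induced (affine_space (chart_indices n \<Gamma>))
       {x. \<forall>i\<in>{1..n}. \<forall>j\<in>{1..n}. i < j \<and> mark \<Gamma> i \<noteq> mark \<Gamma> j \<longrightarrow> x (Zc i j) \<noteq> 0}"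

definition chart_line ::
  "nat \<Rightarrow> ltree \<Rightarrow> (nat \<Rightarrow> nat) \<Rightarrow> (nat \<Rightarrow> nat) \<Rightarrow> nat \<Rightarrow> mline \<Rightarrow> chart_index \<Rightarrow> complex" where
  "chart_line n \<Gamma> a b e S =
     (let f = (SOME f. contraction n \<Gamma> (dual_tree S) f);
          s = chart_scale \<Gamma> a b S;
          v = chart_vertex \<Gamma> a b e
      in restrict
        (\<lambda>k. case k of
            Zc i j \<Rightarrow> I_coord S i j / s (level \<Gamma> (meet \<Gamma> (mark \<Gamma> i) (mark \<Gamma> j)))
          | Tc m \<Rightarrow> if (f (v m), f (v (m - 1))) \<in> equiv_rel S then s m / s (m - 1) else 0)
        (chart_indices n \<Gamma>))"

text \<open>
  The coordinates are invariant under complex projective isomorphism, although the \<open>I_coord\<close> at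
  nonterminal vertices are not, so the chart may be evaluated on any representative.
\<close>

definition chart ::
  "nat \<Rightarrow> ltree \<Rightarrow> (nat \<Rightarrow> nat) \<Rightarrow> (nat \<Rightarrow> nat) \<Rightarrow> nat \<Rightarrow> mline set \<Rightarrow> chart_index \<Rightarrow> complex" where
  "chart n \<Gamma> a b e C = chart_line n \<Gamma> a b e (SOME S. S \<in> C)"

text \<open>The property that characterizes the variety structure of the moduli space uniquely.\<close>

definition moduli_variety :: "nat \<Rightarrow> mline set fspace \<Rightarrow> bool" where
  "moduli_variety n X \<longleftrightarrow>
     variety X \<and> points X = moduli n \<and>
     (\<forall>\<Gamma>\<in>dual_level_trees n.
        openin (ztop X) (chart_dom n \<Gamma>) \<and>
        (\<forall>a b e. chart_choice n \<Gamma> a b e \<longrightarrow>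
           closed_immersion (induced X (chart_dom n \<Gamma>)) (chart_target n \<Gamma>) (chart n \<Gamma> a b e)))"


section \<open>Collision strata\<close>

definition same_block :: "nat set set \<Rightarrow> nat \<Rightarrow> nat \<Rightarrow> bool" where
  "same_block \<rho> i j \<longleftrightarrow> (\<exists>B\<in>\<rho>. i \<in> B \<and> j \<in> B)"

definition collide :: "mline \<Rightarrow> nat \<Rightarrow> nat \<Rightarrow> bool" where
  "collide S i j \<longleftrightarrow> mark S i = mark S j \<and> mpt S i = mpt S j"

definition closed_stratum :: "nat \<Rightarrow> nat set set \<Rightarrow> mline set set" where
  "closed_stratum n \<rho> =
     {C \<in> moduli n. \<forall>S\<in>C. \<forall>i\<in>{1..n}. \<forall>j\<in>{1..n}. same_block \<rho> i j \<longrightarrow> collide S i j}"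

definition open_stratum :: "nat \<Rightarrow> nat set set \<Rightarrow> mline set set" where
  "open_stratum n \<rho> =
     {C \<in> moduli n. \<forall>S\<in>C. \<forall>i\<in>{1..n}. \<forall>j\<in>{1..n}. collide S i j \<longleftrightarrow> same_block \<rho> i j}"

end

theory Submission
  imports Defs
begin

text \<open>
  The locus where \<open>p\<^sub>i = p\<^sub>j\<close> is closed because the charts cover the moduli space: on the chart of \<open>\<Gamma>\<close> it
  is empty if \<open>i\<close>, \<open>j\<close> lie on different vertices of \<open>\<Gamma>\<close>, and is the zero locus of the coordinate \<open>z\<^sub>i\<^sub>j\<close>
  otherwise. Hence the closed strata are closed and the open strata locally closed. For density, move the
  marked points of a line in the closed stratum linearly along their components, with velocities that agree
  exactly within the blocks of the partition. This leaves the curve and its dual tree unchanged, so in the chart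
  of that tree the coordinates \<open>t\<^sub>m\<close> stay zero and the \<open>z\<^sub>i\<^sub>j\<close> are affine in the parameter: every
  polynomial that does not vanish at the given line also does not vanish at nearby ones, which lie in the
  open stratum. So the closure of an open stratum is the closed one, whence the frontier condition.
\<close>

section \<open>Varieties\<close>

text \<open>\<open>X\<close> is any space satisfying \<open>moduli_variety\<close>, so its topology
  is accessible only through the charts: their domains are open, and each is a homeomorphism onto a
  closed subset of its target. Equations of that image are never determined. For density it is
  enough to exhibit points of the image, and the perturbed lines provide them because they are again
  stable lines. The obstacle is that a chart value rests on three choices: a representative of the
  isomorphism class, a contraction picked by \<open>SOME\<close>, and integrals given by
  \<open>THE\<close> over all parametrizations of a component. Evaluating it takes three facts:
  every admissible differential is a \<open>dpole\<close>, hence has an explicit primitive;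
  isomorphic lines have integrals that differ by a factor constant on levels; and a contraction
  between trees with equally many vertices reflects the preorder, which makes all t_m zero in the
  chart of a line's own tree.\<close>

lemma points_induced [simp]: "points (induced X S) = points X \<inter> S"
  by (simp add: induced_def)

lemma ztop_induced [simp]: "ztop (induced X S) = subtopology (ztop X) S"
  by (simp add: induced_def)

lemma sreg_induced:
  "sreg (induced X S) W f \<longleftrightarrow>
     (\<forall>x\<in>W. \<exists>V g. openin (ztop X) V \<and> x \<in> V \<and> sreg X V g \<and> (\<forall>y\<in>V \<inter> W. f y = g y))"
  by (simp add: induced_def)

lemma sreg_restrict:
  assumes "sheaf_of_functions X" "openin (ztop X) U" "openin (ztop X) W" "W \<subseteq> U" "sreg X U f"
  shows "sreg X W f"
  using assms unfolding sheaf_of_functions_def by blast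

lemma fmorphism_comp:
  assumes "fmorphism X Y \<phi>" "fmorphism Y Z \<psi>"
  shows "fmorphism X Z (\<psi> \<circ> \<phi>)"
  unfolding fmorphism_def
proof (intro conjI allI impI)
  show "continuous_map (ztop X) (ztop Z) (\<psi> \<circ> \<phi>)"
    using assms unfolding fmorphism_def by (blast intro: continuous_map_compose)
next
  fix V g assume V: "openin (ztop Z) V \<and> sreg Z V g"
  have c: "continuous_map (ztop X) (ztop Y) \<phi>" "continuous_map (ztop Y) (ztop Z) \<psi>"
    using assms unfolding fmorphism_def by blast+
  let ?W = "{y \<in> points Y. \<psi> y \<in> V}"
  have "openin (ztop Y) ?W" using c(2) V by (blast intro: openin_continuous_map_preimage)
  moreover have "sreg Y ?W (g \<circ> \<psi>)" using assms(2) V unfolding fmorphism_def by blast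
  ultimately have "sreg X {x \<in> points X. \<phi> x \<in> ?W} (g \<circ> \<psi> \<circ> \<phi>)"
    using assms(1) unfolding fmorphism_def by blast
  moreover have "{x \<in> points X. \<phi> x \<in> ?W} = {x \<in> points X. (\<psi> \<circ> \<phi>) x \<in> V}"
    using c(1) unfolding continuous_map_def by auto
  ultimately show "sreg X {x \<in> points X. (\<psi> \<circ> \<phi>) x \<in> V} (g \<circ> (\<psi> \<circ> \<phi>))"
    by (simp add: comp_assoc)
qed

lemma fmorphism_image: "fmorphism X Y \<phi> \<Longrightarrow> x \<in> points X \<Longrightarrow> \<phi> x \<in> points Y"
  unfolding fmorphism_def continuous_map_def by blast

text \<open>Sections of an induced space are locally restrictions of ambient sections, so it
  suffices to pull back the local extensions from \<open>Y\<close>.\<close>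

lemma fmorphism_induced:
  assumes "fmorphism X Y \<phi>" "\<phi> ` (points X \<inter> S) \<subseteq> T"
  shows "fmorphism (induced X S) (induced Y T) \<phi>"
  unfolding fmorphism_def
proof (intro conjI allI impI)
  have c: "continuous_map (ztop X) (ztop Y) \<phi>" using assms(1) unfolding fmorphism_def by blast
  show "continuous_map (ztop (induced X S)) (ztop (induced Y T)) \<phi>"
    using c assms(2)
    by (auto simp: continuous_map_in_subtopology intro: continuous_map_from_subtopology)
  fix V g assume V: "openin (ztop (induced Y T)) V \<and> sreg (induced Y T) V g"
  show "sreg (induced X S) {x \<in> points (induced X S). \<phi> x \<in> V} (g \<circ> \<phi>)"
    unfolding sreg_induced
  proof
    fix x assume x: "x \<in> {x \<in> points (induced X S). \<phi> x \<in> V}"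
    then obtain V0 g0 where V0: "openin (ztop Y) V0" "\<phi> x \<in> V0" "sreg Y V0 g0"
      "\<forall>y\<in>V0 \<inter> V. g y = g0 y"
      using V unfolding sreg_induced by blast
    let ?W = "{x \<in> points X. \<phi> x \<in> V0}"
    have "openin (ztop X) ?W" using c V0 by (blast intro: openin_continuous_map_preimage)
    moreover have "sreg X ?W (g0 \<circ> \<phi>)" using assms(1) V0 unfolding fmorphism_def by blast
    moreover have "x \<in> ?W" using x V0 by auto
    ultimately show "\<exists>W h. openin (ztop X) W \<and> x \<in> W \<and> sreg X W h \<and>
        (\<forall>y\<in>W \<inter> {x \<in> points (induced X S). \<phi> x \<in> V}. (g \<circ> \<phi>) y = h y)"
      using V0(4) by (intro exI[of _ ?W] exI[of _ "g0 \<circ> \<phi>"]) auto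
  qed
qed

lemma fmorphism_inclusion: "fmorphism (induced X S) X id"
  unfolding fmorphism_def
proof (intro conjI allI impI)
  show "continuous_map (ztop (induced X S)) (ztop X) id"
    by (simp add: continuous_map_from_subtopology)
  fix V g assume "openin (ztop X) V \<and> sreg X V g"
  then show "sreg (induced X S) {x \<in> points (induced X S). id x \<in> V} (g \<circ> id)"
    unfolding sreg_induced by auto
qed

lemma fisomorphism_comp:
  assumes "fisomorphism X Y \<phi>" "fisomorphism Y Z \<psi>"
  shows "fisomorphism X Z (\<psi> \<circ> \<phi>)"
proof -
  obtain \<phi>' where 1: "fmorphism Y X \<phi>'" "\<forall>x\<in>points X. \<phi>' (\<phi> x) = x" "\<forall>y\<in>points Y. \<phi> (\<phi>' y) = y"
    using assms(1) unfolding fisomorphism_def by blast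
  obtain \<psi>' where 2: "fmorphism Z Y \<psi>'" "\<forall>x\<in>points Y. \<psi>' (\<psi> x) = x" "\<forall>y\<in>points Z. \<psi> (\<psi>' y) = y"
    using assms(2) unfolding fisomorphism_def by blast
  have 3: "fmorphism X Y \<phi>" "fmorphism Y Z \<psi>" using assms unfolding fisomorphism_def by blast+
  show ?thesis
    unfolding fisomorphism_def
    using fmorphism_comp[OF 3] fmorphism_comp[OF 2(1) 1(1)] 1 2
      fmorphism_image[OF 3(1)] fmorphism_image[OF 2(1)]
    by (intro conjI exI[of _ "\<phi>' \<circ> \<psi>'"]) auto
qed

lemma fisomorphism_induced:
  assumes "fisomorphism X Y \<phi>" "S \<subseteq> points X"
  shows "fisomorphism (induced X S) (induced Y (\<phi> ` S)) \<phi>"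
proof -
  obtain \<psi> where \<psi>: "fmorphism X Y \<phi>" "fmorphism Y X \<psi>" "\<forall>x\<in>points X. \<psi> (\<phi> x) = x"
      "\<forall>y\<in>points Y. \<phi> (\<psi> y) = y"
    using assms(1) unfolding fisomorphism_def by blast
  have "fmorphism (induced X S) (induced Y (\<phi> ` S)) \<phi>"
    by (rule fmorphism_induced[OF \<psi>(1)]) auto
  moreover have "fmorphism (induced Y (\<phi> ` S)) (induced X S) \<psi>"
    by (rule fmorphism_induced[OF \<psi>(2)]) (use \<psi>(3) assms(2) in auto)
  ultimately show ?thesis
    unfolding fisomorphism_def using \<psi> by (intro conjI exI[of _ \<psi>]) auto
qed

text \<open>Turning an extension on the intermediate space into one on \<open>X\<close> shrinks the
  ambient open set, and sections can be restricted to it because \<open>X\<close> carries a sheaf.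
  The result is an isomorphism rather than an equality because \<open>sreg\<close> is compared on
  open sets only.\<close>

lemma fisomorphism_induced_induced:
  assumes "sheaf_of_functions X" "B \<subseteq> A"
  shows "fisomorphism (induced (induced X A) B) (induced X B) id"
proof -
  have top: "ztop (induced (induced X A) B) = ztop (induced X B)"
    using assms(2) by (simp add: subtopology_subtopology Int_absorb1)
  have pts: "points (induced (induced X A) B) = points (induced X B)"
    using top by simp
  have sub: "V \<subseteq> B" "{x \<in> points (induced X B). id x \<in> V} = V"
    if "openin (ztop (induced X B)) V" for V
    using openin_subset[OF that] by auto
  have "sreg (induced (induced X A) B) W f \<longleftrightarrow> sreg (induced X B) W f" (is "?L \<longleftrightarrow> ?R")
    if "openin (ztop (induced X B)) W" for W f
  proof
    assume L: ?L
    show ?R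
      unfolding sreg_induced
    proof
      fix x assume x: "x \<in> W"
      then obtain V g where V: "openin (ztop (induced X A)) V" "x \<in> V" "sreg (induced X A) V g"
        "\<forall>y\<in>V \<inter> W. f y = g y" using L unfolding sreg_induced[of "induced X A"] by blast
      then obtain Q h where Q: "openin (ztop X) Q" "x \<in> Q" "sreg X Q h" "\<forall>y\<in>Q \<inter> V. g y = h y"
        unfolding sreg_induced by blast
      obtain P where P: "openin (ztop X) P" "V = P \<inter> A"
        using V(1) by (auto simp: openin_subtopology)
      have "sreg X (Q \<inter> P) h"
        by (rule sreg_restrict[OF assms(1) Q(1) _ _ Q(3)]) (use Q P in auto)
      moreover have "\<forall>y\<in>Q \<inter> P \<inter> W. f y = h y"
        using V(4) Q(4) P(2) sub(1)[OF that] assms(2) by fastforce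
      ultimately show "\<exists>V g. openin (ztop X) V \<and> x \<in> V \<and> sreg X V g \<and> (\<forall>y\<in>V \<inter> W. f y = g y)"
        using Q P V(2) by (intro exI[of _ "Q \<inter> P"] exI[of _ h]) auto
    qed
  next
    assume R: ?R
    show ?L
      unfolding sreg_induced[of "induced X A"]
    proof
      fix x assume x: "x \<in> W"
      then obtain V g where V: "openin (ztop X) V" "x \<in> V" "sreg X V g" "\<forall>y\<in>V \<inter> W. f y = g y"
        using R unfolding sreg_induced by blast
      have "sreg (induced X A) (V \<inter> A) g"
        unfolding sreg_induced using V by blast
      then show "\<exists>V g. openin (ztop (induced X A)) V \<and> x \<in> V \<and> sreg (induced X A) V g \<and>
          (\<forall>y\<in>V \<inter> W. f y = g y)"
        using V x sub(1)[OF that] assms(2)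
        by (intro exI[of _ "V \<inter> A"] exI[of _ g]) (auto simp: openin_subtopology)
    qed
  qed
  then have "fmorphism (induced (induced X A) B) (induced X B) id"
    "fmorphism (induced X B) (induced (induced X A) B) id"
    unfolding fmorphism_def top pts by (auto simp: sub(2)[unfolded id_apply] simp del: ztop_induced points_induced)
  then show ?thesis unfolding fisomorphism_def by (intro conjI exI[of _ id]) auto
qed

lemma fisomorphism_sym:
  assumes "fisomorphism X Y \<phi>"
  obtains \<psi> where "fisomorphism Y X \<psi>"
  using assms unfolding fisomorphism_def by blast

lemma fisomorphism_imp_homeomorphic_map:
  assumes "fisomorphism X Y \<phi>" shows "homeomorphic_map (ztop X) (ztop Y) \<phi>"
  using assms unfolding fisomorphism_def fmorphism_def homeomorphic_map_maps homeomorphic_maps_def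
  by auto

lemma sheaf_of_functions_affine_space: "sheaf_of_functions (affine_space J)"
  unfolding sheaf_of_functions_def
proof (intro conjI allI impI)
  fix U f g assume a: "openin (ztop (affine_space J)) U \<and> (\<forall>x\<in>U. f x = g x) \<and> sreg (affine_space J) U f"
  show "sreg (affine_space J) U g"
    unfolding affine_space_def fspace.simps
  proof
    fix x assume "x \<in> U"
    then obtain W p q where W: "openin (zariski J) W" "x \<in> W" "W \<subseteq> U"
      "p \<in> poly_funs J" "q \<in> poly_funs J" "\<forall>y\<in>W. q y \<noteq> 0 \<and> f y = p y / q y"
      using a unfolding affine_space_def fspace.simps by metis
    then show "\<exists>W p q. openin (zariski J) W \<and> x \<in> W \<and> W \<subseteq> U \<and>
             p \<in> poly_funs J \<and> q \<in> poly_funs J \<and> (\<forall>y\<in>W. q y \<noteq> 0 \<and> g y = p y / q y)"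
      using a by (metis subsetD)
  qed
next
  fix U W f assume a: "openin (ztop (affine_space J)) U \<and> openin (ztop (affine_space J)) W \<and> W \<subseteq> U \<and> sreg (affine_space J) U f"
  show "sreg (affine_space J) W f"
    unfolding affine_space_def fspace.simps
  proof
    fix x assume x: "x \<in> W"
    then have "x \<in> U" using a by blast
    then obtain V p q where V: "openin (zariski J) V" "x \<in> V" "V \<subseteq> U"
      "p \<in> poly_funs J" "q \<in> poly_funs J" "\<forall>y\<in>V. q y \<noteq> 0 \<and> f y = p y / q y"
      using a unfolding affine_space_def fspace.simps by metis
    have "ztop (affine_space J) = zariski J" by (simp add: affine_space_def)
    then have "openin (zariski J) (V \<inter> W)" using V a by auto
    then show "\<exists>V p q. openin (zariski J) V \<and> x \<in> V \<and> V \<subseteq> W \<and>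
             p \<in> poly_funs J \<and> q \<in> poly_funs J \<and> (\<forall>y\<in>V. q y \<noteq> 0 \<and> f y = p y / q y)"
      using V x by (intro exI[of _ "V \<inter> W"] exI[of _ p] exI[of _ q]) auto
  qed
next
  fix U f assume a: "openin (ztop (affine_space J)) U \<and>
    (\<forall>x\<in>U. \<exists>W. openin (ztop (affine_space J)) W \<and> x \<in> W \<and> W \<subseteq> U \<and> sreg (affine_space J) W f)"
  show "sreg (affine_space J) U f"
    unfolding affine_space_def fspace.simps
  proof
    fix x assume "x \<in> U"
    then obtain V where V: "V \<subseteq> U" "x \<in> V" "sreg (affine_space J) V f" using a by blast
    then obtain W p q where "openin (zariski J) W" "x \<in> W" "W \<subseteq> V"
      "p \<in> poly_funs J" "q \<in> poly_funs J" "\<forall>y\<in>W. q y \<noteq> 0 \<and> f y = p y / q y"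
      unfolding affine_space_def fspace.simps by metis
    with V show "\<exists>V p q. openin (zariski J) V \<and> x \<in> V \<and> V \<subseteq> U \<and>
             p \<in> poly_funs J \<and> q \<in> poly_funs J \<and> (\<forall>y\<in>V. q y \<noteq> 0 \<and> f y = p y / q y)"
      by (meson subset_trans)
  qed
qed

section \<open>Closed subsets of varieties\<close>

text \<open>The affine model of \<open>induced X U\<close> carries \<open>U \<inter> Z\<close> to a
  set closed in \<open>Y\<close>, hence closed in affine space. The remaining isomorphisms only
  rearrange iterated subspaces so that this model can be applied.\<close>

lemma affine_variety_closed_subset:
  assumes X: "sheaf_of_functions X" and Z: "closedin (ztop X) Z"
    and U: "openin (ztop X) U" "affine_variety (induced X U)"
  shows "affine_variety (induced (induced X Z) (U \<inter> Z))"
proof -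
  obtain k Y \<phi> where Y: "closedin (zariski {..<k::nat}) Y"
    "fisomorphism (induced X U) (induced (affine_space {..<k}) Y) \<phi>"
    using U(2) unfolding affine_variety_def by blast
  let ?A = "affine_space {..<k}"
  have zA: "ztop ?A = zariski {..<k}" by (simp add: affine_space_def)
  have Uz: "U \<inter> Z \<subseteq> points (induced X U)" using openin_subset[OF U(1)] by auto
  have shA: "fisomorphism (induced (induced ?A Y) (\<phi> ` (U \<inter> Z))) (induced ?A (\<phi> ` (U \<inter> Z))) id"
  proof (rule fisomorphism_induced_induced)
    show "sheaf_of_functions ?A" by (rule sheaf_of_functions_affine_space)
    show "\<phi> ` (U \<inter> Z) \<subseteq> Y"
      using fmorphism_image[of "induced X U" "induced ?A Y" \<phi>] Y(2) Uz
      unfolding fisomorphism_def by fastforce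
  qed
  have "fisomorphism (induced (induced X Z) (U \<inter> Z)) (induced X (U \<inter> Z)) id"
    by (rule fisomorphism_induced_induced[OF X]) auto
  moreover obtain \<eta> where "fisomorphism (induced X (U \<inter> Z)) (induced (induced X U) (U \<inter> Z)) \<eta>"
    using fisomorphism_sym[OF fisomorphism_induced_induced[OF X, of "U \<inter> Z" U]] by blast
  moreover have "fisomorphism (induced (induced X U) (U \<inter> Z))
      (induced (induced ?A Y) (\<phi> ` (U \<inter> Z))) \<phi>"
    by (rule fisomorphism_induced[OF Y(2) Uz])
  ultimately obtain \<theta> where
    "fisomorphism (induced (induced X Z) (U \<inter> Z)) (induced ?A (\<phi> ` (U \<inter> Z))) \<theta>"
    using shA fisomorphism_comp by metis
  moreover have "closedin (zariski {..<k}) (\<phi> ` (U \<inter> Z))"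
  proof -
    have "closedin (ztop (induced X U)) (U \<inter> Z)"
      using Z by (simp add: closedin_subtopology_Int_closed)
    then have "closedin (ztop (induced ?A Y)) (\<phi> ` (U \<inter> Z))"
      using fisomorphism_imp_homeomorphic_map[OF Y(2)] homeomorphic_map_closedness_eq by blast
    then show ?thesis using Y(1) zA by (metis closedin_closed_subtopology ztop_induced)
  qed
  ultimately show ?thesis unfolding affine_variety_def by blast
qed

text \<open>The affine cover is intersected with \<open>Z\<close>. Separatedness is inherited
  because a morphism into \<open>Z\<close> composed with the inclusion is a morphism into
  \<open>X\<close>.\<close>

lemma variety_closed_subset:
  assumes X: "variety X" and Z: "closedin (ztop X) Z"
  shows "variety (induced X Z)"
proof -
  have sh: "sheaf_of_functions X" using X unfolding variety_def by blast
  have "sheaf_of_functions (induced X Z)"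
    unfolding sheaf_of_functions_def
  proof (intro conjI allI impI)
    fix U f g
    assume "openin (ztop (induced X Z)) U \<and> (\<forall>x\<in>U. f x = g x) \<and> sreg (induced X Z) U f"
    then show "sreg (induced X Z) U g" unfolding sreg_induced by (metis IntE)
  next
    fix U W f
    assume a: "openin (ztop (induced X Z)) U \<and> openin (ztop (induced X Z)) W \<and> W \<subseteq> U \<and>
      sreg (induced X Z) U f"
    then show "sreg (induced X Z) W f"
      unfolding sreg_induced by (meson IntI IntE subsetD)
  next
    fix U f
    assume a: "openin (ztop (induced X Z)) U \<and>
      (\<forall>x\<in>U. \<exists>W. openin (ztop (induced X Z)) W \<and> x \<in> W \<and> W \<subseteq> U \<and> sreg (induced X Z) W f)"
    show "sreg (induced X Z) U f"
      unfolding sreg_induced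
    proof
      fix x assume "x \<in> U"
      then obtain W where W: "openin (ztop (induced X Z)) W" "x \<in> W" "sreg (induced X Z) W f"
        using a by blast
      then obtain V g where V: "openin (ztop X) V" "x \<in> V" "sreg X V g" "\<forall>y\<in>V \<inter> W. f y = g y"
        unfolding sreg_induced by blast
      \<comment> \<open>The extension \<open>g\<close> is known to agree with \<open>f\<close> on
        \<open>W\<close> only. Cutting \<open>V\<close> down to \<open>V \<inter> P\<close> helps
        because this set meets \<open>U\<close> inside \<open>W\<close>.\<close>
      obtain P where P: "openin (ztop X) P" "W = P \<inter> Z"
        using W(1) by (auto simp: openin_subtopology)
      have "U \<subseteq> Z" using a openin_subset by fastforce
      then have "\<forall>y\<in>V \<inter> P \<inter> U. f y = g y" using V(4) P(2) by blast
      moreover have "sreg X (V \<inter> P) g"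
        by (rule sreg_restrict[OF sh V(1) _ _ V(3)]) (use V P in auto)
      ultimately show "\<exists>V g. openin (ztop X) V \<and> x \<in> V \<and> sreg X V g \<and> (\<forall>y\<in>V \<inter> U. f y = g y)"
        using V P W(2) by (intro exI[of _ "V \<inter> P"] exI[of _ g]) auto
    qed
  qed
  moreover obtain \<U> where \<U>: "finite \<U>" "\<Union>\<U> = points X"
    "\<forall>U\<in>\<U>. openin (ztop X) U \<and> affine_variety (induced X U)"
    using X unfolding variety_def by blast
  have "\<exists>\<V>. finite \<V> \<and> \<Union>\<V> = points (induced X Z) \<and>
      (\<forall>V\<in>\<V>. openin (ztop (induced X Z)) V \<and> affine_variety (induced (induced X Z) V))"
    using \<U> affine_variety_closed_subset[OF sh Z]
    by (intro exI[of _ "(\<lambda>U. U \<inter> Z) ` \<U>"]) (auto simp: openin_subtopology)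
  moreover have "separated_fspace (induced X Z)"
    unfolding separated_fspace_def
  proof (intro allI impI, elim conjE)
    fix k Y \<phi> \<psi>
    assume a: "closedin (zariski {..<k::nat}) Y"
      "fmorphism (induced (affine_space {..<k}) Y) (induced X Z) \<phi>"
      "fmorphism (induced (affine_space {..<k}) Y) (induced X Z) \<psi>"
    have "fmorphism (induced (affine_space {..<k}) Y) X \<phi>"
      "fmorphism (induced (affine_space {..<k}) Y) X \<psi>"
      using fmorphism_comp[OF a(2) fmorphism_inclusion] fmorphism_comp[OF a(3) fmorphism_inclusion]
      by simp_all
    then show "closedin (subtopology (zariski {..<k}) Y) {z \<in> Y. \<phi> z = \<psi> z}"
      using X a(1) unfolding variety_def separated_fspace_def by blast
  qed
  ultimately show ?thesis unfolding variety_def by blast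
qed

lemma openin_zariski:
  "openin (zariski J) U \<longleftrightarrow> (\<exists>P\<subseteq>poly_funs J. U = {x \<in> J \<rightarrow>\<^sub>E UNIV. \<exists>p\<in>P. p x \<noteq> 0})"
  unfolding zariski_def by (simp add: topology_inverse'[OF istopology_zariski])

lemma isCont_poly_funs:
  assumes "p \<in> poly_funs J" "\<And>i. i \<in> J \<Longrightarrow> isCont (\<lambda>e. g e i) a"
  shows "isCont (\<lambda>e. p (g e)) a"
  using assms(1) by induction (auto intro: assms(2))

section \<open>Differentials with a single double pole\<close>

text \<open>
  At the pole \<open>a\<close> the value is \<open>k / 0 = 0\<close>, in accordance with \<open>nicely_meromorphic_on\<close>; the value of
  \<open>primitive\<close> at the pole is meaningless.
\<close>

definition dpole :: "P1 \<Rightarrow> complex \<Rightarrow> complex \<Rightarrow> complex" where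
  "dpole q k z = (case q of Infinity \<Rightarrow> k | Pt a \<Rightarrow> k / (z - a)\<^sup>2)"

fun primitive :: "P1 \<Rightarrow> complex \<Rightarrow> P1 \<Rightarrow> complex" where
  "primitive Infinity k (Pt z) = k * z"
| "primitive (Pt a) k (Pt z) = - k / (z - a)"
| "primitive q k Infinity = 0"

lemma dpole_simps [simp]: "dpole Infinity k z = k" "dpole (Pt a) k z = k / (z - a)\<^sup>2"
  by (auto simp: dpole_def)

text \<open>Off the pole, or for \<open>k = 0\<close>, the function is analytic; at a genuine pole
  \<open>remove_sings\<close> returns 0. Hence a pullback is known to be a \<open>dpole\<close> as
  soon as the two agree on punctured neighbourhoods.\<close>

lemma remove_sings_dpole: "remove_sings (dpole q k) z = dpole q k z"
proof (cases "q = Pt z \<and> k \<noteq> 0")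
  case True
  have "is_pole (\<lambda>w. k / (w - z)\<^sup>2) z"
    using True by (intro is_pole_divide) 
      (auto intro!: filterlim_atI tendsto_eq_intros simp: eventually_at_filter)
  moreover have "dpole (Pt z) k = (\<lambda>w. k / (w - z)\<^sup>2)" by (simp add: fun_eq_iff)
  ultimately have "is_pole (dpole q k) z" using True by simp
  then show ?thesis using True by simp
next
  case False
  then have "dpole q k analytic_on {z}"
    unfolding dpole_def[abs_def] by (cases "k = 0"; cases q) (auto intro!: analytic_intros)
  then show ?thesis by simp
qed

section \<open>Pullback along automorphisms of the projective line\<close>

lemma moebius_affine_coord:
  assumes "c * z + d \<noteq> 0"
  shows "affine_coord (mobius a b c d (Pt z)) = (a * z + b) / (c * z + d)"
    and "deriv (\<lambda>w. affine_coord (mobius a b c d (Pt w))) z = (a * d - b * c) / (c * z + d)\<^sup>2"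
proof -
  have *: "affine_coord (mobius a b c d (Pt z)) = (a * z + b) / (c * z + d)" if "c * z + d \<noteq> 0" for z
    using that by (simp add: moebius_def)
  from assms show "affine_coord (mobius a b c d (Pt z)) = (a * z + b) / (c * z + d)" by (rule *)
  have "open {w. c * w + d \<noteq> 0}"
    by (intro open_Collect_neq continuous_intros)
  then have "eventually (\<lambda>w. c * w + d \<noteq> 0) (nhds z)"
    using assms eventually_nhds by blast
  then have ev: "eventually (\<lambda>w. affine_coord (mobius a b c d (Pt w)) = (a * w + b) / (c * w + d)) (nhds z)"
    by eventually_elim (rule *)
  have "((\<lambda>w. (a * w + b) / (c * w + d)) has_field_derivative (a * d - b * c) / (c * z + d)\<^sup>2) (at z)"
    using assms by (auto intro!: derivative_eq_intros simp: power2_eq_square algebra_simps)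
  then have "deriv (\<lambda>w. (a * w + b) / (c * w + d)) z = (a * d - b * c) / (c * z + d)\<^sup>2"
    by (rule DERIV_imp_deriv)
  with deriv_cong_ev[OF ev refl]
  show "deriv (\<lambda>w. affine_coord (mobius a b c d (Pt w))) z = (a * d - b * c) / (c * z + d)\<^sup>2"
    by simp
qed

text \<open>At most one point is sent to infinity, and \<open>remove_sings\<close> ignores the value
  there, so the formula has to be checked only where the denominator is nonzero.\<close>

lemma pullback_mobius_eqI:
  assumes D: "a * d - b * c \<noteq> 0"
    and eq: "\<And>z. c * z + d \<noteq> 0 \<Longrightarrow>
      \<omega> ((a * z + b) / (c * z + d)) * ((a * d - b * c) / (c * z + d)\<^sup>2) = dpole q k z"
  shows "pullback (mobius a b c d) \<omega> = dpole q k"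
proof
  fix z
  have "eventually (\<lambda>w. c * w + d \<noteq> 0) (at z)"
  proof (cases "c = 0")
    case False
    then have "(c * w + d \<noteq> 0) = (w \<noteq> - d / c)" for w by (auto simp: field_simps add_eq_0_iff)
    then show ?thesis by (simp add: eventually_neq_at_within)
  qed (use D in auto)
  then have "eventually (\<lambda>w. \<omega> (affine_coord (mobius a b c d (Pt w))) *
      deriv (\<lambda>w. affine_coord (mobius a b c d (Pt w))) w = dpole q k w) (at z)"
    by eventually_elim (subst moebius_affine_coord, assumption, subst moebius_affine_coord, assumption, rule eq)
  from remove_sings_cong[OF this refl]
  show "pullback (mobius a b c d) \<omega> z = dpole q k z"
    unfolding pullback_def by (simp add: remove_sings_dpole)
qed

text \<open>The factor \<open>k'\<close> comes from the chain rule in each of the four positions of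
  the two poles. The constant \<open>e\<close> arises because primitives are normalized differently:
  \<open>primitive q'\<close> vanishes at \<open>Pt 0\<close> if \<open>q'\<close> is
  \<open>Infinity\<close> and at \<open>Infinity\<close> otherwise, and \<open>e\<close> is the
  value of the left-hand side at that point.\<close>

lemma pullback_dpole:
  assumes "P1_aut \<mu>" "\<mu> q' = q" "k \<noteq> 0"
  obtains k' e where "k' \<noteq> 0" "pullback \<mu> (dpole q k) = dpole q' k'"
    "\<And>x. x \<noteq> q' \<Longrightarrow> primitive q k (\<mu> x) = primitive q' k' x + e"
proof -
  obtain a b c d where D: "a * d - b * c \<noteq> 0" and \<mu>: "\<mu> = mobius a b c d"
    using assms(1) unfolding P1_aut_def by blast
  show thesis
  proof (cases q; cases q')
    assume q: "q = Infinity" "q' = Infinity"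
    then have c: "c = 0" using assms(2) \<mu> by (auto split: if_splits)
    with D have nz: "a \<noteq> 0" "d \<noteq> 0" by auto
    show thesis
    proof (rule that)
      show "k * a / d \<noteq> 0" using nz assms(3) by auto
      show "pullback \<mu> (dpole q k) = dpole q' (k * a / d)"
        unfolding \<mu> by (rule pullback_mobius_eqI[OF D]) (use q c nz in \<open>auto simp: power2_eq_square\<close>)
      show "primitive q k (\<mu> x) = primitive q' (k * a / d) x + k * b / d" if "x \<noteq> q'" for x
        using that q c nz by (cases x) (auto simp: \<mu> moebius_def field_simps)
    qed
  next
    fix t assume q: "q = Infinity" "q' = Pt t"
    then have ct: "c * t + d = 0" using assms(2) \<mu> by (auto split: if_splits)
    have c: "c \<noteq> 0" using D ct by auto
    have d: "d = - (c * t)" using ct by (simp add: add_eq_0_iff)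
    have D': "a * d - b * c = - c * (a * t + b)" by (simp add: d algebra_simps)
    have z: "c * z + d = c * (z - t)" for z by (simp add: d algebra_simps)
    show thesis
    proof (rule that)
      show "- k * (a * t + b) / c \<noteq> 0" using c assms(3) D D' by auto
      show "pullback \<mu> (dpole q k) = dpole q' (- k * (a * t + b) / c)"
        unfolding \<mu>
        by (rule pullback_mobius_eqI[OF D]) (use c in \<open>auto simp: q z D' power2_eq_square\<close>)
      show "primitive q k (\<mu> x) = primitive q' (- k * (a * t + b) / c) x + k * a / c" if "x \<noteq> q'" for x
      proof (cases x)
        case (Pt w)
        then have "w \<noteq> t" using that q by auto
        then have "k * ((a * w + b) / (c * (w - t))) = k * (a * t + b) / c / (w - t) + k * a / c"
          using c by (simp add: divide_simps) (simp add: algebra_simps)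
        then show ?thesis using Pt q c \<open>w \<noteq> t\<close> by (simp add: \<mu> z moebius_def)
      qed (use q c in \<open>auto simp: \<mu>\<close>)
    qed
  next
    fix s assume q: "q = Pt s" "q' = Infinity"
    then have c: "c \<noteq> 0" and a: "a = s * c" using assms(2) \<mu> by (auto split: if_splits)
    \<comment> \<open>The linear terms of the numerator of \<mu>(z) - s cancel, and \<open>m\<close>
      is what remains: \<mu>(z) - s = m / (c z + d).\<close>
    define m where "m = b - s * d"
    have D': "a * d - b * c = - c * m" by (simp add: a m_def algebra_simps)
    have m: "m \<noteq> 0" using D D' by auto
    have diff: "(a * z + b) / (c * z + d) - s = m / (c * z + d)" if "c * z + d \<noteq> 0" for z
      using that by (simp add: a m_def field_simps)
    show thesis
    proof (rule that)
      show "- k * c / m \<noteq> 0" using c m assms(3) by auto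
      show "pullback \<mu> (dpole q k) = dpole q' (- k * c / m)"
        unfolding \<mu>
        by (rule pullback_mobius_eqI[OF D])
          (use m in \<open>auto simp: q diff D' power2_eq_square power_divide\<close>)
      show "primitive q k (\<mu> x) = primitive q' (- k * c / m) x + - k * d / m"
        if "x \<noteq> q'" for x
      proof (cases x)
        case (Pt w)
        have "- k * c / m * w + - k * d / m = - k / m * (c * w + d)"
          using m by (simp add: field_simps)
        then have "primitive q' (- k * c / m) x + - k * d / m = - k / m * (c * w + d)"
          using Pt q by simp
        then show ?thesis using Pt q by (auto simp: \<mu> moebius_def diff)
      qed (use q that in auto)
    qed
  next
    fix s t assume q: "q = Pt s" "q' = Pt t"
    then have ct: "c * t + d \<noteq> 0" and s: "(a * t + b) / (c * t + d) = s"
      using assms(2) \<mu> by (auto simp: moebius_def split: if_splits)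
    \<comment> \<open>Since \<mu>(t) = s, the numerator of \<mu>(z) - s is divisible by z - t;
      \<open>m\<close> is the quotient.\<close>
    define m where "m = a - s * c"
    have at: "a * t + b = s * (c * t + d)" using ct s by (auto simp: field_simps)
    then have b: "b = s * (c * t + d) - a * t" by (simp add: algebra_simps)
    have D': "a * d - b * c = m * (c * t + d)" by (simp add: b m_def algebra_simps)
    have m: "m \<noteq> 0" using D D' by auto
    have diff: "(a * z + b) / (c * z + d) - s = m * (z - t) / (c * z + d)" if "c * z + d \<noteq> 0" for z
      using that by (simp add: b m_def field_simps)
    show thesis
    proof (rule that)
      show "k * (c * t + d) / m \<noteq> 0" using ct m assms(3) by auto
      show "pullback \<mu> (dpole q k) = dpole q' (k * (c * t + d) / m)"
        unfolding \<mu>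
        by (rule pullback_mobius_eqI[OF D])
          (use m in \<open>auto simp: q diff D' power2_eq_square power_divide\<close>)
      show "primitive q k (\<mu> x) = primitive q' (k * (c * t + d) / m) x + - k * c / m"
        if "x \<noteq> q'" for x
      proof (cases x)
        case (Pt w)
        then have wt: "w \<noteq> t" using that q by auto
        then have *: "- k / (m * (w - t) / (c * w + d)) = - (k * (c * t + d) / m) / (w - t) + - k * c / m"
          using m by (simp add: divide_simps) (simp add: algebra_simps)
        show ?thesis
        proof (cases "c * w + d = 0")
          case True
          with * show ?thesis using Pt q by (simp add: \<mu>)
        next
          case False
          with * show ?thesis using Pt q by (simp add: \<mu> moebius_def diff)
        qed
      next
        case Infinity
        show ?thesis
        proof (cases "c = 0")
          case False
          then have "a / c - s = m / c" by (simp add: m_def field_simps)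
          then show ?thesis using Infinity q False by (simp add: \<mu>)
        qed (use Infinity q in \<open>simp add: \<mu>\<close>)
      qed
    qed
  qed
qed

lemma mobius_id: "mobius 1 0 0 1 = id"
proof
  fix x show "mobius 1 0 0 1 x = id x" by (cases x) (auto simp: moebius_def)
qed

lemma P1_aut_id: "P1_aut id"
  unfolding P1_aut_def by (intro exI[of _ 1] exI[of _ 0]) (auto simp: mobius_id)

lemma P1_aut_inj:
  assumes "P1_aut \<mu>" shows "inj \<mu>"
proof -
  obtain a b c d where D: "a * d - b * c \<noteq> 0" and \<mu>: "\<mu> = mobius a b c d"
    using assms(1) unfolding P1_aut_def by blast
  \<comment> \<open>The adjugate matrix represents the inverse, since scalar matrices act
    trivially.\<close>
  have "mobius d (-b) (-c) a (\<mu> x) = x" for x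
  proof (cases x)
    case (Pt z)
    show ?thesis
    proof (cases "c * z + d = 0")
      case True
      then have c: "c \<noteq> 0" and d: "d = - (c * z)" using D by (auto simp: add_eq_0_iff)
      then show ?thesis using Pt by (simp add: \<mu>)
    next
      case False
      then have "- c * ((a * z + b) / (c * z + d)) + a = (a * d - b * c) / (c * z + d)"
        by (simp add: field_simps)
      then have "- c * moebius a b c d z + a \<noteq> 0" using D False by (simp add: moebius_def)
      moreover have "moebius d (-b) (-c) a (moebius a b c d z) = z"
        using D False by (intro moebius_inverse) auto
      ultimately show ?thesis using Pt False by (simp add: \<mu>)
    qed
  next
    case Infinity
    show ?thesis
    proof (cases "c = 0")
      case False
      then show ?thesis using Infinity D by (simp add: \<mu> moebius_def)
    qed (use Infinity in \<open>simp add: \<mu>\<close>)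
  qed
  then show ?thesis by (metis injI)
qed

lemma P1_aut_parametrization:
  obtains \<mu> where "P1_aut \<mu>" "\<mu> Infinity = q" "\<And>x. x \<noteq> q \<Longrightarrow> \<exists>z. x = \<mu> (Pt z)"
proof (cases q)
  case Infinity
  show thesis
  proof (rule that[of id])
    show "\<exists>z. x = id (Pt z)" if "x \<noteq> q" for x using that Infinity by (cases x) auto
  qed (auto simp: P1_aut_id Infinity)
next
  case (Pt s)
  \<comment> \<open>The chosen map is z |-> s + 1 / z, which sends infinity to
    \<open>s\<close>.\<close>
  show thesis
  proof (rule that[of "mobius s 1 1 0"])
    show "P1_aut (mobius s 1 1 0)"
      unfolding P1_aut_def
      by (rule exI[of _ s], rule exI[of _ 1], rule exI[of _ 1], rule exI[of _ 0]) simp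
    show "\<exists>z. x = mobius s 1 1 0 (Pt z)" if "x \<noteq> q" for x
    proof (cases x)
      case (Pt w)
      then have "w \<noteq> s" using that \<open>q = Pt s\<close> by auto
      then show ?thesis using Pt by (intro exI[of _ "1 / (w - s)"]) (auto simp: moebius_def field_simps)
    next
      case Infinity
      then show ?thesis by (intro exI[of _ 0]) auto
    qed
  qed (use Pt in auto)
qed

text \<open>Pulling back along a parametrization with the pole at infinity makes the differential
  constant on the plane, where the integral depends only on the endpoints. The additive constant of
  the primitives cancels in the difference.\<close>

lemma diff_integral_dpole:
  assumes "k \<noteq> 0" "x \<noteq> q" "y \<noteq> q"
  shows "diff_integral (dpole q k) q x y = primitive q k y - primitive q k x"
proof -
  have *: "(pullback \<mu> (dpole q k) has_contour_integral (primitive q k y - primitive q k x)) \<gamma>"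
    if hyps: "P1_aut \<mu>" "\<mu> Infinity = q" "valid_path \<gamma>"
      "\<mu> (Pt (pathstart \<gamma>)) = x" "\<mu> (Pt (pathfinish \<gamma>)) = y" for \<mu> \<gamma>
  proof -
    obtain k' e where k': "pullback \<mu> (dpole q k) = dpole Infinity k'"
      "\<And>x. x \<noteq> Infinity \<Longrightarrow> primitive q k (\<mu> x) = primitive Infinity k' x + e"
      using pullback_dpole[OF hyps(1,2) assms(1)] by metis
    have "((\<lambda>z. k') has_contour_integral (k' * pathfinish \<gamma> - k' * pathstart \<gamma>)) \<gamma>"
      by (rule contour_integral_primitive[where S=UNIV]) (use hyps(3) in \<open>auto intro!: derivative_eq_intros\<close>)
    moreover have "primitive q k y - primitive q k x = k' * pathfinish \<gamma> - k' * pathstart \<gamma>"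
      using k'(2)[of "Pt (pathfinish \<gamma>)"] k'(2)[of "Pt (pathstart \<gamma>)"] hyps by simp
    moreover have "dpole Infinity k' = (\<lambda>z. k')" by (simp add: fun_eq_iff)
    ultimately show ?thesis using k'(1) by simp
  qed
  \<comment> \<open>An admissible parametrization and path must exist: otherwise every number would
    satisfy the condition in \<open>THE\<close> vacuously.\<close>
  obtain \<mu> z w where \<mu>: "P1_aut \<mu>" "\<mu> Infinity = q" "x = \<mu> (Pt z)" "y = \<mu> (Pt w)"
    using P1_aut_parametrization[of q] assms(2,3) by metis
  show ?thesis
    unfolding diff_integral_def
  proof (rule the_equality)
    fix I
    assume "\<forall>\<mu> \<gamma>. P1_aut \<mu> \<and> \<mu> Infinity = q \<and> valid_path \<gamma> \<and>
        \<mu> (Pt (pathstart \<gamma>)) = x \<and> \<mu> (Pt (pathfinish \<gamma>)) = y \<longrightarrow>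
        (pullback \<mu> (dpole q k) has_contour_integral I) \<gamma>"
    then have "(pullback \<mu> (dpole q k) has_contour_integral I) (linepath z w)"
      using \<mu> by simp
    moreover have "(pullback \<mu> (dpole q k) has_contour_integral (primitive q k y - primitive q k x))
        (linepath z w)"
      using * \<mu> by simp
    ultimately show "I = primitive q k y - primitive q k x"
      by (rule has_contour_integral_unique)
  qed (use * in blast)
qed

lemma primitive_inject:
  assumes "k \<noteq> 0" "x \<noteq> q" "y \<noteq> q"
  shows "primitive q k x = primitive q k y \<longleftrightarrow> x = y"
  using assms by (cases q; cases x; cases y) (auto simp: divide_simps)

section \<open>Classification of differentials with a single double pole\<close>

text \<open>Near 0, \<open>at_infty \<omega>\<close> is -\<omega>(1/w) / w^2, so the order at
  infinity of the function \<omega> exceeds that of the differential by 2. The bound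
  \<open>R\<close> makes \<omega>(1/w) analytic near 0, so that \<open>remove_sings\<close> changes
  nothing there; \<open>nz\<close> rules out a vanishing expansion, for which the order would be
  meaningless.\<close>

lemma at_infty_expansion:
  fixes \<omega> :: "complex \<Rightarrow> complex"
  assumes an: "\<And>z. R < norm z \<Longrightarrow> \<omega> analytic_on {z}"
    and mero: "at_infty \<omega> meromorphic_on {0}"
    and nz: "\<And>z. \<not> eventually (\<lambda>w. \<omega> w = 0) (at z)"
  obtains G where "G 0 \<noteq> 0" "isCont G 0"
    "eventually (\<lambda>w. \<omega> (1 / w) = G w * w powi (zorder (at_infty \<omega>) 0 + 2)) (at 0)"
proof -
  define f where "f = (\<lambda>z. \<omega> (affine_coord (mobius 0 1 1 0 (Pt z))) *
      deriv (\<lambda>w. affine_coord (mobius 0 1 1 0 (Pt w))) z)"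
  \<comment> \<open>Inversion maps the punctured ball of this radius into the points of norm greater
    than \<open>R\<close>; adding 1 keeps the denominator nonzero.\<close>
  define r where "r = 1 / (1 + \<bar>R\<bar>)"
  have r: "r > 0" by (simp add: r_def)
  have big: "R < norm (1 / z)" if "z \<in> ball 0 r - {0}" for z :: complex
  proof -
    have "norm z > 0" "norm z * (1 + \<bar>R\<bar>) < 1" using that by (auto simp: r_def field_simps)
    then have "\<bar>R\<bar> * norm z < 1" by (auto simp: distrib_left mult.commute intro: less_trans[rotated])
    then have "\<bar>R\<bar> < norm (1 / z)" using \<open>norm z > 0\<close> by (simp add: norm_divide field_simps)
    then show ?thesis by linarith
  qed
  have f: "f z = - \<omega> (1 / z) / z\<^sup>2" if "z \<noteq> 0" for z
    using that moebius_affine_coord[of 1 z 0 0 1] unfolding f_def by simp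
  have A: "at_infty \<omega> z = - \<omega> (1 / z) / z\<^sup>2" if z: "z \<in> ball 0 r - {0}" for z
  proof -
    have "(\<lambda>z. - (\<omega> \<circ> (\<lambda>z. 1 / z)) z / z\<^sup>2) analytic_on {z}"
      using z by (intro analytic_intros analytic_on_compose) (auto intro!: an big[OF z] analytic_intros)
    moreover have "eventually (\<lambda>z. f z = - (\<omega> \<circ> (\<lambda>z. 1 / z)) z / z\<^sup>2) (nhds z)"
    proof -
      have "eventually (\<lambda>w. w \<in> - {0}) (nhds z)" using z by (intro eventually_nhds_in_open) auto
      then show ?thesis by eventually_elim (simp add: f)
    qed
    ultimately have "f analytic_on {z}" by (subst analytic_at_cong[OF _ refl])
    then have "remove_sings f z = f z" by simp
    moreover have "at_infty \<omega> = remove_sings f" unfolding at_infty_def pullback_def f_def ..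
    ultimately show ?thesis using z f[of z] by simp
  qed
  have ball_ev: "eventually (\<lambda>w. w \<in> ball 0 r - {0}) (at (0::complex))"
    using r by (intro eventually_at_in_open) auto
  \<comment> \<open>If the form at infinity vanished near 0, then \<omega> would vanish outside a
    large disk, hence near some finite point, against \<open>nz\<close>.\<close>
  have "\<exists>\<^sub>F w in at 0. at_infty \<omega> w \<noteq> 0"
  proof (rule ccontr)
    assume "\<not> ?thesis"
    then have "eventually (\<lambda>w. at_infty \<omega> w = 0) (at 0)" by (simp add: not_frequently)
    with ball_ev have "eventually (\<lambda>w. w \<in> ball 0 r - {0} \<and> at_infty \<omega> w = 0) (at 0)"
      by eventually_elim auto
    then have "eventually (\<lambda>w. \<omega> (inverse w) = 0) (at 0)"
    proof eventually_elim
      case (elim w)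
      then show ?case using A[of w] by (auto simp: inverse_eq_divide)
    qed
    then have "eventually (\<lambda>w. \<omega> w = 0) at_infinity"
      by (simp add: at_to_infinity eventually_filtermap)
    then obtain B where B: "\<And>w. norm w \<ge> B \<Longrightarrow> \<omega> w = 0" by (auto simp: eventually_at_infinity)
    define z where "z = complex_of_real (\<bar>B\<bar> + 1)"
    have "norm z > B" unfolding z_def norm_of_real by linarith
    then have "eventually (\<lambda>w. norm w > B) (nhds z)"
      using eventually_nhds_in_open[of "{w. norm w > B}" z]
      by (auto simp: open_Collect_less continuous_intros)
    then have "eventually (\<lambda>w. \<omega> w = 0) (nhds z)"
      by eventually_elim (use B in auto)
    then show False using nz[of z] filter_leD[OF at_within_le_nhds] by blast
  qed
  moreover have "isolated_singularity_at (at_infty \<omega>) 0" "not_essential (at_infty \<omega>) 0"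
    using mero by (auto simp: meromorphic_at_iff)
  ultimately obtain e where e: "e > 0" "zor_poly (at_infty \<omega>) 0 0 \<noteq> 0"
    "zor_poly (at_infty \<omega>) 0 holomorphic_on cball 0 e"
    "\<And>w. w \<in> cball 0 e - {0} \<Longrightarrow>
      at_infty \<omega> w = zor_poly (at_infty \<omega>) 0 w * w powi (zorder (at_infty \<omega>) 0)"
    using zorder_exist[of "at_infty \<omega>" 0] by auto
  show thesis
  proof (rule that[of "\<lambda>w. - zor_poly (at_infty \<omega>) 0 w"])
    show "- zor_poly (at_infty \<omega>) 0 0 \<noteq> 0" using e by simp
    have "zor_poly (at_infty \<omega>) 0 holomorphic_on ball 0 e" using e(3) holomorphic_on_subset by fastforce
    then have "isCont (zor_poly (at_infty \<omega>) 0) 0"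
      using e(1) by (intro holomorphic_on_imp_continuous_on[THEN continuous_on_interior]) auto
    then show "isCont (\<lambda>w. - zor_poly (at_infty \<omega>) 0 w) 0" by (intro continuous_intros)
    have "eventually (\<lambda>w. w \<in> ball 0 e - {0}) (at (0::complex))"
      using e by (intro eventually_at_in_open) auto
    with ball_ev show "\<forall>\<^sub>F w in at 0. \<omega> (1 / w) =
        - zor_poly (at_infty \<omega>) 0 w * w powi (zorder (at_infty \<omega>) 0 + 2)"
    proof eventually_elim
      case (elim w)
      then have w: "w \<noteq> 0" "at_infty \<omega> w = zor_poly (at_infty \<omega>) 0 w * w powi (zorder (at_infty \<omega>) 0)"
        using e(4)[of w] by auto
      have "\<omega> (1 / w) = - at_infty \<omega> w * w\<^sup>2" using A[of w] elim w by simp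
      also have "\<dots> = - zor_poly (at_infty \<omega>) 0 w * w powi (zorder (at_infty \<omega>) 0 + 2)"
        using w by (simp add: power_int_add)
      finally show ?case .
    qed
  qed
qed

text \<open>Liouville's theorem: with the pole removed, by multiplying with (z - a)^2 when it is a
  finite point \<open>a\<close>, the coefficient function is entire and has a finite nonzero limit
  at infinity. That limit is \<open>G 0\<close>, and it becomes the constant
  \<open>k\<close>.\<close>

lemma only_double_pole_imp_dpole:
  assumes "only_double_pole \<omega> q"
  obtains k where "k \<noteq> 0" "\<omega> = dpole q k"
proof -
  have nm: "\<omega> nicely_meromorphic_on UNIV" and mi: "at_infty \<omega> meromorphic_on {0}"
    and n0: "\<omega> \<noteq> (\<lambda>z. 0)" and dq: "diff_order \<omega> q = -2"
    and dx: "\<And>x. x \<noteq> q \<Longrightarrow> diff_order \<omega> x = 0"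
    using assms unfolding only_double_pole_def mero_diff_def by auto
  have mero: "\<omega> meromorphic_on {z}" for z
    using nm unfolding nicely_meromorphic_on_def using meromorphic_on_subset by blast
  have nz: "\<not> eventually (\<lambda>w. \<omega> w = 0) (at z)" for z
  proof
    assume "eventually (\<lambda>w. \<omega> w = 0) (at z)"
    then have "frequently (\<lambda>w. \<omega> w = 0) (at z)" by (intro eventually_frequently) auto
    from frequently_eq_meromorphic_imp_constant[OF this nm] have "\<omega> w = 0" for w by auto
    with n0 show False by auto
  qed
  then have fz: "\<exists>\<^sub>F w in at z. \<omega> w \<noteq> 0" for z by (simp add: frequently_def)
  have sing: "isolated_singularity_at \<omega> z" "not_essential \<omega> z" for z
    using mero by (auto simp: meromorphic_at_iff)
  have an: "\<omega> analytic_on {z}" if "Pt z \<noteq> q" for z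
  proof -
    have "zorder \<omega> z = 0" using dx[OF that] by simp
    then have "\<not> is_pole \<omega> z"
      using sing isolated_pole_imp_neg_zorder by fastforce
    then show ?thesis using nm nicely_meromorphic_on_imp_analytic_at by blast
  qed
  show thesis
  proof (cases q)
    case Infinity
    have "zorder (at_infty \<omega>) 0 + 2 = 0" using dq Infinity by simp
    moreover have "\<omega> analytic_on {z}" for z using an Infinity by auto
    ultimately obtain G where G: "G 0 \<noteq> 0" "isCont G 0" "eventually (\<lambda>w. \<omega> (1 / w) = G w) (at 0)"
      using at_infty_expansion[of 0 \<omega>, OF _ mi nz] by auto
    have "((\<lambda>w. \<omega> (1 / w)) \<longlongrightarrow> G 0) (at 0)"
      using G(2,3) by (simp add: isCont_def tendsto_cong)
    moreover have "\<omega> holomorphic_on UNIV"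
      using an Infinity analytic_on_analytic_at analytic_imp_holomorphic by blast
    ultimately have "\<omega> z = G 0" for z
      using Liouville_weak lim_zero_infinity by blast
    then show thesis using that[of "G 0"] G(1) Infinity by (auto simp: fun_eq_iff)
  next
    case (Pt a)
    have "zorder (at_infty \<omega>) 0 = 0" using dx[of Infinity] Pt by simp
    moreover have "\<omega> analytic_on {z}" if "norm a < norm z" for z using an[of z] Pt that by auto
    ultimately obtain G where G: "G 0 \<noteq> 0" "isCont G 0"
      "eventually (\<lambda>w. \<omega> (1 / w) = G w * w powi 2) (at 0)"
      using at_infty_expansion[of "norm a" \<omega>, OF _ mi nz] by auto
    define h where "h = (\<lambda>z. \<omega> z * (z - a)\<^sup>2)"
    have za: "zorder \<omega> a = -2" using dq Pt by simp
    have pole: "is_pole \<omega> a"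
      by (rule neg_zorder_imp_is_pole) (use sing za fz in auto)
    obtain e where e: "e > 0" "zor_poly \<omega> a holomorphic_on cball a e"
      "\<And>w. w \<in> cball a e - {a} \<Longrightarrow> \<omega> w = zor_poly \<omega> a w * (w - a) powi (- 2)"
      using zorder_exist[OF sing(1) sing(2) fz, of a] za by auto
    have h_an: "h analytic_on {z}" if "z \<noteq> a" for z
      unfolding h_def using an[of z] that Pt by (auto intro!: analytic_intros)
    have h_eq: "h w = zor_poly \<omega> a w" if "w \<in> cball a e - {a}" for w
      using e(3)[OF that] that by (simp add: h_def power_int_minus)
    define g where "g = (\<lambda>z. if z = a then zor_poly \<omega> a a else h z)"
    have "g analytic_on {z}" for z
    proof (cases "z = a")
      case True
      have "zor_poly \<omega> a holomorphic_on ball a e" using e(2) holomorphic_on_subset by fastforce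
      then have "g holomorphic_on ball a e"
        by (rule holomorphic_transform) (use h_eq in \<open>auto simp: g_def\<close>)
      then show ?thesis using True e(1) analytic_at by (metis centre_in_ball open_ball)
    next
      case False
      have "eventually (\<lambda>w. w \<in> - {a}) (nhds z)" using False by (intro eventually_nhds_in_open) auto
      then have "eventually (\<lambda>w. g w = h w) (nhds z)" by eventually_elim (auto simp: g_def)
      then show ?thesis using h_an[OF False] analytic_at_cong by blast
    qed
    then have ghol: "g holomorphic_on UNIV"
      using analytic_on_analytic_at analytic_imp_holomorphic by blast
    \<comment> \<open>With z = 1/w the factor (z - a)^2 equals (1 - a w)^2 / w^2, which cancels the
      w^2 of the expansion at infinity.\<close>
    have "((\<lambda>w. G w * (1 - a * w)\<^sup>2) \<longlongrightarrow> G 0 * (1 - a * 0)\<^sup>2) (at 0)"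
      using G(2) by (intro tendsto_intros) (simp add: isCont_def)
    moreover have "eventually (\<lambda>w. g (1 / w) = G w * (1 - a * w)\<^sup>2) (at 0)"
    proof -
      have "eventually (\<lambda>w. 1 - a * w \<noteq> 0) (at 0)"
      proof (rule tendsto_imp_eventually_ne)
        show "((\<lambda>w. 1 - a * w) \<longlongrightarrow> 1 - a * 0) (at 0)" by (intro tendsto_intros)
      qed simp
      moreover have "eventually (\<lambda>w. w \<noteq> 0) (at (0::complex))" by (simp add: eventually_neq_at_within)
      ultimately show ?thesis using G(3)
      proof eventually_elim
        case (elim w)
        then have "1 / w \<noteq> a" by (auto simp: field_simps)
        moreover have "(1 / w - a) = (1 - a * w) / w" using elim by (simp add: field_simps)
        ultimately show ?case using elim by (simp add: g_def h_def power_divide)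
      qed
    qed
    ultimately have "((\<lambda>w. g (1 / w)) \<longlongrightarrow> G 0) (at 0)" by (simp add: tendsto_cong)
    then have g: "g z = G 0" for z
      by (intro Liouville_weak[OF ghol] lim_zero_infinity)
    have "\<omega> z = dpole q (G 0) z" for z
    proof (cases "z = a")
      case True
      have "\<omega> a = 0" using is_pole_zero_at_nicely_mero[OF nm pole] by simp
      then show ?thesis using True Pt by simp
    next
      case False
      then have "\<omega> z * (z - a)\<^sup>2 = G 0" using g[of z] by (simp add: g_def h_def)
      then show ?thesis using False Pt by (simp add: field_simps)
    qed
    then show thesis using that[of "G 0"] G(1) by auto
  qed
qed

lemma dpole_scale: "(\<lambda>z. c * dpole q k z) = dpole q (c * k)"
  by (cases q) (auto simp: fun_eq_iff)

lemma primitive_scale: "primitive q (c * k) x = c * primitive q k x"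
  by (cases q; cases x) auto

lemma dpole_inject: "dpole q k = dpole q k' \<Longrightarrow> k = k'"
proof (cases q)
  case (Pt a)
  assume "dpole q k = dpole q k'"
  from fun_cong[OF this, of "a + 1"] show ?thesis using Pt by simp
qed (auto simp: fun_eq_iff)

lemma diff_integral_eq_0_iff:
  assumes "only_double_pole \<omega> q" "x \<noteq> q" "y \<noteq> q"
  shows "diff_integral \<omega> q x y = 0 \<longleftrightarrow> x = y"
proof -
  obtain k where "k \<noteq> 0" "\<omega> = dpole q k" using only_double_pole_imp_dpole[OF assms(1)] .
  then show ?thesis
    using diff_integral_dpole[of k x q y] primitive_inject[of k y q x] assms by auto
qed

text \<open>Change of variables. Comparing coefficients of the two \<open>dpole\<close> forms gives
  \<open>k'' = c * k\<close>, and the constant between the primitives cancels in the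
  difference.\<close>

lemma diff_integral_pullback:
  assumes "only_double_pole \<omega> q" "only_double_pole \<omega>' (\<mu> q)" "P1_aut \<mu>"
    and c: "pullback \<mu> \<omega>' = (\<lambda>z. c * \<omega> z)" and "x \<noteq> q" "y \<noteq> q"
  shows "diff_integral \<omega>' (\<mu> q) (\<mu> x) (\<mu> y) = c * diff_integral \<omega> q x y"
proof -
  obtain k where k: "k \<noteq> 0" "\<omega> = dpole q k" using only_double_pole_imp_dpole[OF assms(1)] .
  obtain k' where k': "k' \<noteq> 0" "\<omega>' = dpole (\<mu> q) k'" using only_double_pole_imp_dpole[OF assms(2)] .
  obtain k'' e where k'': "pullback \<mu> (dpole (\<mu> q) k') = dpole q k''"
    "\<And>x. x \<noteq> q \<Longrightarrow> primitive (\<mu> q) k' (\<mu> x) = primitive q k'' x + e"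
    using pullback_dpole[OF assms(3) refl k'(1)] by metis
  have "k'' = c * k"
    using c k k' k''(1) by (metis dpole_scale dpole_inject)
  moreover have "\<mu> x \<noteq> \<mu> q" "\<mu> y \<noteq> \<mu> q"
    using P1_aut_inj[OF assms(3)] assms(5,6) by (auto dest: injD)
  ultimately show ?thesis
    using diff_integral_dpole[OF k'(1), of "\<mu> x" "\<mu> q" "\<mu> y"] diff_integral_dpole[OF k(1), of x q y]
      assms(5,6) k(2) k'(2) k''(2)[of x] k''(2)[of y]
    by (simp add: primitive_scale right_diff_distrib)
qed

text \<open>In a coordinate with the pole at infinity the differential is a constant multiple of dz.
  This is what makes z_ij affine in the parameter when points move linearly.\<close>

lemma diff_integral_translate:
  assumes "only_double_pole \<omega> q" "P1_aut \<mu>" "\<mu> Infinity = q"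
  obtains k where "\<And>z w. diff_integral \<omega> q (\<mu> (Pt z)) (\<mu> (Pt w)) = k * (w - z)"
proof -
  obtain k where k: "k \<noteq> 0" "\<omega> = dpole q k" using only_double_pole_imp_dpole[OF assms(1)] .
  obtain k' e where k': "\<And>x. x \<noteq> Infinity \<Longrightarrow> primitive q k (\<mu> x) = primitive Infinity k' x + e"
    using pullback_dpole[OF assms(2,3) k(1)] by metis
  have "\<mu> (Pt z) \<noteq> q" for z
    using P1_aut_inj[OF assms(2)] assms(3) by (metis P1.distinct(1) injD)
  then show thesis
    using that[of k'] diff_integral_dpole[OF k(1)] k(2) k'[of "Pt _"] by (simp add: algebra_simps)
qed

lemma pullback_id:
  assumes "only_double_pole \<omega> q" shows "pullback id \<omega> = \<omega>"
proof -
  obtain k where k: "k \<noteq> 0" "\<omega> = dpole q k" using only_double_pole_imp_dpole[OF assms(1)] .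
  have "pullback (mobius 1 0 0 1) \<omega> = dpole q k"
    by (rule pullback_mobius_eqI) (auto simp: k)
  then show ?thesis by (simp add: mobius_id k)
qed

section \<open>Level trees\<close>

text \<open>Stated for a record scheme so that a multiscaled line itself can be an instance, without
  passing to its dual tree.\<close>

locale level_tree =
  fixes T :: "'r ltree_scheme"
  assumes tree: "is_tree T"
    and preorder: "preorder_on (verts T) (pre T)"
    and total: "total_on (verts T) (pre T)"
    and ex1_descending: "\<And>v. v \<in> verts T \<Longrightarrow> v \<noteq> vroot T \<Longrightarrow> \<exists>!w. (v, w) \<in> adj T \<and> strict T w v"
    and terminal_equiv: "\<And>v w. terminal T v \<Longrightarrow> terminal T w \<Longrightarrow> (v, w) \<in> equiv_rel T"
begin

definition parent :: "nat \<Rightarrow> nat" where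
  "parent v = (THE w. (v, w) \<in> adj T \<and> strict T w v)"

lemma finite_verts [simp]: "finite (verts T)" and root_vert [simp]: "vroot T \<in> verts T"
  and adj_sym: "(u, v) \<in> adj T \<Longrightarrow> (v, u) \<in> adj T"
  and adj_irrefl: "(u, u) \<notin> adj T"
  and adj_verts: "(u, v) \<in> adj T \<Longrightarrow> u \<in> verts T \<and> v \<in> verts T"
  and ex1_path: "u \<in> verts T \<Longrightarrow> v \<in> verts T \<Longrightarrow> \<exists>!xs. simple_path T u v xs"
  using tree unfolding is_tree_def by (auto dest: symD irreflD)

lemma simple_path_unique: "simple_path T u v xs \<Longrightarrow> simple_path T u v ys \<Longrightarrow> xs = ys"
  using ex1_path[of u v] unfolding simple_path_def
  by (metis (no_types, lifting) hd_in_set last_in_set simple_path_def subsetD)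

lemma pre_refl: "v \<in> verts T \<Longrightarrow> (v, v) \<in> pre T"
  and pre_trans: "(u, v) \<in> pre T \<Longrightarrow> (v, w) \<in> pre T \<Longrightarrow> (u, w) \<in> pre T"
  and pre_verts: "(u, v) \<in> pre T \<Longrightarrow> u \<in> verts T \<and> v \<in> verts T"
  using preorder unfolding preorder_on_def by (auto dest: refl_onD transD)

lemma pre_total: "u \<in> verts T \<Longrightarrow> v \<in> verts T \<Longrightarrow> (u, v) \<in> pre T \<or> (v, u) \<in> pre T"
  using total pre_refl unfolding total_on_def by metis

lemma strict_trans: "strict T u v \<Longrightarrow> strict T v w \<Longrightarrow> strict T u w"
  and pre_strict_trans: "(u, v) \<in> pre T \<Longrightarrow> strict T v w \<Longrightarrow> strict T u w"
  and strict_pre_trans: "strict T u v \<Longrightarrow> (v, w) \<in> pre T \<Longrightarrow> strict T u w"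
  and strict_irrefl: "\<not> strict T u u"
  and strict_verts: "strict T u v \<Longrightarrow> u \<in> verts T \<and> v \<in> verts T"
  unfolding strict_def using pre_trans pre_verts by blast+

lemma strict_induct [consumes 1, case_names less]:
  assumes "v \<in> verts T" "\<And>v. v \<in> verts T \<Longrightarrow> (\<And>u. strict T u v \<Longrightarrow> P u) \<Longrightarrow> P v"
  shows "P v"
  using assms(1)
proof (induction "card {w. strict T w v}" arbitrary: v rule: less_induct)
  case less
  have "P u" if "strict T u v" for u
  proof (rule less.hyps)
    have "finite {w. strict T w v}"
      by (rule finite_subset[OF _ finite_verts]) (auto dest: strict_verts)
    moreover have "{w. strict T w u} \<subset> {w. strict T w v}"
      using that strict_trans strict_irrefl by blast
    ultimately show "card {w. strict T w u} < card {w. strict T w v}" by (rule psubset_card_mono)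
  qed (use that strict_verts in blast)
  then show ?case using assms(2) less.prems by blast
qed

lemma strict_induct_up [consumes 1, case_names less]:
  assumes "v \<in> verts T" "\<And>v. v \<in> verts T \<Longrightarrow> (\<And>u. strict T v u \<Longrightarrow> P u) \<Longrightarrow> P v"
  shows "P v"
  using assms(1)
proof (induction "card {w. strict T v w}" arbitrary: v rule: less_induct)
  case less
  have "P u" if "strict T v u" for u
  proof (rule less.hyps)
    have "finite {w. strict T v w}"
      by (rule finite_subset[OF _ finite_verts]) (auto dest: strict_verts)
    moreover have "{w. strict T u w} \<subset> {w. strict T v w}"
      using that strict_trans strict_irrefl by blast
    ultimately show "card {w. strict T u w} < card {w. strict T v w}" by (rule psubset_card_mono)
  qed (use that strict_verts in blast)
  then show ?case using assms(2) less.prems by blast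
qed

lemma parent:
  assumes "v \<in> verts T" "v \<noteq> vroot T"
  shows "(v, parent v) \<in> adj T" "strict T (parent v) v" "parent v \<in> verts T"
    "\<And>w. (v, w) \<in> adj T \<Longrightarrow> strict T w v \<Longrightarrow> w = parent v"
proof -
  have *: "(v, parent v) \<in> adj T \<and> strict T (parent v) v"
    unfolding parent_def by (rule theI'[OF ex1_descending[OF assms]])
  then show "(v, parent v) \<in> adj T" "strict T (parent v) v" by auto
  then show "parent v \<in> verts T" using adj_verts by blast
  show "w = parent v" if "(v, w) \<in> adj T" "strict T w v" for w
    using ex1_descending[OF assms] * that by blast
qed

lemma simple_path_Cons:
  assumes "simple_path T u v xs" "(w, u) \<in> adj T" "w \<notin> set xs"
  shows "simple_path T w v (w # xs)"
  using assms adj_verts unfolding simple_path_def by (auto simp: successively_Cons)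

lemma simple_path_self: "v \<in> verts T \<Longrightarrow> simple_path T v v [v]"
  by (auto simp: simple_path_def)

text \<open>Descending from parent to parent never repeats a vertex, so it traces the simple path to the root.\<close>

lemma ex_descending_path:
  assumes "v \<in> verts T"
  shows "\<exists>xs. simple_path T v (vroot T) xs \<and> (\<forall>x\<in>set xs. (x, v) \<in> pre T)"
  using assms
proof (induction rule: strict_induct)
  case (less v)
  show ?case
  proof (cases "v = vroot T")
    case True
    then show ?thesis using simple_path_self less.hyps pre_refl by (intro exI[of _ "[v]"]) auto
  next
    case False
    note p = parent[OF less.hyps False]
    obtain xs where xs: "simple_path T (parent v) (vroot T) xs" "\<forall>x\<in>set xs. (x, parent v) \<in> pre T"
      using less.IH[OF p(2)] by blast
    have "strict T x v" if "x \<in> set xs" for x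
      using that xs(2) p(2) pre_strict_trans by blast
    then have "v \<notin> set xs" "\<forall>x\<in>set (v # xs). (x, v) \<in> pre T"
      using strict_irrefl pre_refl[OF less.hyps] unfolding strict_def by auto
    then show ?thesis using simple_path_Cons[OF xs(1) p(1)] by blast
  qed
qed

lemma path_to_root:
  assumes "v \<in> verts T" "v \<noteq> vroot T" "simple_path T v (vroot T) zs"
  obtains xs where "zs = v # xs" "simple_path T (parent v) (vroot T) xs"
proof -
  note p = parent[OF assms(1,2)]
  obtain xs where xs: "simple_path T (parent v) (vroot T) xs" "\<forall>x\<in>set xs. (x, parent v) \<in> pre T"
    using ex_descending_path[OF p(3)] by blast
  have "v \<notin> set xs" using xs(2) p(2) unfolding strict_def by blast
  then have "simple_path T v (vroot T) (v # xs)" using simple_path_Cons[OF xs(1) p(1)] by blast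
  then show thesis using that[of xs] simple_path_unique[OF assms(3)] xs(1) by blast
qed

section \<open>Ancestors and meets\<close>

lemma ancestor_verts: "ancestor T x v \<Longrightarrow> x \<in> verts T \<and> v \<in> verts T"
  unfolding ancestor_def on_path_def simple_path_def by (metis hd_in_set subsetD)

lemma ancestor_root_iff: "ancestor T x (vroot T) \<longleftrightarrow> x = vroot T"
proof -
  have "simple_path T (vroot T) (vroot T) zs \<longleftrightarrow> zs = [vroot T]" for zs
    using simple_path_self[OF root_vert] simple_path_unique by blast
  then show ?thesis by (auto simp: ancestor_def on_path_def)
qed

text \<open>This turns the definition by paths into a recursion along parents, on which the order
  properties of ancestors rest.\<close>

lemma ancestor_parent_iff:
  assumes "v \<in> verts T" "v \<noteq> vroot T"
  shows "ancestor T x v \<longleftrightarrow> x = v \<or> ancestor T x (parent v)"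
proof -
  obtain zs where zs: "simple_path T v (vroot T) zs" using ex_descending_path[OF assms(1)] by blast
  obtain xs where xs: "zs = v # xs" "simple_path T (parent v) (vroot T) xs"
    using path_to_root[OF assms zs] .
  have "ancestor T x v \<longleftrightarrow> x \<in> set zs" "ancestor T x (parent v) \<longleftrightarrow> x \<in> set xs" for x
    unfolding ancestor_def on_path_def using zs xs(2) simple_path_unique by blast+
  then show ?thesis using xs(1) by simp
qed

lemma parent_induct [consumes 1, case_names root step]:
  assumes "v \<in> verts T" "P (vroot T)"
    "\<And>v. v \<in> verts T \<Longrightarrow> v \<noteq> vroot T \<Longrightarrow> P (parent v) \<Longrightarrow> P v"
  shows "P v"
  using assms(1)
proof (induction rule: strict_induct)
  case (less v)
  then show ?case using assms(2,3) parent by (cases "v = vroot T") auto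
qed

lemma ancestor_refl: "v \<in> verts T \<Longrightarrow> ancestor T v v"
  using ancestor_parent_iff ancestor_root_iff by blast

lemma ancestor_parent: "v \<in> verts T \<Longrightarrow> v \<noteq> vroot T \<Longrightarrow> ancestor T (parent v) v"
  using ancestor_parent_iff ancestor_refl parent(3) by blast

lemma ancestor_trans: "ancestor T y z \<Longrightarrow> ancestor T x y \<Longrightarrow> ancestor T x z"
proof -
  assume yz: "ancestor T y z" and xy: "ancestor T x y"
  have "z \<in> verts T" using yz ancestor_verts by blast
  then show "ancestor T x z" using yz
    by (induction rule: parent_induct) (use xy in \<open>auto simp: ancestor_root_iff ancestor_parent_iff\<close>)
qed

lemma ancestor_strict: "ancestor T x v \<Longrightarrow> x \<noteq> v \<Longrightarrow> strict T x v"
proof -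
  assume a: "ancestor T x v" "x \<noteq> v"
  have "v \<in> verts T" using a ancestor_verts by blast
  then show "strict T x v" using a
  proof (induction rule: parent_induct)
    case root
    then show ?case by (auto simp: ancestor_root_iff)
  next
    case (step v)
    then show ?case using ancestor_parent_iff parent(2) strict_trans by metis
  qed
qed

lemma ancestor_antisym: "ancestor T x y \<Longrightarrow> ancestor T y x \<Longrightarrow> x = y"
  using ancestor_strict strict_trans strict_irrefl by metis

lemma ancestor_pre: "ancestor T x v \<Longrightarrow> (x, v) \<in> pre T"
  using ancestor_strict ancestor_verts pre_refl unfolding strict_def by blast

lemma ancestor_chain: "ancestor T x z \<Longrightarrow> ancestor T y z \<Longrightarrow> ancestor T x y \<or> ancestor T y x"
proof -
  assume a: "ancestor T x z" "ancestor T y z"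
  have "z \<in> verts T" using a ancestor_verts by blast
  then show ?thesis using a
    by (induction rule: parent_induct) 
      (auto simp: ancestor_root_iff ancestor_parent_iff ancestor_refl)
qed

text \<open>The descending-node axiom gives each vertex one strictly lower neighbour; that the
  others lie above it comes from the tree. Compare with the simple path from \<open>u\<close> to the
  root: if \<open>v\<close> is not on it, prepending \<open>v\<close> gives the path from
  \<open>v\<close>, so \<open>u\<close> is the parent of \<open>v\<close>; if \<open>v\<close> is on
  it, uniqueness of paths makes \<open>v\<close> the second vertex.\<close>

lemma adj_cases:
  assumes "(u, v) \<in> adj T"
  obtains "u \<noteq> vroot T" "parent u = v" | "v \<noteq> vroot T" "parent v = u"
proof -
  have uv: "u \<in> verts T" "v \<in> verts T" "u \<noteq> v" "(v, u) \<in> adj T"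
    using assms adj_verts adj_irrefl adj_sym by auto
  obtain zs where zs: "simple_path T u (vroot T) zs" using ex_descending_path[OF uv(1)] by blast
  show thesis
  proof (cases "v \<in> set zs")
    case False
    have vz: "simple_path T v (vroot T) (v # zs)" using simple_path_Cons[OF zs uv(4) False] .
    have "v \<noteq> vroot T"
      using simple_path_unique[OF vz, of "[v]"] simple_path_self[OF uv(2)] zs
      by (auto simp: simple_path_def)
    moreover obtain xs where "v # zs = v # xs" "simple_path T (parent v) (vroot T) xs"
      using path_to_root[OF uv(2) calculation vz] .
    then have "parent v = u" using zs by (auto simp: simple_path_def)
    ultimately show thesis using that by blast
  next
    case True
    then obtain as bs where ab: "zs = as @ v # bs" by (meson split_list)
    have "as \<noteq> []" using ab zs uv(3) by (auto simp: simple_path_def)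
    then have "simple_path T u v (as @ [v])"
      using zs ab unfolding simple_path_def by (auto simp: successively_append_iff)
    moreover have "simple_path T u v [u, v]"
      using assms uv by (auto simp: simple_path_def)
    ultimately have z: "zs = u # v # bs" using ab simple_path_unique by fastforce
    have "u \<noteq> vroot T"
      using simple_path_unique[OF zs] simple_path_self[OF uv(1)] z by auto
    moreover obtain xs where "zs = u # xs" "simple_path T (parent u) (vroot T) xs"
      using path_to_root[OF uv(1) calculation zs] .
    then have "parent u = v" using z by (auto simp: simple_path_def)
    ultimately show thesis using that by blast
  qed
qed

lemma ex_terminal_descendant: "v \<in> verts T \<Longrightarrow> \<exists>t. terminal T t \<and> ancestor T v t"
proof (induction rule: strict_induct_up)
  case (less v)
  show ?case
  proof (cases "terminal T v")
    case True
    then show ?thesis using ancestor_refl less.hyps by blast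
  next
    case False
    then obtain u where "ancestor T v u" "u \<noteq> v" using less.hyps unfolding terminal_def by blast
    then show ?thesis using less.IH[of u] ancestor_strict ancestor_trans by blast
  qed
qed

text \<open>Going from \<open>u\<close> towards the root, the nearest vertex that is also an
  ancestor of \<open>v\<close> works. Being greatest is stronger than the maximality in
  \<open>meet\<close>, and is what transfer along isomorphisms uses.\<close>

lemma ex_greatest_common_ancestor:
  assumes "u \<in> verts T" "v \<in> verts T"
  shows "\<exists>m. ancestor T m u \<and> ancestor T m v \<and> (\<forall>w. ancestor T w u \<and> ancestor T w v \<longrightarrow> ancestor T w m)"
  using assms(1)
proof (induction rule: parent_induct)
  case root
  have "ancestor T (vroot T) v"
    using assms(2) by (induction rule: parent_induct) (auto simp: ancestor_root_iff ancestor_parent_iff)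
  then show ?case using ancestor_root_iff by metis
next
  case (step u)
  show ?case
  proof (cases "ancestor T u v")
    case True
    then show ?thesis using ancestor_refl step.hyps by blast
  next
    case False
    then show ?thesis using step ancestor_parent_iff by metis
  qed
qed

text \<open>The ancestors of \<open>u\<close> form a chain, so two maximal common ancestors are
  comparable and hence equal; the description in \<open>meet\<close> is therefore well
  defined.\<close>

lemma meet_eqI:
  assumes "ancestor T m u" "ancestor T m v"
    and "\<And>w. ancestor T w u \<Longrightarrow> ancestor T w v \<Longrightarrow> ancestor T m w \<Longrightarrow> w = m"
  shows "meet T u v = m"
  unfolding meet_def
proof (rule the_equality)
  show "ancestor T m u \<and> ancestor T m v \<and>
      (\<forall>w. ancestor T w u \<and> ancestor T w v \<and> ancestor T m w \<longrightarrow> w = m)"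
    using assms by blast
  fix m' assume m': "ancestor T m' u \<and> ancestor T m' v \<and>
      (\<forall>w. ancestor T w u \<and> ancestor T w v \<and> ancestor T m' w \<longrightarrow> w = m')"
  then have "ancestor T m m' \<or> ancestor T m' m" using assms(1) ancestor_chain by blast
  then show "m' = m" using m' assms by metis
qed

lemma meet:
  assumes "u \<in> verts T" "v \<in> verts T"
  shows "ancestor T (meet T u v) u" "ancestor T (meet T u v) v" "meet T u v \<in> verts T"
    "\<And>w. ancestor T w u \<Longrightarrow> ancestor T w v \<Longrightarrow> ancestor T w (meet T u v)"
proof -
  obtain m where m: "ancestor T m u" "ancestor T m v"
    "\<forall>w. ancestor T w u \<and> ancestor T w v \<longrightarrow> ancestor T w m"
    using ex_greatest_common_ancestor[OF assms] by blast
  have "meet T u v = m" by (rule meet_eqI) (use m ancestor_antisym in blast)+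
  then show "ancestor T (meet T u v) u" "ancestor T (meet T u v) v" "meet T u v \<in> verts T"
    "\<And>w. ancestor T w u \<Longrightarrow> ancestor T w v \<Longrightarrow> ancestor T w (meet T u v)"
    using m ancestor_verts by blast+
qed

lemma meet_self: "v \<in> verts T \<Longrightarrow> meet T v v = v"
  by (rule meet_eqI) (auto simp: ancestor_refl intro: ancestor_antisym)

text \<open>A common ancestor properly descending from \<open>v\<close> would have both children as
  ancestors. These would then be comparable, so one of them would be an ancestor of
  \<open>v\<close>, although both are strictly higher. The lemma realizes a branching vertex as the
  meet of two terminal ones.\<close>

lemma meet_children:
  assumes "w \<noteq> w'" "parent w = v" "parent w' = v" "w \<in> verts T" "w' \<in> verts T"
    "w \<noteq> vroot T" "w' \<noteq> vroot T" "ancestor T w t" "ancestor T w' t'"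
  shows "meet T t t' = v"
proof (rule meet_eqI)
  show "ancestor T v t" "ancestor T v t'"
    using assms ancestor_parent ancestor_trans by metis+
  fix x assume x: "ancestor T x t" "ancestor T x t'" "ancestor T v x"
  show "x = v"
  proof (rule ccontr)
    assume "x \<noteq> v"
    then have "\<not> ancestor T x v" using x(3) ancestor_antisym by blast
    then have "ancestor T w x" "ancestor T w' x"
      using x(1,2) assms ancestor_chain ancestor_parent_iff ancestor_refl by metis+
    then have "ancestor T w w' \<or> ancestor T w' w" using ancestor_chain by blast
    then have "ancestor T w v \<or> ancestor T w' v" using assms ancestor_parent_iff by metis
    then show False
      using assms parent(2) ancestor_pre unfolding strict_def by metis
  qed
qed

section \<open>Levels\<close>

lemma equiv_equiv_rel: "equiv (verts T) (equiv_rel T)"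
proof (rule equivI)
  show "trans (equiv_rel T)"
    unfolding equiv_rel_def by (auto intro!: transI intro: pre_trans)
qed (auto simp: equiv_rel_def refl_on_def sym_def pre_refl dest: pre_verts)

lemma finite_quotient_verts: "finite (verts T // equiv_rel T)"
  using equiv_equiv_rel finite_quotient[OF finite_verts] equiv_type by blast

lemma level_strict_mono: "strict T v w \<Longrightarrow> level T v < level T w"
proof -
  assume vw: "strict T v w"
  have v: "v \<in> verts T" using vw strict_verts by blast
  let ?L = "\<lambda>v. {C \<in> verts T // equiv_rel T. \<exists>w\<in>C. strict T w v}"
  let ?v = "equiv_rel T `` {v}"
  have "?L v \<subseteq> ?L w" using vw strict_trans by blast
  moreover have "v \<in> ?v" using equiv_class_self[OF equiv_equiv_rel v] .
  then have "?v \<in> ?L w" using quotientI[OF v] vw by blast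
  moreover have "?v \<notin> ?L v" unfolding equiv_rel_def strict_def by auto
  ultimately have "?L v \<subset> ?L w" by blast
  then show ?thesis unfolding level_def using finite_quotient_verts by (intro psubset_card_mono) auto
qed

lemma level_mono: "(v, w) \<in> pre T \<Longrightarrow> level T v \<le> level T w"
  unfolding level_def using finite_quotient_verts strict_pre_trans
  by (intro card_mono) auto

lemma level_eq_iff:
  assumes "v \<in> verts T" "w \<in> verts T"
  shows "level T v = level T w \<longleftrightarrow> (v, w) \<in> equiv_rel T"
proof
  assume eq: "level T v = level T w"
  then have "\<not> strict T v w" "\<not> strict T w v" using level_strict_mono by force+
  then show "(v, w) \<in> equiv_rel T"
    using pre_total[OF assms] unfolding strict_def equiv_rel_def by blast
next
  assume "(v, w) \<in> equiv_rel T"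
  then show "level T v = level T w" using level_mono unfolding equiv_rel_def by (auto intro: antisym)
qed

text \<open>A counting argument: no class is strictly below its own members, so levels are less than
  the number of classes; and inequivalent vertices have different levels, so there are at least as
  many levels as classes.\<close>

lemma level_image: "level T ` verts T = {..<card (verts T // equiv_rel T)}"
proof (rule card_seteq)
  let ?N = "card (verts T // equiv_rel T)"
  show "level T ` verts T \<subseteq> {..<?N}"
  proof clarify
    fix v assume v: "v \<in> verts T"
    have "equiv_rel T `` {v} \<notin> {C \<in> verts T // equiv_rel T. \<exists>w\<in>C. strict T w v}"
      unfolding equiv_rel_def strict_def by auto
    then have "{C \<in> verts T // equiv_rel T. \<exists>w\<in>C. strict T w v} \<subset> verts T // equiv_rel T"
      using quotientI[OF v, of "equiv_rel T"] by blast
    then show "level T v < ?N"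
      unfolding level_def by (rule psubset_card_mono[OF finite_quotient_verts])
  qed
  let ?g = "\<lambda>C. level T (SOME v. v \<in> C)"
  have some: "(SOME v. v \<in> C) \<in> C" if "C \<in> verts T // equiv_rel T" for C
    using in_quotient_imp_non_empty[OF equiv_equiv_rel that] by (simp add: some_in_eq)
  have sub: "(SOME v. v \<in> C) \<in> verts T" if "C \<in> verts T // equiv_rel T" for C
    using some[OF that] in_quotient_imp_subset[OF equiv_equiv_rel that] by blast
  have "inj_on ?g (verts T // equiv_rel T)"
  proof (rule inj_onI)
    fix C D assume CD: "C \<in> verts T // equiv_rel T" "D \<in> verts T // equiv_rel T" "?g C = ?g D"
    then show "C = D"
      using quotient_eq_iff[OF equiv_equiv_rel CD(1,2) some some] level_eq_iff[OF sub sub] by blast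
  qed
  then have "?N = card (?g ` (verts T // equiv_rel T))" by (simp add: card_image)
  also have "\<dots> \<le> card (level T ` verts T)" using sub by (intro card_mono) auto
  finally show "card {..<?N} \<le> card (level T ` verts T)" by simp
qed simp

lemma terminal_top: "terminal T e \<Longrightarrow> v \<in> verts T \<Longrightarrow> (v, e) \<in> pre T"
  using ex_terminal_descendant[of v] terminal_equiv ancestor_pre pre_trans
  unfolding equiv_rel_def by blast

lemma level_terminal:
  assumes "terminal T e" shows "level T e = tree_length T"
proof -
  let ?N = "card (verts T // equiv_rel T)"
  have e: "e \<in> verts T" using assms unfolding terminal_def by blast
  have "level T e < ?N" using level_image e by blast
  then have "?N - 1 \<in> level T ` verts T" using level_image by auto
  then obtain v where "v \<in> verts T" "level T v = ?N - 1" by auto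
  then have "?N - 1 \<le> level T e" using level_mono terminal_top[OF assms] by metis
  then show ?thesis using \<open>level T e < ?N\<close> unfolding tree_length_def by auto
qed

lemma level_eq_tree_length_iff:
  assumes "v \<in> verts T" shows "level T v = tree_length T \<longleftrightarrow> terminal T v"
proof
  assume l: "level T v = tree_length T"
  show "terminal T v"
  proof (rule ccontr)
    assume "\<not> terminal T v"
    then obtain u where "u \<in> verts T" "ancestor T v u" "u \<noteq> v" using assms unfolding terminal_def by blast
    then have "strict T v u" using ancestor_strict by blast
    moreover obtain e where e: "terminal T e" using ex_terminal_descendant assms by blast
    ultimately have "level T v < level T e"
      using terminal_top strict_pre_trans level_strict_mono \<open>u \<in> verts T\<close> by blast
    then show False using l level_terminal[OF e] by simp
  qed
qed (rule level_terminal)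

lemma ex_level:
  assumes "m \<le> tree_length T" shows "\<exists>v\<in>verts T. level T v = m"
proof -
  \<comment> \<open>\<open>tree_length\<close> is a truncated difference, so the number of classes
    must be known to be positive.\<close>
  have "card (verts T // equiv_rel T) > 0"
    using finite_quotient_verts quotientI[OF root_vert, of "equiv_rel T"] by (auto simp: card_gt_0_iff)
  then have "m < card (verts T // equiv_rel T)" using assms unfolding tree_length_def by auto
  then show ?thesis using level_image by (metis imageE lessThan_iff)
qed

text \<open>By uniqueness of simple paths, a neighbour of \<open>v\<close> on a simple path from \<open>v\<close> is its second vertex.\<close>

lemma neighbour_on_path:
  assumes "simple_path T v u xs" "(v, w) \<in> adj T" "w \<in> set xs"
  obtains zs where "xs = v # w # zs"
proof -
  obtain as bs where ab: "xs = as @ w # bs" using assms(3) by (meson split_list)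
  have vw: "v \<noteq> w" "v \<in> verts T" "w \<in> verts T" using assms(2) adj_irrefl adj_verts by auto
  then have "as \<noteq> []" using ab assms(1) by (auto simp: simple_path_def)
  then have "simple_path T v w (as @ [w])"
    using assms(1) ab unfolding simple_path_def by (auto simp: successively_append_iff)
  moreover have "simple_path T v w [v, w]"
    using assms vw by (auto simp: simple_path_def)
  ultimately have "as @ [w] = [v, w]" by (rule simple_path_unique)
  then show thesis using ab that by auto
qed

text \<open>The neighbour is the second vertex of the simple path. This justifies the description in
  \<open>node_towards\<close>.\<close>

lemma ex1_neighbour_towards:
  assumes "v \<in> verts T" "u \<in> verts T" "v \<noteq> u"
  shows "\<exists>!w. (v, w) \<in> adj T \<and> on_path T w v u"
proof -
  obtain xs where xs: "simple_path T v u xs" using ex1_path[OF assms(1,2)] by blast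
  then obtain w zs where w: "xs = v # w # zs"
    using assms(3) unfolding simple_path_def
    by (metis hd_Cons_tl last.simps list.exhaust_sel)
  then have "(v, w) \<in> adj T" "w \<in> set xs" using xs unfolding simple_path_def by auto
  then have "(v, w) \<in> adj T \<and> on_path T w v u" using xs unfolding on_path_def by blast
  moreover have "w' = w" if "(v, w') \<in> adj T" "on_path T w' v u" for w'
  proof -
    have "w' \<in> set xs" using that(2) xs simple_path_unique unfolding on_path_def by blast
    then show ?thesis using neighbour_on_path[OF xs that(1)] w by (metis list.inject)
  qed
  ultimately show ?thesis by blast
qed

text \<open>The path from an ancestor \<open>v\<close> to \<open>u\<close> is obtained by appending
  \<open>u\<close> to the path to its parent, so all its vertices descend from \<open>v\<close>. In
  particular its first step does not use the descending node of \<open>v\<close>.\<close>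

lemma on_path_imp_ancestor:
  assumes "ancestor T v u" "on_path T w v u"
  shows "ancestor T v w"
proof -
  have u: "u \<in> verts T" using assms(1) ancestor_verts by blast
  have "\<exists>xs. simple_path T v u xs \<and> (\<forall>x\<in>set xs. ancestor T v x \<and> ancestor T x u)"
    using u assms(1)
  proof (induction rule: parent_induct)
    case root
    then show ?case using simple_path_self[OF root_vert] ancestor_refl[OF root_vert]
      by (auto simp: ancestor_root_iff)
  next
    case (step u)
    show ?case
    proof (cases "v = u")
      case True
      then show ?thesis using simple_path_self ancestor_refl step.hyps by (intro exI[of _ "[v]"]) auto
    next
      case False
      then have "ancestor T v (parent u)" using step ancestor_parent_iff by blast
      then obtain xs where xs: "simple_path T v (parent u) xs"
        "\<forall>x\<in>set xs. ancestor T v x \<and> ancestor T x (parent u)" using step.IH by blast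
      have "u \<notin> set xs"
        using xs(2) parent(2)[OF step.hyps] ancestor_pre unfolding strict_def by blast
      then have "simple_path T v u (xs @ [u])"
        using xs(1) parent(1)[OF step.hyps] step.hyps adj_sym unfolding simple_path_def
        by (auto simp: successively_append_iff)
      moreover have "\<forall>x\<in>set (xs @ [u]). ancestor T v x \<and> ancestor T x u"
        using xs(2) step ancestor_parent_iff ancestor_refl by auto
      ultimately show ?thesis by blast
    qed
  qed
  then show ?thesis using assms(2) simple_path_unique unfolding on_path_def by blast
qed

end

section \<open>Isomorphisms of level trees\<close>

locale level_tree_iso = T: level_tree T + T': level_tree T'
  for T :: "'r ltree_scheme" and T' :: "'s ltree_scheme" +
  fixes \<phi> :: "nat \<Rightarrow> nat"
  assumes bij: "bij_betw \<phi> (verts T) (verts T')"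
    and adj_iff: "\<And>v w. v \<in> verts T \<Longrightarrow> w \<in> verts T \<Longrightarrow> (v, w) \<in> adj T \<longleftrightarrow> (\<phi> v, \<phi> w) \<in> adj T'"
    and pre_iff: "\<And>v w. v \<in> verts T \<Longrightarrow> w \<in> verts T \<Longrightarrow> (v, w) \<in> pre T \<longleftrightarrow> (\<phi> v, \<phi> w) \<in> pre T'"
    and root: "\<phi> (vroot T) = vroot T'"
begin

lemma inj: "inj_on \<phi> (verts T)" and img: "\<phi> ` verts T = verts T'"
  using bij by (auto simp: bij_betw_def)

lemma vert: "v \<in> verts T \<Longrightarrow> \<phi> v \<in> verts T'"
  using img by blast

lemma simple_path_map:
  assumes "simple_path T u v xs" shows "simple_path T' (\<phi> u) (\<phi> v) (map \<phi> xs)"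
proof -
  have "inj_on \<phi> (set xs)" using assms inj unfolding simple_path_def by (meson inj_on_subset)
  moreover have "successively (\<lambda>x y. (\<phi> x, \<phi> y) \<in> adj T') xs"
    using assms adj_iff unfolding simple_path_def by (auto elim!: successively_mono)
  ultimately show ?thesis
    using assms img unfolding simple_path_def
    by (auto simp: hd_map last_map distinct_map successively_map)
qed

lemma on_path_iff:
  assumes "u \<in> verts T" "v \<in> verts T" "x \<in> verts T"
  shows "on_path T' (\<phi> x) (\<phi> u) (\<phi> v) \<longleftrightarrow> on_path T x u v"
proof -
  obtain xs where xs: "simple_path T u v xs" using T.ex1_path[OF assms(1,2)] by blast
  have "on_path T x u v \<longleftrightarrow> x \<in> set xs"
    using xs T.simple_path_unique unfolding on_path_def by blast
  moreover have "on_path T' (\<phi> x) (\<phi> u) (\<phi> v) \<longleftrightarrow> \<phi> x \<in> set (map \<phi> xs)"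
    using simple_path_map[OF xs] T'.simple_path_unique unfolding on_path_def by blast
  moreover have "set xs \<subseteq> verts T" using xs unfolding simple_path_def by blast
  ultimately show ?thesis using inj assms(3) by (auto dest: inj_onD)
qed

lemma ancestor_iff:
  "u \<in> verts T \<Longrightarrow> v \<in> verts T \<Longrightarrow> ancestor T' (\<phi> u) (\<phi> v) \<longleftrightarrow> ancestor T u v"
  unfolding ancestor_def root[symmetric] by (rule on_path_iff) auto

lemma strict_iff: "u \<in> verts T \<Longrightarrow> v \<in> verts T \<Longrightarrow> strict T' (\<phi> u) (\<phi> v) \<longleftrightarrow> strict T u v"
  unfolding strict_def using pre_iff by blast

lemma meet_eq:
  assumes "u \<in> verts T" "v \<in> verts T"
  shows "meet T' (\<phi> u) (\<phi> v) = \<phi> (meet T u v)"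
proof (rule T'.meet_eqI)
  note m = T.meet[OF assms]
  show "ancestor T' (\<phi> (meet T u v)) (\<phi> u)" "ancestor T' (\<phi> (meet T u v)) (\<phi> v)"
    using m assms ancestor_iff by blast+
  fix w' assume w': "ancestor T' w' (\<phi> u)" "ancestor T' w' (\<phi> v)" "ancestor T' (\<phi> (meet T u v)) w'"
  then obtain w where w: "w \<in> verts T" "w' = \<phi> w" using T'.ancestor_verts img by blast
  then have "ancestor T w u" "ancestor T w v" "ancestor T (meet T u v) w"
    using w' ancestor_iff assms m by blast+
  then have "w = meet T u v" using m T.ancestor_antisym by blast
  then show "w' = \<phi> (meet T u v)" using w by simp
qed

lemma parent_eq:
  assumes "v \<in> verts T" "v \<noteq> vroot T"
  shows "T'.parent (\<phi> v) = \<phi> (T.parent v)"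
proof -
  note p = T.parent[OF assms]
  have "\<phi> v \<noteq> vroot T'" using assms root inj T.root_vert by (metis inj_onD)
  moreover have "(\<phi> v, \<phi> (T.parent v)) \<in> adj T'" "strict T' (\<phi> (T.parent v)) (\<phi> v)"
    using p(1,2) adj_iff[OF assms(1) p(3)] strict_iff[OF p(3) assms(1)] by auto
  ultimately show ?thesis
    using T'.parent(4)[OF vert[OF assms(1)], of "\<phi> (T.parent v)"] by simp
qed

lemma neighbour_towards_eq:
  assumes "u \<in> verts T" "v \<in> verts T" "v \<noteq> u"
  shows "(THE w. (\<phi> v, w) \<in> adj T' \<and> on_path T' w (\<phi> v) (\<phi> u)) =
    \<phi> (THE w. (v, w) \<in> adj T \<and> on_path T w v u)"
proof (rule the1_equality)
  have "\<phi> v \<noteq> \<phi> u" using assms inj by (auto dest: inj_onD)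
  then show "\<exists>!w. (\<phi> v, w) \<in> adj T' \<and> on_path T' w (\<phi> v) (\<phi> u)"
    using T'.ex1_neighbour_towards assms vert by blast
  let ?w = "THE w. (v, w) \<in> adj T \<and> on_path T w v u"
  have "(v, ?w) \<in> adj T \<and> on_path T ?w v u"
    by (rule theI'[OF T.ex1_neighbour_towards[OF assms(2,1,3)]])
  then show "(\<phi> v, \<phi> ?w) \<in> adj T' \<and> on_path T' (\<phi> ?w) (\<phi> v) (\<phi> u)"
    using adj_iff on_path_iff assms T.adj_verts by blast
qed

text \<open>
  Being a bijection of vertices, \<open>f\<close> maps the related pairs injectively into equally many related pairs,
  so it hits all of them.
\<close>

lemma surj_reflects_pre:
  assumes f: "f ` verts T = verts T'" and mono: "\<And>v w. (v, w) \<in> pre T \<Longrightarrow> (f v, f w) \<in> pre T'"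
    and vw: "v \<in> verts T" "w \<in> verts T" "(f v, f w) \<in> pre T'"
  shows "(v, w) \<in> pre T"
proof -
  have inj_f: "inj_on f (verts T)"
    using f bij_betw_same_card[OF bij] by (intro eq_card_imp_inj_on) auto
  have sub: "pre T \<subseteq> verts T \<times> verts T" "pre T' \<subseteq> verts T' \<times> verts T'"
    using T.pre_verts T'.pre_verts by auto
  have "pre T' \<subseteq> map_prod \<phi> \<phi> ` pre T"
  proof
    fix p assume p: "p \<in> pre T'"
    then obtain a b where "a \<in> verts T" "b \<in> verts T" "p = (\<phi> a, \<phi> b)"
      using sub img by (cases p) blast
    then show "p \<in> map_prod \<phi> \<phi> ` pre T" using p pre_iff by force
  qed
  moreover have fin: "finite (pre T)"
    by (rule finite_subset[OF sub(1)]) auto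
  ultimately have "card (pre T') \<le> card (pre T)"
    using card_mono[of "map_prod \<phi> \<phi> ` pre T" "pre T'"] card_image_le[OF fin, of "map_prod \<phi> \<phi>"]
    by force
  moreover have "inj_on (map_prod f f) (pre T)"
    using map_prod_inj_on[OF inj_f inj_f] sub(1) by (rule inj_on_subset)
  ultimately have "map_prod f f ` pre T = pre T'"
    using mono sub finite_subset[OF sub(2)] by (intro card_seteq) (auto simp: card_image)
  then obtain p where p: "p \<in> pre T" "map_prod f f p = (f v, f w)"
    using vw(3) by (metis imageE)
  then have "fst p = v" "snd p = w"
    using inj_onD[OF inj_f, of "fst p" v] inj_onD[OF inj_f, of "snd p" w] vw(1,2) sub(1)
    by (cases p; auto)+
  then show ?thesis using p(1) by auto
qed

end

section \<open>Charts of the moduli space\<close>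

text \<open>The tree notions live on record schemes, so on \<open>dual_tree S\<close> and on
  \<open>S\<close> they are different instances. This and the following rules move everything to
  \<open>S\<close>.\<close>

lemma dual_tree_simps [simp]:
  "verts (dual_tree S) = verts S" "adj (dual_tree S) = adj S" "vroot (dual_tree S) = vroot S"
  "pre (dual_tree S) = pre S" "mark (dual_tree S) = mark S"
  by (simp_all add: dual_tree_def)

lemma simple_path_dual_tree [simp]: "simple_path (dual_tree S) = simple_path S"
  by (intro ext) (simp add: simple_path_def)

lemma ancestor_dual_tree [simp]: "ancestor (dual_tree S) = ancestor S"
  by (intro ext) (simp add: ancestor_def on_path_def)

lemma dual_tree_transfer [simp]:
  "meet (dual_tree S) = meet S" "terminal (dual_tree S) = terminal S" "strict (dual_tree S) = strict S"
  "equiv_rel (dual_tree S) = equiv_rel S"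
  by (simp_all add: fun_eq_iff meet_def terminal_def strict_def equiv_rel_def)

lemma level_dual_tree [simp]: "level (dual_tree S) = level S" "tree_length (dual_tree S) = tree_length S"
  by (simp_all add: fun_eq_iff level_def tree_length_def)

text \<open>Moving marked points inside their components affects neither the tree nor the curve.
  These rules place a perturbed line in the chart of the original tree.\<close>

lemma dual_tree_mpt_update [simp]: "dual_tree (S\<lparr>mpt := p\<rparr>) = dual_tree S"
  by (simp add: dual_tree_def)

lemma simple_path_mpt_update [simp]: "simple_path (S\<lparr>mpt := p\<rparr>) = simple_path S"
  by (intro ext) (simp add: simple_path_def)

lemma ancestor_mpt_update [simp]: "ancestor (S\<lparr>mpt := p\<rparr>) = ancestor S"
  by (intro ext) (simp add: ancestor_def on_path_def)

lemma mpt_update_tree [simp]: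
  "is_tree (S\<lparr>mpt := p\<rparr>) = is_tree S" "meet (S\<lparr>mpt := p\<rparr>) = meet S"
  "terminal (S\<lparr>mpt := p\<rparr>) = terminal S" "strict (S\<lparr>mpt := p\<rparr>) = strict S"
  "equiv_rel (S\<lparr>mpt := p\<rparr>) = equiv_rel S"
  by (simp_all add: fun_eq_iff is_tree_def meet_def terminal_def strict_def equiv_rel_def)

lemma mpt_update_curve [simp]:
  "nodes_on (S\<lparr>mpt := p\<rparr>) = nodes_on S" "desc_point (S\<lparr>mpt := p\<rparr>) = desc_point S"
  "node_towards (S\<lparr>mpt := p\<rparr>) = node_towards S"
  by (intro ext; simp add: nodes_on_def desc_point_def node_towards_def on_path_def)+

lemma multiscaled_line_mpt_update [simp]: "multiscaled_line (S\<lparr>mpt := p\<rparr>) = multiscaled_line S"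
  by (simp add: multiscaled_line_def)

lemma level_tree_multiscaled: "multiscaled_line S \<Longrightarrow> level_tree S"
  unfolding multiscaled_line_def by unfold_locales auto

lemma stable_line_multiscaled: "stable_line n S \<Longrightarrow> multiscaled_line S"
  unfolding stable_line_def marked_line_def by blast

lemma level_tree_stable: "stable_line n S \<Longrightarrow> level_tree S"
  using stable_line_multiscaled level_tree_multiscaled by blast

lemma mark_terminal: "stable_line n S \<Longrightarrow> i \<in> {1..n} \<Longrightarrow> terminal S (mark S i)"
  unfolding stable_line_def marked_line_def by blast

lemma mark_vert: "stable_line n S \<Longrightarrow> i \<in> {1..n} \<Longrightarrow> mark S i \<in> verts S"
  using mark_terminal unfolding terminal_def by blast

lemma omega_pole:
  "stable_line n S \<Longrightarrow> v \<in> verts S \<Longrightarrow> only_double_pole (omega S v) (desc_point S v)"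
  using stable_line_multiscaled unfolding multiscaled_line_def by blast

lemma desc_point_eq:
  assumes "multiscaled_line S"
  shows "desc_point S v = (if v = vroot S then infpt S else node S v (level_tree.parent S v))"
  unfolding desc_point_def level_tree.parent_def[OF level_tree_multiscaled[OF assms]] by simp

lemma desc_point_node:
  assumes "multiscaled_line S" "v \<in> verts S" "v \<noteq> vroot S"
  shows "desc_point S v \<in> nodes_on S v"
proof -
  interpret level_tree S using assms(1) by (rule level_tree_multiscaled)
  show ?thesis using parent(1)[OF assms(2,3)] assms by (auto simp: desc_point_eq nodes_on_def)
qed

lemma mpt_neq_desc_point:
  assumes "stable_line n S" "i \<in> {1..n}"
  shows "mpt S i \<noteq> desc_point S (mark S i)"
proof (cases "mark S i = vroot S")
  case True
  then show ?thesis
    using assms unfolding stable_line_def marked_line_def by (auto simp: desc_point_def)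
next
  case False
  then have "desc_point S (mark S i) \<in> nodes_on S (mark S i)"
    using desc_point_node assms stable_line_multiscaled mark_vert by blast
  moreover have "mpt S i \<notin> nodes_on S (mark S i)"
    using assms unfolding stable_line_def marked_line_def by blast
  ultimately show ?thesis by metis
qed

text \<open>Towards a descendant one leaves through a neighbour higher than \<open>v\<close>,
  whereas the descending node leads to the lower one; injectivity of \<open>node S v\<close>
  separates the two points. At the root the pole is \<open>infpt\<close>, which is not a
  node.\<close>

lemma node_towards_neq_desc_point:
  assumes "multiscaled_line S" "ancestor S v u" "v \<noteq> u"
  shows "node_towards S v u \<noteq> desc_point S v"
proof -
  interpret level_tree S using assms(1) by (rule level_tree_multiscaled)
  have vu: "v \<in> verts S" "u \<in> verts S" using assms(2) ancestor_verts by auto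
  define w where "w = (THE w. (v, w) \<in> adj S \<and> on_path S w v u)"
  have w: "(v, w) \<in> adj S" "on_path S w v u"
    using theI'[OF ex1_neighbour_towards[OF vu assms(3)]] unfolding w_def by blast+
  have nt: "node_towards S v u = node S v w" unfolding node_towards_def w_def ..
  show ?thesis
  proof (cases "v = vroot S")
    case True
    then show ?thesis
      using w(1) assms(1) nt unfolding multiscaled_line_def desc_point_def nodes_on_def by force
  next
    case False
    have "strict S v w"
      using on_path_imp_ancestor[OF assms(2) w(2)] ancestor_strict w(1) adj_irrefl by metis
    then have "w \<noteq> parent v" using parent(2)[OF vu(1) False] unfolding strict_def by blast
    moreover have "inj_on (node S v) {w. (v, w) \<in> adj S}"
      using assms(1) vu(1) unfolding multiscaled_line_def by blast
    ultimately have "node S v w \<noteq> node S v (parent v)"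
      using w(1) parent(1)[OF vu(1) False] by (auto dest: inj_onD)
    then show ?thesis using False assms(1) by (simp add: nt desc_point_eq)
  qed
qed

section \<open>Behaviour under complex projective isomorphism\<close>

lemma level_tree_iso_cp_isomorphism:
  assumes "stable_line n S" "stable_line n S'" "cp_isomorphism n S S' \<phi> \<mu>"
  shows "level_tree_iso S S' \<phi>"
  using assms unfolding level_tree_iso_def level_tree_iso_axioms_def cp_isomorphism_def
  by (auto intro: level_tree_stable)

lemma desc_point_cp_isomorphism:
  assumes "stable_line n S" "stable_line n S'" and iso: "cp_isomorphism n S S' \<phi> \<mu>"
    and v: "v \<in> verts S"
  shows "desc_point S' (\<phi> v) = \<mu> v (desc_point S v)"
proof -
  interpret level_tree_iso S S' \<phi> using assms(1-3) by (rule level_tree_iso_cp_isomorphism)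
  have ms: "multiscaled_line S" "multiscaled_line S'" using assms stable_line_multiscaled by auto
  show ?thesis
  proof (cases "v = vroot S")
    case True
    then show ?thesis using iso unfolding cp_isomorphism_def by (simp add: desc_point_def)
  next
    case False
    then have "\<phi> v \<noteq> vroot S'" using v root inj T.root_vert by (metis inj_onD)
    then show ?thesis
      using iso T.parent(1)[OF v False] False parent_eq[OF v False]
      unfolding cp_isomorphism_def by (simp add: desc_point_eq ms)
  qed
qed

text \<open>The endpoint of the integral I_ij on the side of \<open>i\<close>. With one function for
  both endpoints, each fact is proved once and reused with \<open>i\<close> and \<open>j\<close>
  exchanged.\<close>

definition I_point :: "mline \<Rightarrow> nat \<Rightarrow> nat \<Rightarrow> P1" where
  "I_point S i j = (if mark S i = mark S j then mpt S i else node_towards S (meet S (mark S i) (mark S j)) (mark S i))"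

lemma meet_commute: "meet S u v = meet S v u"
  unfolding meet_def by meson

lemma I_coord_eq:
  "I_coord S i j = diff_integral (omega S (meet S (mark S i) (mark S j)))
     (desc_point S (meet S (mark S i) (mark S j))) (I_point S i j) (I_point S j i)"
  unfolding I_coord_def I_point_def Let_def by (simp add: meet_commute eq_commute)

text \<open>Marks sit on terminal vertices, which are ancestors of no other vertex, so two different
  marked vertices meet strictly below both.\<close>

lemma meet_marks:
  assumes "stable_line n S" "i \<in> {1..n}" "j \<in> {1..n}"
  shows "meet S (mark S i) (mark S j) \<in> verts S" "ancestor S (meet S (mark S i) (mark S j)) (mark S i)"
    "mark S i = mark S j \<Longrightarrow> meet S (mark S i) (mark S j) = mark S i"
    "mark S i \<noteq> mark S j \<Longrightarrow> meet S (mark S i) (mark S j) \<noteq> mark S i"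
proof -
  interpret level_tree S using assms(1) by (rule level_tree_stable)
  have v: "mark S i \<in> verts S" "mark S j \<in> verts S" using assms mark_vert by auto
  note m = meet[OF v]
  show "meet S (mark S i) (mark S j) \<in> verts S" "ancestor S (meet S (mark S i) (mark S j)) (mark S i)"
    using m by auto
  show "mark S i = mark S j \<Longrightarrow> meet S (mark S i) (mark S j) = mark S i"
    using meet_self v by simp
  show "meet S (mark S i) (mark S j) \<noteq> mark S i" if ne: "mark S i \<noteq> mark S j"
  proof
    assume "meet S (mark S i) (mark S j) = mark S i"
    then have "ancestor S (mark S i) (mark S j)" using m(2) by simp
    then show False using mark_terminal[OF assms(1,2)] ne v unfolding terminal_def by metis
  qed
qed

lemma I_point_neq_desc_point:
  assumes "stable_line n S" "i \<in> {1..n}" "j \<in> {1..n}"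
  shows "I_point S i j \<noteq> desc_point S (meet S (mark S i) (mark S j))"
proof (cases "mark S i = mark S j")
  case True
  then show ?thesis
    using mpt_neq_desc_point[OF assms(1,2)] meet_marks(3)[OF assms True] by (simp add: I_point_def)
next
  case False
  then show ?thesis
    using node_towards_neq_desc_point[OF stable_line_multiscaled meet_marks(2) meet_marks(4)] assms
    by (auto simp: I_point_def)
qed

lemma I_point_cp_isomorphism:
  assumes S: "stable_line n S" "stable_line n S'" and iso: "cp_isomorphism n S S' \<phi> \<mu>"
    and ij: "i \<in> {1..n}" "j \<in> {1..n}"
  shows "I_point S' i j = \<mu> (meet S (mark S i) (mark S j)) (I_point S i j)"
proof -
  interpret level_tree_iso S S' \<phi> using S iso by (rule level_tree_iso_cp_isomorphism)
  let ?v = "meet S (mark S i) (mark S j)"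
  have marks: "mark S' i = \<phi> (mark S i)" "mark S' j = \<phi> (mark S j)" "mpt S' i = \<mu> (mark S i) (mpt S i)"
    using iso ij unfolding cp_isomorphism_def by auto
  have v: "mark S i \<in> verts S" "mark S j \<in> verts S" "?v \<in> verts S"
    using S(1) ij mark_vert meet_marks(1) by blast+
  have eq: "mark S' i = mark S' j \<longleftrightarrow> mark S i = mark S j"
    using marks inj v by (auto dest: inj_onD)
  show ?thesis
  proof (cases "mark S i = mark S j")
    case True
    then show ?thesis using meet_marks(3)[OF S(1) ij] marks eq by (simp add: I_point_def)
  next
    case False
    let ?w = "THE w. (?v, w) \<in> adj S \<and> on_path S w ?v (mark S i)"
    have ne: "?v \<noteq> mark S i" using meet_marks(4)[OF S(1) ij False] .
    have "(?v, ?w) \<in> adj S"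
      using theI'[OF T.ex1_neighbour_towards[OF v(3,1) ne]] by blast
    then have "\<mu> ?v (node S ?v ?w) = node S' (\<phi> ?v) (\<phi> ?w)"
      using iso unfolding cp_isomorphism_def by blast
    then show ?thesis
      using False eq neighbour_towards_eq[OF v(1,3) ne]
      by (simp add: I_point_def node_towards_def marks meet_eq v)
  qed
qed

text \<open>The factor is the constant of the isomorphism at the meet. It is constant on levels, so
  it cancels in quotients of integrals on one level; it is 1 on terminal vertices, which matches the
  convention that the last scale is 1.\<close>

lemma I_coord_cp_isomorphism:
  assumes S: "stable_line n S" "stable_line n S'" and iso: "cp_isomorphism n S S' \<phi> \<mu>"
  shows "\<exists>c. (\<forall>v\<in>verts S. c v \<noteq> 0) \<and> (\<forall>v w. (v, w) \<in> equiv_rel S \<longrightarrow> c v = c w) \<and>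
    (\<forall>v. terminal S v \<longrightarrow> c v = 1) \<and>
    (\<forall>i\<in>{1..n}. \<forall>j\<in>{1..n}. I_coord S' i j = c (meet S (mark S i) (mark S j)) * I_coord S i j)"
proof -
  interpret level_tree_iso S S' \<phi> using S iso by (rule level_tree_iso_cp_isomorphism)
  have "\<exists>c. (\<forall>v\<in>verts S. c v \<noteq> 0 \<and> pullback (\<mu> v) (omega S' (\<phi> v)) = (\<lambda>z. c v * omega S v z)) \<and>
      (\<forall>v w. (v, w) \<in> equiv_rel S \<longrightarrow> c v = c w) \<and> (\<forall>v. terminal S v \<longrightarrow> c v = 1)"
    using iso unfolding cp_isomorphism_def by (elim conjE)
  then obtain c where c: "\<And>v. v \<in> verts S \<Longrightarrow> c v \<noteq> 0"
    "\<And>v. v \<in> verts S \<Longrightarrow> pullback (\<mu> v) (omega S' (\<phi> v)) = (\<lambda>z. c v * omega S v z)"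
    "\<And>v w. (v, w) \<in> equiv_rel S \<Longrightarrow> c v = c w" "\<And>v. terminal S v \<Longrightarrow> c v = 1"
    by metis
  show ?thesis
  proof (intro exI[of _ c] conjI ballI)
    fix i j assume ij: "i \<in> {1..n}" "j \<in> {1..n}"
    let ?v = "meet S (mark S i) (mark S j)"
    have v: "mark S i \<in> verts S" "mark S j \<in> verts S" "?v \<in> verts S"
      using S(1) ij mark_vert meet_marks(1) by blast+
    have "mark S' i = \<phi> (mark S i)" "mark S' j = \<phi> (mark S j)"
      using iso ij unfolding cp_isomorphism_def by auto
    then have m: "meet S' (mark S' i) (mark S' j) = \<phi> ?v" using meet_eq v by simp
    have d: "desc_point S' (\<phi> ?v) = \<mu> ?v (desc_point S ?v)"
      using desc_point_cp_isomorphism[OF S iso v(3)] .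
    have "I_coord S' i j = diff_integral (omega S' (\<phi> ?v)) (\<mu> ?v (desc_point S ?v))
        (\<mu> ?v (I_point S i j)) (\<mu> ?v (I_point S j i))"
      using I_point_cp_isomorphism[OF S iso ij] I_point_cp_isomorphism[OF S iso ij(2,1)]
      by (simp add: I_coord_eq m d meet_commute[of S "mark S j"])
    also have "\<dots> = c ?v * diff_integral (omega S ?v) (desc_point S ?v) (I_point S i j) (I_point S j i)"
    proof (rule diff_integral_pullback)
      show "only_double_pole (omega S ?v) (desc_point S ?v)" by (rule omega_pole[OF S(1) v(3)])
      show "only_double_pole (omega S' (\<phi> ?v)) (\<mu> ?v (desc_point S ?v))"
        using omega_pole[OF S(2) vert[OF v(3)]] d by simp
      show "P1_aut (\<mu> ?v)" using iso v(3) unfolding cp_isomorphism_def by blast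
      show "I_point S i j \<noteq> desc_point S ?v" by (rule I_point_neq_desc_point[OF S(1) ij])
      show "I_point S j i \<noteq> desc_point S ?v"
        using I_point_neq_desc_point[OF S(1) ij(2,1)] by (simp add: meet_commute)
    qed (rule c(2)[OF v(3)])
    also have "\<dots> = c ?v * I_coord S i j" by (simp add: I_coord_eq)
    finally show "I_coord S' i j = c ?v * I_coord S i j" .
  qed (use c in blast)+
qed

section \<open>The chart of a line's own dual tree\<close>

text \<open>Stability provides the pairs. Away from the root one of at least three nodes is
  descending; at the root none of at least two is. So a nonterminal vertex always has two children.
  Each has a terminal descendant, which carries a mark, and two such marks meet at the
  vertex.\<close>

lemma chart_choice_exists:
  assumes S: "stable_line n S"
  obtains a b e where "chart_choice n (dual_tree S) a b e"
proof -
  interpret level_tree S using S by (rule level_tree_stable)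
  have ms: "multiscaled_line S" using S by (rule stable_line_multiscaled)
  have "\<exists>i\<in>{1..n}. \<exists>j\<in>{1..n}. level S (meet S (mark S i) (mark S j)) = m" if m: "m < tree_length S" for m
  proof -
    obtain v where v: "v \<in> verts S" "level S v = m" using ex_level[of m] m by auto
    then have nt: "\<not> terminal S v" using level_terminal m by force
    define Ch where "Ch = {w \<in> verts S. w \<noteq> vroot S \<and> parent w = v}"
    have "{w. (v, w) \<in> adj S} \<subseteq> verts S" using adj_verts by blast
    then have fin: "finite Ch" "finite {w. (v, w) \<in> adj S}"
      unfolding Ch_def using finite_subset[OF _ finite_verts] by auto
    have "nodes_on S v = node S v ` {w. (v, w) \<in> adj S}" by (auto simp: nodes_on_def)
    then have le: "card (nodes_on S v) \<le> card {w. (v, w) \<in> adj S}" using fin(2) card_image_le by simp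
    have sub: "w \<in> Ch \<or> v \<noteq> vroot S \<and> w = parent v" if "(v, w) \<in> adj S" for w
      by (rule adj_cases[OF that]) (use adj_verts[OF that] in \<open>auto simp: Ch_def\<close>)
    have "\<not> card Ch \<le> Suc 0"
    proof
      assume c: "card Ch \<le> Suc 0"
      show False
      proof (cases "v = vroot S")
        case True
        then have "card {w. (v, w) \<in> adj S} \<le> card Ch" using sub by (intro card_mono fin) auto
        then show False using S v(1) nt le c unfolding stable_line_def by fastforce
      next
        case False
        have "card {w. (v, w) \<in> adj S} \<le> card (insert (parent v) Ch)"
          using sub fin by (intro card_mono) auto
        also have "\<dots> \<le> Suc (card Ch)" by (rule card_insert_le_m1) (auto simp: fin)
        finally show False using S v(1) nt le c False unfolding stable_line_def by fastforce
      qed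
    qed
    then obtain w w' where w: "w \<in> Ch" "w' \<in> Ch" "w \<noteq> w'"
      using card_le_Suc0_iff_eq[OF fin(1)] by blast
    obtain t t' where t: "terminal S t" "ancestor S w t" "terminal S t'" "ancestor S w' t'"
      using ex_terminal_descendant w(1,2) unfolding Ch_def by blast
    then obtain i j where ij: "i \<in> {1..n}" "mark S i = t" "j \<in> {1..n}" "mark S j = t'"
      using S unfolding stable_line_def terminal_def by metis
    have "meet S t t' = v"
      using meet_children[OF w(3)] w(1,2) t unfolding Ch_def by blast
    then show ?thesis using ij v(2) by blast
  qed
  then have "\<forall>m. \<exists>i j. m < tree_length S \<longrightarrow>
      i \<in> {1..n} \<and> j \<in> {1..n} \<and> level S (meet S (mark S i) (mark S j)) = m" by blast
  then obtain a b where "\<forall>m<tree_length S.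
      a m \<in> {1..n} \<and> b m \<in> {1..n} \<and> level S (meet S (mark S (a m)) (mark S (b m))) = m" by metis
  moreover obtain e where "terminal S e" using ex_terminal_descendant[OF root_vert] by blast
  ultimately have "chart_choice n (dual_tree S) a b e" unfolding chart_choice_def by simp
  then show thesis by (rule that)
qed

text \<open>Fibers of a bijection are single vertices, hence connected by the reflexive
  closure.\<close>

lemma contraction_cp_isomorphism:
  assumes S: "stable_line n S" "stable_line n S'" and iso: "cp_isomorphism n S S' \<phi> \<mu>"
  shows "contraction n (dual_tree S) (dual_tree S') \<phi>"
proof -
  interpret level_tree_iso S S' \<phi> using S iso by (rule level_tree_iso_cp_isomorphism)
  have "(v, w) \<in> (adj S \<inter> {u \<in> verts S. \<phi> u = x} \<times> {u \<in> verts S. \<phi> u = x})\<^sup>*"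
    if "v \<in> verts S" "w \<in> verts S" "\<phi> v = x" "\<phi> w = x" for v w x
    using inj_onD[OF inj, of v w] that by simp
  moreover have "\<forall>i\<in>{1..n}. \<phi> (mark S i) = mark S' i"
    using iso unfolding cp_isomorphism_def by blast
  moreover have "\<forall>v w. (v, w) \<in> adj S \<longrightarrow> (\<phi> v, \<phi> w) \<in> adj S'"
    using T.adj_verts adj_iff by blast
  ultimately show ?thesis
    using img pre_iff unfolding contraction_def Let_def by simp
qed

text \<open>The coordinates of an isomorphic line \<open>S'\<close> are expressed through
  \<open>S\<close> alone, so they are the same for every representative of the class and for every
  contraction that \<open>SOME\<close> may return.\<close>

lemma chart_line_cp_isomorphism:
  assumes S: "stable_line n S" "stable_line n S'" and iso: "cp_isomorphism n S S' \<phi> \<mu>"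
    and ch: "chart_choice n (dual_tree S) a b e"
  shows "chart_line n (dual_tree S) a b e S' =
    restrict (\<lambda>k. case k of
        Zc i j \<Rightarrow> I_coord S i j / chart_scale (dual_tree S) a b S (level S (meet S (mark S i) (mark S j)))
      | Tc m \<Rightarrow> 0) (chart_indices n (dual_tree S))"
proof -
  interpret level_tree_iso S S' \<phi> using S iso by (rule level_tree_iso_cp_isomorphism)
  let ?G = "dual_tree S" and ?l = "tree_length S"
  define f where "f = (SOME f. contraction n ?G (dual_tree S') f)"
  obtain c where c: "\<And>v. v \<in> verts S \<Longrightarrow> c v \<noteq> 0" "\<And>v w. (v, w) \<in> equiv_rel S \<Longrightarrow> c v = c w"
    "\<And>v. terminal S v \<Longrightarrow> c v = 1"
    "\<And>i j. i \<in> {1..n} \<Longrightarrow> j \<in> {1..n} \<Longrightarrow>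
      I_coord S' i j = c (meet S (mark S i) (mark S j)) * I_coord S i j"
    using I_coord_cp_isomorphism[OF S iso] by metis
  have ab: "a m \<in> {1..n}" "b m \<in> {1..n}" "level S (meet S (mark S (a m)) (mark S (b m))) = m" if "m < ?l" for m
    using ch that unfolding chart_choice_def by auto
  have e: "terminal S e" using ch unfolding chart_choice_def by auto
  have "contraction n ?G (dual_tree S') \<phi>" using S iso by (rule contraction_cp_isomorphism)
  then have f: "contraction n ?G (dual_tree S') f" 
    unfolding f_def by (rule someI[where P = "contraction n ?G (dual_tree S')"])
  have Z: "I_coord S' i j / chart_scale ?G a b S' (level S (meet S (mark S i) (mark S j))) =
      I_coord S i j / chart_scale ?G a b S (level S (meet S (mark S i) (mark S j)))"
    if ij: "i \<in> {1..n}" "j \<in> {1..n}" for i j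
  proof -
    let ?v = "meet S (mark S i) (mark S j)"
    have v: "?v \<in> verts S" using meet_marks(1)[OF S(1) ij] .
    show ?thesis
    proof (cases "level S ?v = ?l")
      case True
      then have "c ?v = 1" using c(3) T.level_eq_tree_length_iff v by blast
      then show ?thesis using True c(4)[OF ij] by (simp add: chart_scale_def)
    next
      case False
      then have l: "level S ?v < ?l"
        using T.level_mono[OF T.terminal_top[OF e v]] T.level_terminal[OF e] by simp
      \<comment> \<open>The chosen pair of this level supplies the denominator; its meet is
        equivalent to \<open>?v\<close>, so both integrals scale by the same factor.\<close>
      let ?w = "meet S (mark S (a (level S ?v))) (mark S (b (level S ?v)))"
      have "?w \<in> verts S" using meet_marks(1)[OF S(1) ab(1,2)[OF l]] .
      then have "(?v, ?w) \<in> equiv_rel S" using T.level_eq_iff v ab(3)[OF l] by metis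
      then have "c ?v = c ?w" by (rule c(2))
      then show ?thesis
        using False c(1)[OF v] c(4)[OF ij] c(4)[OF ab(1,2)[OF l]] by (simp add: chart_scale_def)
    qed
  qed
  \<comment> \<open>The two trees have equally many vertices, so any contraction reflects the
    preorder. Equivalent images would put a vertex of level \<open>m\<close> below one of level
    \<open>m - 1\<close>.\<close>
  have T: "(f (chart_vertex ?G a b e m), f (chart_vertex ?G a b e (m - 1))) \<notin> equiv_rel S'"
    if m: "m \<in> {1..?l}" for m
  proof
    let ?u = "chart_vertex ?G a b e"
    have u: "?u k \<in> verts S" "level S (?u k) = k" if "k \<le> ?l" for k
      using that e ab[of k] T.level_terminal[OF e] meet_marks(1)[OF S(1) ab(1,2)]
      unfolding chart_vertex_def terminal_def by auto
    assume "(f (?u m), f (?u (m - 1))) \<in> equiv_rel S'"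
    then have "(f (?u m), f (?u (m - 1))) \<in> pre S'" unfolding equiv_rel_def by blast
    then have "(?u m, ?u (m - 1)) \<in> pre S"
    proof (rule surj_reflects_pre[rotated 4])
      show "f ` verts S = verts S'" using f unfolding contraction_def by simp
      show "(f v, f w) \<in> pre S'" if "(v, w) \<in> pre S" for v w
        using f that T.pre_verts unfolding contraction_def by auto
    qed (use u m in auto)
    then have "level S (?u m) \<le> level S (?u (m - 1))" by (rule T.level_mono)
    then show False using u(2)[of m] u(2)[of "m - 1"] m by auto
  qed
  show ?thesis
    unfolding chart_line_def Let_def f_def[symmetric]
    by (rule restrict_ext) (use Z T in \<open>auto simp: chart_indices_def\<close>)
qed

text \<open>The elements of the quotient \<open>moduli\<close> have literally this form, so a point
  is handled through one line \<open>S\<close> and the isomorphisms starting from it.\<close>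

definition iso_class :: "nat \<Rightarrow> mline \<Rightarrow> mline set" where
  "iso_class n S = {S'. stable_line n S' \<and> (\<exists>\<phi> \<mu>. cp_isomorphism n S S' \<phi> \<mu>)}"

lemma moduli_eq: "moduli n = iso_class n ` {S. stable_line n S}"
  unfolding moduli_def quotient_def iso_class_def by auto

lemma iso_class_self:
  assumes "stable_line n S" shows "S \<in> iso_class n S"
proof -
  have "cp_isomorphism n S S id (\<lambda>v. id)"
    unfolding cp_isomorphism_def
    using P1_aut_id pullback_id[OF omega_pole[OF assms]]
    by (auto intro!: exI[of _ "\<lambda>_. 1"])
  then show ?thesis using assms unfolding iso_class_def by blast
qed

lemma collide_cp_isomorphism:
  assumes S: "stable_line n S" "stable_line n S'" and iso: "cp_isomorphism n S S' \<phi> \<mu>"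
    and ij: "i \<in> {1..n}" "j \<in> {1..n}"
  shows "collide S' i j \<longleftrightarrow> collide S i j"
proof -
  interpret level_tree_iso S S' \<phi> using S iso by (rule level_tree_iso_cp_isomorphism)
  have marks: "mark S' i = \<phi> (mark S i)" "mark S' j = \<phi> (mark S j)"
    "mpt S' i = \<mu> (mark S i) (mpt S i)" "mpt S' j = \<mu> (mark S j) (mpt S j)"
    using iso ij unfolding cp_isomorphism_def by auto
  have v: "mark S i \<in> verts S" "mark S j \<in> verts S" using S(1) ij mark_vert by blast+
  have "P1_aut (\<mu> (mark S i))" using iso v(1) unfolding cp_isomorphism_def by blast
  then show ?thesis
    unfolding collide_def marks
    using inj_on_eq_iff[OF inj v] inj_eq[OF P1_aut_inj] by metis
qed

lemma collide_iso_class: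
  assumes "stable_line n S" "S' \<in> iso_class n S" "i \<in> {1..n}" "j \<in> {1..n}"
  shows "collide S' i j \<longleftrightarrow> collide S i j"
  using assms collide_cp_isomorphism unfolding iso_class_def by blast

lemma iso_class_in_moduli: "stable_line n S \<Longrightarrow> iso_class n S \<in> moduli n"
  unfolding moduli_eq by blast

lemma iso_class_closed_stratum_iff:
  assumes "stable_line n S"
  shows "iso_class n S \<in> closed_stratum n \<rho> \<longleftrightarrow>
    (\<forall>i\<in>{1..n}. \<forall>j\<in>{1..n}. same_block \<rho> i j \<longrightarrow> collide S i j)"
  unfolding closed_stratum_def
  using iso_class_in_moduli[OF assms] collide_iso_class[OF assms] iso_class_self[OF assms] by blast

lemma iso_class_open_stratum_iff:
  assumes "stable_line n S"
  shows "iso_class n S \<in> open_stratum n \<rho> \<longleftrightarrow>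
    (\<forall>i\<in>{1..n}. \<forall>j\<in>{1..n}. collide S i j \<longleftrightarrow> same_block \<rho> i j)"
  unfolding open_stratum_def
  using iso_class_in_moduli[OF assms] collide_iso_class[OF assms] iso_class_self[OF assms] by blast

text \<open>Isomorphisms to the representatives serve as contractions, and marks on different
  components have \<open>Pi_coord\<close> equal to \<open>Infinity\<close>, not 0. Hence the charts
  cover the moduli space.\<close>

lemma iso_class_chart_dom:
  assumes S: "stable_line n S"
  shows "iso_class n S \<in> chart_dom n (dual_tree S)"
proof -
  have "(\<exists>f. contraction n (dual_tree S) (dual_tree S') f) \<and>
      (\<forall>i\<in>{1..n}. \<forall>j\<in>{1..n}. mark S i \<noteq> mark S j \<longrightarrow> Pi_coord S' i j \<noteq> Pt 0)"
    if S': "S' \<in> iso_class n S" for S'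
  proof -
    obtain \<phi> \<mu> where iso: "stable_line n S'" "cp_isomorphism n S S' \<phi> \<mu>"
      using S' unfolding iso_class_def by blast
    interpret level_tree_iso S S' \<phi> using S iso by (rule level_tree_iso_cp_isomorphism)
    have "contraction n (dual_tree S) (dual_tree S') \<phi>"
      using S iso by (rule contraction_cp_isomorphism)
    moreover have "Pi_coord S' i j \<noteq> Pt 0"
      if "i \<in> {1..n}" "j \<in> {1..n}" "mark S i \<noteq> mark S j" for i j
      using that iso(2) inj_on_eq_iff[OF inj mark_vert[OF S that(1)] mark_vert[OF S that(2)]]
      unfolding cp_isomorphism_def Pi_coord_def by auto
    ultimately show ?thesis by blast
  qed
  then show ?thesis using iso_class_in_moduli[OF S] unfolding chart_dom_def by simp
qed

lemma chart_iso_class: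
  assumes S: "stable_line n S" and ch: "chart_choice n (dual_tree S) a b e"
  shows "chart n (dual_tree S) a b e (iso_class n S) =
    restrict (\<lambda>k. case k of
        Zc i j \<Rightarrow> I_coord S i j / chart_scale (dual_tree S) a b S (level S (meet S (mark S i) (mark S j)))
      | Tc m \<Rightarrow> 0) (chart_indices n (dual_tree S))"
proof -
  have "(SOME S'. S' \<in> iso_class n S) \<in> iso_class n S" using iso_class_self[OF S] by (rule someI)
  then show ?thesis
    unfolding chart_def using chart_line_cp_isomorphism[OF S _ _ ch] unfolding iso_class_def by blast
qed

section \<open>Collision strata\<close>

text \<open>The primitive of the differential is injective off the pole, so its integral vanishes
  only between equal points.\<close>

lemma I_coord_eq_0_iff_collide:
  assumes S: "stable_line n S" and ij: "i \<in> {1..n}" "j \<in> {1..n}" and m: "mark S i = mark S j"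
  shows "I_coord S i j = 0 \<longleftrightarrow> collide S i j"
  using diff_integral_eq_0_iff[OF omega_pole[OF S mark_vert[OF S ij(1)]]
      mpt_neq_desc_point[OF S ij(1)], of "mpt S j"] mpt_neq_desc_point[OF S ij(2)] m
    meet_marks(3)[OF S ij m]
  by (simp add: I_coord_eq I_point_def collide_def)

lemma collide_imp_Pi_coord:
  assumes S: "stable_line n S" and ij: "i \<in> {1..n}" "j \<in> {1..n}" and c: "collide S i j"
  shows "Pi_coord S i j = Pt 0"
  using diff_integral_eq_0_iff[OF omega_pole[OF S mark_vert[OF S ij(1)]]
      mpt_neq_desc_point[OF S ij(1)], of "mpt S j"] mpt_neq_desc_point[OF S ij(2)] c
  by (simp add: Pi_coord_def collide_def)

section \<open>Closedness of collision loci and strata\<close>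

definition collision_locus :: "nat \<Rightarrow> nat \<Rightarrow> nat \<Rightarrow> mline set set" where
  "collision_locus n i j = {C \<in> moduli n. \<forall>S\<in>C. collide S i j}"

lemma iso_class_collision_locus:
  assumes "stable_line n S" "i \<in> {1..n}" "j \<in> {1..n}"
  shows "iso_class n S \<in> collision_locus n i j \<longleftrightarrow> collide S i j"
  using assms iso_class_in_moduli iso_class_self collide_iso_class unfolding collision_locus_def by blast

lemma collision_locus_commute: "collision_locus n i j = collision_locus n j i"
  unfolding collision_locus_def collide_def by auto

lemma moduliE:
  assumes "C \<in> moduli n" obtains S where "stable_line n S" "C = iso_class n S"
  using assms unfolding moduli_eq by blast

text \<open>If \<open>i\<close> and \<open>j\<close> share a vertex of \<Gamma>, their meet is
  terminal and the scale in the denominator is 1, so z_ij is the integral itself. The contraction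
  respects marks, so \<open>i\<close> and \<open>j\<close> also share a component of every line in
  the chart, even when \<Gamma> is not its dual tree.\<close>

lemma chart_zero_iff_collide:
  assumes G: "\<Gamma> \<in> dual_level_trees n" and ch: "chart_choice n \<Gamma> a b e"
    and C: "C \<in> chart_dom n \<Gamma>" and ij: "i \<in> {1..n}" "j \<in> {1..n}" "i < j"
    and m: "mark \<Gamma> i = mark \<Gamma> j"
  shows "chart n \<Gamma> a b e C (Zc i j) = 0 \<longleftrightarrow> C \<in> collision_locus n i j"
proof -
  obtain S0 where S0: "stable_line n S0" "\<Gamma> = dual_tree S0" using G unfolding dual_level_trees_def by blast
  interpret L: level_tree S0 using S0(1) by (rule level_tree_stable)
  have mod: "C \<in> moduli n" using C unfolding chart_dom_def by blast
  obtain S1 where S1: "stable_line n S1" "C = iso_class n S1" using moduliE[OF mod] .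
  define S where "S = (SOME S. S \<in> C)"
  have SC: "S \<in> C" unfolding S_def S1(2) using iso_class_self[OF S1(1)] by (rule someI)
  then have S: "stable_line n S" using S1 unfolding iso_class_def by blast
  obtain f where "contraction n \<Gamma> (dual_tree S) f" using C SC unfolding chart_dom_def by blast
  then have mS: "mark S i = mark S j"
    using ij m unfolding contraction_def by (metis dual_tree_simps(5))
  have "level S0 (meet S0 (mark S0 i) (mark S0 j)) = tree_length S0"
    using L.level_terminal[OF mark_terminal[OF S0(1) ij(1)]] meet_marks(3)[OF S0(1) ij(1,2)] m S0(2)
    by simp
  then have "chart n \<Gamma> a b e C (Zc i j) = I_coord S i j"
    unfolding chart_def S_def[symmetric] chart_line_def Let_def
    using ij by (simp add: S0(2) chart_scale_def chart_indices_def)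
  also have "\<dots> = 0 \<longleftrightarrow> collide S i j" using I_coord_eq_0_iff_collide[OF S ij(1,2) mS] .
  also have "\<dots> \<longleftrightarrow> C \<in> collision_locus n i j"
    using iso_class_collision_locus[OF S1(1) ij(1,2)] collide_iso_class[OF S1(1) _ ij(1,2), of S] SC S1(2)
    by auto
  finally show ?thesis .
qed

lemma continuous_map_closed_immersion:
  "closed_immersion X Y \<phi> \<Longrightarrow> continuous_map (ztop X) (ztop Y) \<phi>"
  unfolding closed_immersion_def fisomorphism_def fmorphism_def
  by (auto simp: continuous_map_in_subtopology)

lemma ztop_chart_target:
  "ztop (chart_target n \<Gamma>) = subtopology (zariski (chart_indices n \<Gamma>))
     {x. \<forall>i\<in>{1..n}. \<forall>j\<in>{1..n}. i < j \<and> mark \<Gamma> i \<noteq> mark \<Gamma> j \<longrightarrow> x (Zc i j) \<noteq> 0}"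
  by (simp add: chart_target_def affine_space_def)

lemma openin_chart_dom_diff_collision_locus:
  assumes X: "moduli_variety n X" and G: "\<Gamma> \<in> dual_level_trees n"
    and ij: "i \<in> {1..n}" "j \<in> {1..n}" "i < j"
  shows "openin (ztop X) (chart_dom n \<Gamma> - collision_locus n i j)"
proof (cases "mark \<Gamma> i = mark \<Gamma> j")
  case False
  have U: "openin (ztop X) (chart_dom n \<Gamma>)" using X G unfolding moduli_variety_def by blast
  have "C \<notin> collision_locus n i j" if C: "C \<in> chart_dom n \<Gamma>" for C
  proof
    assume D: "C \<in> collision_locus n i j"
    have "C \<in> moduli n" using C unfolding chart_dom_def by blast
    then obtain S where S: "stable_line n S" "C = iso_class n S" by (rule moduliE)
    \<comment> \<open>Different vertices of \<Gamma> may be contracted to one component, so it is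
      the condition on \<open>Pi_coord\<close> that excludes the collision.\<close>
    then have "Pi_coord S i j = Pt 0"
      using collide_imp_Pi_coord iso_class_collision_locus D ij by blast
    then show False using C False ij iso_class_self[OF S(1)] S(2) unfolding chart_dom_def by blast
  qed
  then have "chart_dom n \<Gamma> - collision_locus n i j = chart_dom n \<Gamma>" by blast
  then show ?thesis using U by simp
next
  case True
  have U: "openin (ztop X) (chart_dom n \<Gamma>)" using X G unfolding moduli_variety_def by blast
  obtain a b e where ch: "chart_choice n \<Gamma> a b e"
    using G chart_choice_exists unfolding dual_level_trees_def by blast
  let ?J = "chart_indices n \<Gamma>" and ?\<psi> = "chart n \<Gamma> a b e"
  have "closed_immersion (induced X (chart_dom n \<Gamma>)) (chart_target n \<Gamma>) ?\<psi>"
    using X G ch unfolding moduli_variety_def by blast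
  from continuous_map_closed_immersion[OF this]
  have cont: "continuous_map (subtopology (ztop X) (chart_dom n \<Gamma>)) (zariski ?J) ?\<psi>"
    unfolding ztop_chart_target by (simp add: continuous_map_in_subtopology)
  have "(\<lambda>x. x (Zc i j)) \<in> poly_funs ?J"
    using ij by (intro poly_funs.coord) (auto simp: chart_indices_def)
  then have "openin (zariski ?J) {x \<in> ?J \<rightarrow>\<^sub>E UNIV. x (Zc i j) \<noteq> 0}"
    unfolding openin_zariski by (intro exI[of _ "{\<lambda>x. x (Zc i j)}"]) auto
  from openin_continuous_map_preimage[OF cont this]
  have "openin (ztop X) {C \<in> points X \<inter> chart_dom n \<Gamma>. ?\<psi> C \<in> {x \<in> ?J \<rightarrow>\<^sub>E UNIV. x (Zc i j) \<noteq> 0}}"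
    using openin_trans_full[OF _ U] by simp
  moreover have "{C \<in> points X \<inter> chart_dom n \<Gamma>. ?\<psi> C \<in> {x \<in> ?J \<rightarrow>\<^sub>E UNIV. x (Zc i j) \<noteq> 0}} =
      chart_dom n \<Gamma> - collision_locus n i j"
  proof -
    have "?\<psi> C \<in> ?J \<rightarrow>\<^sub>E UNIV" for C
      unfolding chart_def chart_line_def Let_def by auto
    moreover have "chart_dom n \<Gamma> \<subseteq> points X" using openin_subset[OF U] .
    ultimately show ?thesis using chart_zero_iff_collide[OF G ch _ ij True] by blast
  qed
  ultimately show ?thesis by simp
qed

lemma closedin_collision_locus:
  assumes X: "moduli_variety n X" and ij: "i \<in> {1..n}" "j \<in> {1..n}"
  shows "closedin (ztop X) (collision_locus n i j)"
proof -
  have pts: "points X = moduli n" using X unfolding moduli_variety_def by blast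
  \<comment> \<open>Coordinates z_ij exist only for \<open>i < j\<close>; the reverse order follows
    by symmetry, and for \<open>i = j\<close> the locus is the whole space.\<close>
  have less: "closedin (ztop X) (collision_locus n i j)"
    if ij: "i \<in> {1..n}" "j \<in> {1..n}" "i < j" for i j
  proof -
    have "points X - collision_locus n i j =
        (\<Union>\<Gamma>\<in>dual_level_trees n. chart_dom n \<Gamma> - collision_locus n i j)"
    proof (intro equalityI subsetI)
      fix C assume C: "C \<in> points X - collision_locus n i j"
      then obtain S where S: "stable_line n S" "C = iso_class n S" using pts moduliE by blast
      then have "C \<in> chart_dom n (dual_tree S)" "dual_tree S \<in> dual_level_trees n"
        using iso_class_chart_dom unfolding dual_level_trees_def by auto
      then show "C \<in> (\<Union>\<Gamma>\<in>dual_level_trees n. chart_dom n \<Gamma> - collision_locus n i j)" using C by blast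
    qed (auto simp: pts chart_dom_def)
    moreover have "openin (ztop X) (\<Union>\<Gamma>\<in>dual_level_trees n. chart_dom n \<Gamma> - collision_locus n i j)"
      using openin_chart_dom_diff_collision_locus[OF X _ ij] by (intro openin_Union) auto
    ultimately show ?thesis
      unfolding closedin_def using pts by (auto simp: collision_locus_def)
  qed
  show ?thesis
  proof (cases i j rule: linorder_cases)
    case equal
    then have "collision_locus n i j = points X" unfolding collision_locus_def collide_def pts by auto
    then show ?thesis by simp
  qed (use less ij collision_locus_commute in metis)+
qed

lemma closed_stratum_eq:
  "closed_stratum n \<rho> = moduli n \<inter> (\<Inter>(i, j)\<in>{(i, j) \<in> {1..n} \<times> {1..n}. same_block \<rho> i j}. collision_locus n i j)"
  unfolding closed_stratum_def collision_locus_def by auto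

lemma open_stratum_eq:
  "open_stratum n \<rho> = closed_stratum n \<rho> -
     (\<Union>(i, j)\<in>{(i, j) \<in> {1..n} \<times> {1..n}. \<not> same_block \<rho> i j}. collision_locus n i j)"
proof -
  have "C \<in> open_stratum n \<rho> \<longleftrightarrow> C \<in> closed_stratum n \<rho> \<and>
      (\<forall>i\<in>{1..n}. \<forall>j\<in>{1..n}. \<not> same_block \<rho> i j \<longrightarrow> C \<notin> collision_locus n i j)" for C
  proof (cases "C \<in> moduli n")
    case True
    then obtain S where "stable_line n S" "C = iso_class n S" by (rule moduliE)
    then show ?thesis
      using iso_class_open_stratum_iff iso_class_closed_stratum_iff iso_class_collision_locus by blast
  qed (auto simp: open_stratum_def closed_stratum_def)
  then show ?thesis by (intro equalityI subsetI) fastforce+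
qed

lemma closedin_closed_stratum:
  assumes X: "moduli_variety n X" shows "closedin (ztop X) (closed_stratum n \<rho>)"
proof -
  have pts: "points X = moduli n" using X unfolding moduli_variety_def by blast
  let ?K = "(\<lambda>(i, j). collision_locus n i j) ` {(i, j) \<in> {1..n} \<times> {1..n}. same_block \<rho> i j}"
  \<comment> \<open>Inserting the whole space keeps the intersected family nonempty, as
    \<open>closedin_Inter\<close> demands.\<close>
  have "closed_stratum n \<rho> = \<Inter>(insert (points X) ?K)"
    unfolding closed_stratum_eq pts by simp
  moreover have "closedin (ztop X) (\<Inter>(insert (points X) ?K))"
    using closedin_collision_locus[OF X] by (intro closedin_Inter) auto
  ultimately show ?thesis by simp
qed

lemma locally_closed_open_stratum:
  assumes X: "moduli_variety n X" shows "locally_closed_in (ztop X) (open_stratum n \<rho>)"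
proof -
  let ?N = "\<Union>(i, j)\<in>{(i, j) \<in> {1..n} \<times> {1..n}. \<not> same_block \<rho> i j}. collision_locus n i j"
  have fin: "finite {(i, j) \<in> {1..n} \<times> {1..n}. \<not> same_block \<rho> i j}"
    by (rule finite_subset[of _ "{1..n} \<times> {1..n}"]) auto
  have "closedin (ztop X) ?N"
    using closedin_collision_locus[OF X] fin by (intro closedin_Union) auto
  then have "openin (ztop X) (points X - ?N)" by blast
  moreover have "open_stratum n \<rho> = (points X - ?N) \<inter> closed_stratum n \<rho>"
    unfolding open_stratum_eq using closedin_subset[OF closedin_closed_stratum[OF X, of \<rho>]] by blast
  ultimately show ?thesis
    unfolding locally_closed_in_def using closedin_closed_stratum[OF X] by blast
qed

section \<open>Moving the marked points\<close>

lemma isCont_eventually_neq: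
  fixes f :: "complex \<Rightarrow> complex"
  assumes "isCont f a" "f a \<noteq> c" shows "eventually (\<lambda>x. f x \<noteq> c) (at a)"
  using assms unfolding isCont_def by (rule tendsto_imp_eventually_ne)

text \<open>In a coordinate with the pole at infinity a linear motion never reaches the pole, and it
  avoids the finitely many other nodes for small parameters because it does not start at one.
  Collisions are stated for the punctured filter \<open>at 0\<close>: at the parameter 0 itself no
  collision has been resolved.\<close>

lemma perturb_marked_points:
  fixes w :: "nat \<Rightarrow> complex"
  assumes S: "stable_line n S"
  shows "\<exists>p :: complex \<Rightarrow> nat \<Rightarrow> P1.
    eventually (\<lambda>\<epsilon>. stable_line n (S\<lparr>mpt := p \<epsilon>\<rparr>)) (at 0) \<and>
    (\<forall>i\<in>{1..n}. \<forall>j\<in>{1..n}.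
      eventually (\<lambda>\<epsilon>. collide (S\<lparr>mpt := p \<epsilon>\<rparr>) i j \<longleftrightarrow> collide S i j \<and> w i = w j) (at 0) \<and>
      isCont (\<lambda>\<epsilon>. I_coord (S\<lparr>mpt := p \<epsilon>\<rparr>) i j) 0) \<and>
    (\<forall>i\<in>{1..n}. p 0 i = mpt S i)"
proof -
  have "\<forall>v. \<exists>\<mu>. P1_aut \<mu> \<and> \<mu> Infinity = desc_point S v \<and> (\<forall>x. x \<noteq> desc_point S v \<longrightarrow> (\<exists>z. x = \<mu> (Pt z)))"
    using P1_aut_parametrization by metis
  then obtain \<mu> where \<mu>: "\<And>v. P1_aut (\<mu> v)" "\<And>v. \<mu> v Infinity = desc_point S v"
    "\<And>v x. x \<noteq> desc_point S v \<Longrightarrow> \<exists>z. x = \<mu> v (Pt z)" by metis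
  have "\<forall>i. \<exists>z. i \<in> {1..n} \<longrightarrow> mpt S i = \<mu> (mark S i) (Pt z)"
    using \<mu>(3) mpt_neq_desc_point[OF S] by blast
  then obtain x where x: "\<And>i. i \<in> {1..n} \<Longrightarrow> mpt S i = \<mu> (mark S i) (Pt (x i))" by metis
  \<comment> \<open>The coordinate depends on the component only, so points on the same component
    have coordinate differences that are affine in the parameter.\<close>
  define p where "p = (\<lambda>\<epsilon> i. \<mu> (mark S i) (Pt (x i + \<epsilon> * w i)))"
  have \<mu>_eq: "\<mu> v s = \<mu> v t \<longleftrightarrow> s = t" for v s t using P1_aut_inj[OF \<mu>(1)] by (rule inj_eq)
  have off_desc: "p \<epsilon> i \<noteq> desc_point S (mark S i)" for \<epsilon> i
    unfolding p_def \<mu>(2)[symmetric] \<mu>_eq by simp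
  show ?thesis
  proof (intro exI[of _ p] conjI ballI)
    show "p 0 i = mpt S i" if "i \<in> {1..n}" for i using x[OF that] by (simp add: p_def)
    have "eventually (\<lambda>\<epsilon>. p \<epsilon> i \<notin> nodes_on S (mark S i)) (at 0)" if i: "i \<in> {1..n}" for i
    proof -
      interpret level_tree S using S by (rule level_tree_stable)
      have "nodes_on S (mark S i) = node S (mark S i) ` {w. (mark S i, w) \<in> adj S}"
        by (auto simp: nodes_on_def)
      moreover have "{w. (mark S i, w) \<in> adj S} \<subseteq> verts S" using adj_verts by blast
      ultimately have fin: "finite (nodes_on S (mark S i))"
        using finite_subset[OF _ finite_verts] by simp
      have "eventually (\<lambda>\<epsilon>. p \<epsilon> i \<noteq> q) (at 0)" if q: "q \<in> nodes_on S (mark S i)" for q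
      proof (cases "q = desc_point S (mark S i)")
        case True
        then show ?thesis using off_desc by simp
      next
        case False
        then obtain z where z: "q = \<mu> (mark S i) (Pt z)" using \<mu>(3) by blast
        have "q \<noteq> mpt S i" using S i q unfolding stable_line_def marked_line_def by blast
        then have "x i \<noteq> z" using x[OF i] z by auto
        then have "eventually (\<lambda>\<epsilon>. x i + \<epsilon> * w i \<noteq> z) (at 0)"
          by (intro isCont_eventually_neq continuous_intros) auto
        then show ?thesis by eventually_elim (simp add: p_def z \<mu>_eq)
      qed
      then have "eventually (\<lambda>\<epsilon>. \<forall>q\<in>nodes_on S (mark S i). p \<epsilon> i \<noteq> q) (at 0)"
        using fin by (simp add: eventually_ball_finite)
      then show ?thesis by eventually_elim blast
    qed
    then have "eventually (\<lambda>\<epsilon>. \<forall>i\<in>{1..n}. p \<epsilon> i \<notin> nodes_on S (mark S i)) (at 0)"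
      by (simp add: eventually_ball_finite)
    then show "eventually (\<lambda>\<epsilon>. stable_line n (S\<lparr>mpt := p \<epsilon>\<rparr>)) (at 0)"
    proof eventually_elim
      case (elim \<epsilon>)
      have "p \<epsilon> i \<noteq> infpt S" if "mark S i = vroot S" for i
        using off_desc[of \<epsilon> i] that by (simp add: desc_point_def)
      then show ?case using S elim unfolding stable_line_def marked_line_def by simp
    qed
  next
    fix i j assume ij: "i \<in> {1..n}" "j \<in> {1..n}"
    have collide: "collide (S\<lparr>mpt := p \<epsilon>\<rparr>) i j \<longleftrightarrow> mark S i = mark S j \<and> x i + \<epsilon> * w i = x j + \<epsilon> * w j" for \<epsilon>
      unfolding collide_def p_def by (auto simp: \<mu>_eq)
    have collide0: "collide S i j \<longleftrightarrow> mark S i = mark S j \<and> x i = x j"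
      using x ij unfolding collide_def by (auto simp: \<mu>_eq)
    show "eventually (\<lambda>\<epsilon>. collide (S\<lparr>mpt := p \<epsilon>\<rparr>) i j \<longleftrightarrow> collide S i j \<and> w i = w j) (at 0)"
    \<comment> \<open>Coinciding points separate at once exactly when their velocities differ;
      distinct points stay distinct for small parameters.\<close>
    proof (cases "x i = x j")
      case True
      have "eventually (\<lambda>\<epsilon>. \<epsilon> \<noteq> 0) (at (0::complex))" by (simp add: eventually_neq_at_within)
      then show ?thesis by eventually_elim (use True in \<open>auto simp: collide collide0\<close>)
    next
      case False
      have "eventually (\<lambda>\<epsilon>. x i + \<epsilon> * w i - (x j + \<epsilon> * w j) \<noteq> 0) (at 0)"
        by (intro isCont_eventually_neq continuous_intros) (use False in auto)
      then show ?thesis by eventually_elim (use False in \<open>auto simp: collide collide0\<close>)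
    qed
    show "isCont (\<lambda>\<epsilon>. I_coord (S\<lparr>mpt := p \<epsilon>\<rparr>) i j) 0"
    proof (cases "mark S i = mark S j")
      case True
      let ?v = "mark S i"
      obtain k where k: "\<And>z y. diff_integral (omega S ?v) (desc_point S ?v) (\<mu> ?v (Pt z)) (\<mu> ?v (Pt y)) = k * (y - z)"
        using diff_integral_translate[OF omega_pole[OF S mark_vert[OF S ij(1)]] \<mu>(1,2)] by metis
      have "I_coord (S\<lparr>mpt := p \<epsilon>\<rparr>) i j = k * ((x j + \<epsilon> * w j) - (x i + \<epsilon> * w i))" for \<epsilon>
        using True meet_marks(3)[OF S ij True] k
        by (simp add: I_coord_eq I_point_def p_def)
      then show ?thesis by (simp add: continuous_intros)
    next
      case False
      then have "I_coord (S\<lparr>mpt := p \<epsilon>\<rparr>) i j = I_coord S i j" for \<epsilon>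
        by (simp add: I_coord_eq I_point_def)
      then show ?thesis by simp
    qed
  qed
qed

text \<open>The least element of the block of \<open>i\<close>, read as a complex number, labels the
  block. These labels are the velocities.\<close>

lemma same_block_weights:
  assumes "partition_on {1..n} \<rho>"
  obtains w :: "nat \<Rightarrow> complex"
  where "\<And>i j. i \<in> {1..n} \<Longrightarrow> j \<in> {1..n} \<Longrightarrow> w i = w j \<longleftrightarrow> same_block \<rho> i j"
proof (rule that[of "\<lambda>i. of_nat (LEAST k. same_block \<rho> i k)"])
  have sym: "same_block \<rho> i j \<Longrightarrow> same_block \<rho> j i" for i j unfolding same_block_def by blast
  have trans: "same_block \<rho> i j \<Longrightarrow> same_block \<rho> j k \<Longrightarrow> same_block \<rho> i k" for i j k
    using partition_onD2[OF assms] unfolding same_block_def disjoint_def by blast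
  have refl: "same_block \<rho> i i" if "i \<in> {1..n}" for i
    using partition_onD1[OF assms] that unfolding same_block_def by blast
  fix i j assume ij: "i \<in> {1..n}" "j \<in> {1..n}"
  have 1: "same_block \<rho> i j" if eq: "(LEAST k. same_block \<rho> i k) = (LEAST k. same_block \<rho> j k)"
  proof -
    have "same_block \<rho> i (LEAST k. same_block \<rho> i k)" by (rule LeastI) (rule refl[OF ij(1)])
    moreover have "same_block \<rho> j (LEAST k. same_block \<rho> j k)" by (rule LeastI) (rule refl[OF ij(2)])
    ultimately show ?thesis using trans sym unfolding eq by blast
  qed
  have 2: "same_block \<rho> i = same_block \<rho> j" if "same_block \<rho> i j"
    using sym[OF that] trans[OF that] trans[of j i] by (auto simp: fun_eq_iff)
  show "(of_nat (LEAST k. same_block \<rho> i k) = (of_nat (LEAST k. same_block \<rho> j k) :: complex))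
      \<longleftrightarrow> same_block \<rho> i j"
    unfolding of_nat_eq_iff using 1 2 by metis
qed

lemma level_meet_marks_le:
  assumes "stable_line n S" "i \<in> {1..n}" "j \<in> {1..n}"
  shows "level S (meet S (mark S i) (mark S j)) \<le> tree_length S"
proof -
  interpret level_tree S using assms(1) by (rule level_tree_stable)
  note t = mark_terminal[OF assms(1,2)]
  show ?thesis
    using level_mono[OF terminal_top[OF t meet_marks(1)[OF assms]]] level_terminal[OF t] by simp
qed

text \<open>Below the terminal level the chosen pair lies on two different components, since equal
  ones would meet at the terminal level. So the scale is an integral between nodes, which do not
  move; the last scale is 1 by convention.\<close>

lemma chart_scale_mpt_update:
  assumes S: "stable_line n S" and ch: "chart_choice n (dual_tree S) a b e" and m: "m \<le> tree_length S"
  shows "chart_scale (dual_tree S) a b (S\<lparr>mpt := p\<rparr>) m = chart_scale (dual_tree S) a b S m"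
proof (cases "m = tree_length S")
  case False
  interpret level_tree S using S by (rule level_tree_stable)
  have ab: "a m \<in> {1..n}" "b m \<in> {1..n}" "level S (meet S (mark S (a m)) (mark S (b m))) = m"
    using ch m False unfolding chart_choice_def by auto
  have "mark S (a m) \<noteq> mark S (b m)"
    using meet_marks(3)[OF S ab(1,2)] level_terminal[OF mark_terminal[OF S ab(1)]] ab(3) False by auto
  then show ?thesis by (simp add: chart_scale_def I_coord_eq I_point_def)
qed (simp add: chart_scale_def)

lemma level_mpt_update [simp]: "level (S\<lparr>mpt := p\<rparr>) = level S"
  by (simp add: fun_eq_iff level_def)

text \<open>Injectivity of the chart leads back from coordinates to classes: the perturbed class
  lies in the same chart domain, and its coordinates lie in the image of \<open>Q\<close>, so it
  lies in \<open>Q\<close>.\<close>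

lemma open_stratum_meets_neighbourhood:
  assumes X: "moduli_variety n X" and \<rho>: "partition_on {1..n} \<rho>"
    and C: "C \<in> closed_stratum n \<rho>" and Q: "openin (ztop X) Q" "C \<in> Q"
  shows "Q \<inter> open_stratum n \<rho> \<noteq> {}"
proof -
  have pts: "points X = moduli n" using X unfolding moduli_variety_def by blast
  have "C \<in> moduli n" using C unfolding closed_stratum_def by blast
  then obtain S where S: "stable_line n S" "C = iso_class n S" by (rule moduliE)
  let ?G = "dual_tree S"
  let ?U = "chart_dom n ?G" and ?J = "chart_indices n ?G"
  have G: "?G \<in> dual_level_trees n" using S(1) unfolding dual_level_trees_def by blast
  have U: "openin (ztop X) ?U" using X G unfolding moduli_variety_def by blast
  obtain a b e where ch: "chart_choice n ?G a b e" using chart_choice_exists[OF S(1)] .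
  let ?\<psi> = "chart n ?G a b e"
  have CU: "C \<in> ?U" using iso_class_chart_dom[OF S(1)] S(2) by simp
  let ?I = "?\<psi> ` points (induced X ?U)"
  have "closed_immersion (induced X ?U) (chart_target n ?G) ?\<psi>"
    using X G ch unfolding moduli_variety_def by blast
  then have "homeomorphic_map (subtopology (ztop X) ?U) (subtopology (ztop (chart_target n ?G)) ?I) ?\<psi>"
    unfolding closed_immersion_def using fisomorphism_imp_homeomorphic_map by force
  then have hom: "homeomorphic_map (subtopology (ztop X) ?U)
      (subtopology (ztop (chart_target n ?G)) ?I) ?\<psi>" .
  have "openin (subtopology (ztop X) ?U) (Q \<inter> ?U)" using Q(1) openin_subtopology_Int by blast
  then have "openin (subtopology (ztop (chart_target n ?G)) ?I) (?\<psi> ` (Q \<inter> ?U))"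
    using homeomorphic_imp_open_map[OF hom] unfolding open_map_def by blast
  \<comment> \<open>In affine space \<open>Q \<inter> ?U\<close> is the trace of a Zariski open set
    on the image of the chart. The perturbed class is in the chart domain anyway, so only membership
    in \<open>W\<close> is left to control.\<close>
  then obtain W where W: "openin (zariski ?J) W"
    "?\<psi> ` (Q \<inter> ?U) = W \<inter> topspace (ztop (chart_target n ?G)) \<inter> ?I"
    unfolding ztop_chart_target openin_subtopology using openin_subset by fastforce
  obtain P where P: "P \<subseteq> poly_funs ?J" "W = {x \<in> ?J \<rightarrow>\<^sub>E UNIV. \<exists>q\<in>P. q x \<noteq> 0}"
    using W(1) unfolding openin_zariski by blast
  \<comment> \<open>A single polynomial witnesses membership in \<open>W\<close>, and keeping it
    nonzero is enough.\<close>
  have "?\<psi> C \<in> W" using W(2) CU Q(2) by blast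
  then obtain q where q: "q \<in> P" "q (?\<psi> C) \<noteq> 0" using P(2) by blast

  obtain w :: "nat \<Rightarrow> complex"
    where w: "\<And>i j. i \<in> {1..n} \<Longrightarrow> j \<in> {1..n} \<Longrightarrow> w i = w j \<longleftrightarrow> same_block \<rho> i j"
    using same_block_weights[OF \<rho>] by metis
  from perturb_marked_points[OF S(1), of w] obtain p :: "complex \<Rightarrow> nat \<Rightarrow> P1" where
    p1: "eventually (\<lambda>\<epsilon>. stable_line n (S\<lparr>mpt := p \<epsilon>\<rparr>)) (at 0)" and
    p23: "\<forall>i\<in>{1..n}. \<forall>j\<in>{1..n}.
      eventually (\<lambda>\<epsilon>. collide (S\<lparr>mpt := p \<epsilon>\<rparr>) i j \<longleftrightarrow> collide S i j \<and> w i = w j) (at 0) \<and>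
      isCont (\<lambda>\<epsilon>. I_coord (S\<lparr>mpt := p \<epsilon>\<rparr>) i j) 0" and
    p4: "\<forall>i\<in>{1..n}. p 0 i = mpt S i"
    by (elim exE conjE)
  let ?S = "\<lambda>\<epsilon>. S\<lparr>mpt := p \<epsilon>\<rparr>"
  let ?s = "\<lambda>i j. chart_scale ?G a b S (level S (meet S (mark S i) (mark S j)))"
  define g where "g = (\<lambda>\<epsilon>. restrict (\<lambda>k. case k of Zc i j \<Rightarrow> I_coord (?S \<epsilon>) i j / ?s i j | Tc m \<Rightarrow> 0) ?J)"
  \<comment> \<open>The perturbed line has the dual tree of \<open>S\<close>, so its coordinates are
    again those of a line in the chart of its own tree, and the denominators are still the scales of
    \<open>S\<close>.\<close>
  have chart_eq: "?\<psi> (iso_class n (?S \<epsilon>)) = g \<epsilon>" if st: "stable_line n (?S \<epsilon>)" for \<epsilon>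
  proof -
    have "chart_scale ?G a b (?S \<epsilon>) (level S (meet S (mark S i) (mark S j))) = ?s i j"
      if "i \<in> {1..n}" "j \<in> {1..n}" for i j
      using chart_scale_mpt_update[OF S(1) ch] that level_meet_marks_le[OF S(1)] by blast
    then show ?thesis
      using chart_iso_class[OF st, of a b e] ch
      by (auto simp: g_def fun_eq_iff restrict_def chart_indices_def split: chart_index.split)
  qed
  have "I_coord (?S 0) i j = I_coord S i j" if "i \<in> {1..n}" "j \<in> {1..n}" for i j
    using p4 that by (simp add: I_coord_eq I_point_def)
  then have g0: "g 0 = ?\<psi> C"
    unfolding S(2) chart_iso_class[OF S(1) ch]
    by (auto simp: g_def fun_eq_iff restrict_def chart_indices_def split: chart_index.split)
  have g_cont: "isCont (\<lambda>\<epsilon>. g \<epsilon> k) 0" if k: "k \<in> ?J" for k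
  proof (cases k)
    case (Zc i j)
    then have ij: "i \<in> {1..n}" "j \<in> {1..n}" using k by (auto simp: chart_indices_def)
    have "isCont (\<lambda>\<epsilon>. I_coord (?S \<epsilon>) i j) 0" using p23 ij by blast
    then have "isCont (\<lambda>\<epsilon>. I_coord (?S \<epsilon>) i j / ?s i j) 0"
      unfolding divide_inverse by (intro continuous_intros)
    then show ?thesis using Zc k by (simp add: g_def)
  qed (use k in \<open>simp add: g_def\<close>)
  have "q \<in> poly_funs ?J" using q(1) P(1) by blast
  then have "isCont (\<lambda>\<epsilon>. q (g \<epsilon>)) 0" by (rule isCont_poly_funs) (rule g_cont)
  then have "eventually (\<lambda>\<epsilon>. q (g \<epsilon>) \<noteq> 0) (at 0)"
    by (rule isCont_eventually_neq) (use q(2) g0 in simp)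
  moreover have "eventually (\<lambda>\<epsilon>. \<forall>i\<in>{1..n}. \<forall>j\<in>{1..n}.
      collide (?S \<epsilon>) i j \<longleftrightarrow> collide S i j \<and> w i = w j) (at 0)"
    unfolding eventually_ball_finite_distrib[OF finite_atLeastAtMost] using p23 by blast
  ultimately have "eventually (\<lambda>\<epsilon>. q (g \<epsilon>) \<noteq> 0 \<and> stable_line n (?S \<epsilon>) \<and> (\<forall>i\<in>{1..n}. \<forall>j\<in>{1..n}.
      collide (?S \<epsilon>) i j \<longleftrightarrow> collide S i j \<and> w i = w j)) (at 0)"
    using p1 by eventually_elim blast
  then obtain \<epsilon> where \<epsilon>: "q (g \<epsilon>) \<noteq> 0" "stable_line n (?S \<epsilon>)"
    "\<forall>i\<in>{1..n}. \<forall>j\<in>{1..n}. collide (?S \<epsilon>) i j \<longleftrightarrow> collide S i j \<and> w i = w j"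
    using eventually_happens by fastforce
  let ?C = "iso_class n (?S \<epsilon>)"
  \<comment> \<open>In the closed stratum the points of each block already coincide, so after the
    motion exactly the pairs within blocks collide.\<close>
  have "\<forall>i\<in>{1..n}. \<forall>j\<in>{1..n}. same_block \<rho> i j \<longrightarrow> collide S i j"
    using C iso_class_closed_stratum_iff[OF S(1)] S(2) by blast
  then have "?C \<in> open_stratum n \<rho>"
    unfolding iso_class_open_stratum_iff[OF \<epsilon>(2)] using \<epsilon>(3) w by blast
  moreover have "?C \<in> Q"
  proof -
    have CU': "?C \<in> ?U" using iso_class_chart_dom[OF \<epsilon>(2)] by simp
    have pts_U: "topspace (subtopology (ztop X) ?U) = ?U" using openin_subset[OF U] by auto
    have "?\<psi> ?C \<in> ?\<psi> ` topspace (subtopology (ztop X) ?U)" unfolding pts_U using CU' by (rule imageI)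
    then have "?\<psi> ?C \<in> topspace (subtopology (ztop (chart_target n ?G)) ?I)"
      unfolding homeomorphic_imp_surjective_map[OF hom] .
    then have "?\<psi> ?C \<in> topspace (ztop (chart_target n ?G)) \<inter> ?I"
      unfolding topspace_subtopology .
    moreover have "?\<psi> ?C \<in> W"
      unfolding P(2) using chart_eq[OF \<epsilon>(2)] \<epsilon>(1) q(1) by (auto simp: g_def)
    ultimately have "?\<psi> ?C \<in> ?\<psi> ` (Q \<inter> ?U)" using W(2) by blast
    then obtain D where D: "D \<in> Q \<inter> ?U" "?\<psi> ?C = ?\<psi> D" by blast
    have "?C = D"
      using homeomorphic_imp_injective_map[OF hom, unfolded pts_U] D(2) CU' IntD2[OF D(1)]
      by (rule inj_onD)
    then show ?thesis using D(1) by blast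
  qed
  ultimately show ?thesis by blast
qed

section \<open>Closures and the stratification\<close>

lemma closure_of_open_stratum:
  assumes X: "moduli_variety n X" and \<rho>: "partition_on {1..n} \<rho>"
  shows "ztop X closure_of open_stratum n \<rho> = closed_stratum n \<rho>"
proof
  show "ztop X closure_of open_stratum n \<rho> \<subseteq> closed_stratum n \<rho>"
    using closedin_closed_stratum[OF X] by (intro closure_of_minimal) (auto simp: open_stratum_eq)
  show "closed_stratum n \<rho> \<subseteq> ztop X closure_of open_stratum n \<rho>"
    using open_stratum_meets_neighbourhood[OF X \<rho>] closedin_subset[OF closedin_closed_stratum[OF X, of \<rho>]]
    unfolding in_closure_of subset_iff by blast
qed

text \<open>The blocks are the classes of coinciding marked points on a representative.\<close>

lemma open_stratum_cover:
  assumes "C \<in> moduli n"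
  obtains \<rho> where "partition_on {1..n} \<rho>" "C \<in> open_stratum n \<rho>"
proof -
  obtain S where S: "stable_line n S" "C = iso_class n S" using moduliE[OF assms] .
  define r where "r = {(i, j) \<in> {1..n} \<times> {1..n}. collide S i j}"
  have eq: "equiv {1..n} r"
    by (rule equivI) (auto simp: r_def collide_def refl_on_def sym_def trans_def)
  have "same_block ({1..n} // r) i j \<longleftrightarrow> collide S i j" if "i \<in> {1..n}" "j \<in> {1..n}" for i j
  proof
    assume "same_block ({1..n} // r) i j"
    then obtain B where "B \<in> {1..n} // r" "i \<in> B" "j \<in> B" unfolding same_block_def by blast
    then show "collide S i j" using quotient_eq_iff[OF eq] unfolding r_def by blast
  next
    assume "collide S i j"
    then have "i \<in> r `` {i}" "j \<in> r `` {i}" using that by (auto simp: r_def collide_def)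
    moreover have "r `` {i} \<in> {1..n} // r" using that(1) by (rule quotientI)
    ultimately show "same_block ({1..n} // r) i j" unfolding same_block_def by blast
  qed
  then have "C \<in> open_stratum n ({1..n} // r)"
    using iso_class_open_stratum_iff[OF S(1)] S(2) by blast
  then show thesis using that partition_on_quotient[OF eq] by blast
qed

text \<open>Strata see a partition only through \<open>same_block\<close>. Recovering the partition
  from this relation shows that different partitions have disjoint open strata.\<close>

lemma partition_eq_same_block_classes:
  assumes "partition_on {1..n} \<rho>"
  shows "\<rho> = (\<lambda>i. {j \<in> {1..n}. same_block \<rho> i j}) ` {1..n}"
proof -
  have B: "B = {j \<in> {1..n}. same_block \<rho> i j}" if "B \<in> \<rho>" "i \<in> B" for B i
    using partition_onD1[OF assms] partition_onD2[OF assms] that unfolding same_block_def disjoint_def by blast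
  show ?thesis
  proof (intro equalityI subsetI)
    fix B assume "B \<in> \<rho>"
    moreover from this obtain i where "i \<in> B" using partition_onD3[OF assms] by (metis all_not_in_conv)
    ultimately show "B \<in> (\<lambda>i. {j \<in> {1..n}. same_block \<rho> i j}) ` {1..n}"
      using B partition_onD1[OF assms] by blast
  next
    fix B assume "B \<in> (\<lambda>i. {j \<in> {1..n}. same_block \<rho> i j}) ` {1..n}"
    then obtain i where i: "i \<in> {1..n}" "B = {j \<in> {1..n}. same_block \<rho> i j}" by blast
    then obtain D where "D \<in> \<rho>" "i \<in> D" using partition_onD1[OF assms] by blast
    then show "B \<in> \<rho>" using B i(2) by metis
  qed
qed

lemma open_stratum_disjoint:
  assumes "partition_on {1..n} \<rho>" "partition_on {1..n} \<sigma>" "C \<in> open_stratum n \<rho>" "C \<in> open_stratum n \<sigma>"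
  shows "\<rho> = \<sigma>"
proof -
  have "C \<in> moduli n" using assms(3) unfolding open_stratum_def by blast
  then obtain S where S: "stable_line n S" "C = iso_class n S" by (rule moduliE)
  have "same_block \<rho> i j \<longleftrightarrow> same_block \<sigma> i j" if "i \<in> {1..n}" "j \<in> {1..n}" for i j
    using assms(3,4) that unfolding S(2) iso_class_open_stratum_iff[OF S(1)] by blast
  then have "(\<lambda>i. {j \<in> {1..n}. same_block \<rho> i j}) ` {1..n} = (\<lambda>i. {j \<in> {1..n}. same_block \<sigma> i j}) ` {1..n}"
    by (intro image_cong) auto
  then show ?thesis
    using partition_eq_same_block_classes[OF assms(1)] partition_eq_same_block_classes[OF assms(2)] by simp
qed

text \<open>A point of an open stratum has exactly the collisions of \<rho>, so one common point
  already shows that \<sigma> refines \<rho>, a statement in which the point no longer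
  occurs.\<close>

lemma open_stratum_frontier:
  assumes "C \<in> open_stratum n \<rho>" "C \<in> closed_stratum n \<sigma>"
  shows "open_stratum n \<rho> \<subseteq> closed_stratum n \<sigma>"
proof -
  have "C \<in> moduli n" using assms(1) unfolding open_stratum_def by blast
  then obtain S where S: "stable_line n S" "C = iso_class n S" by (rule moduliE)
  have "\<forall>i\<in>{1..n}. \<forall>j\<in>{1..n}. same_block \<sigma> i j \<longrightarrow> same_block \<rho> i j"
    using assms unfolding S(2) iso_class_open_stratum_iff[OF S(1)] iso_class_closed_stratum_iff[OF S(1)]
    by blast
  then show ?thesis unfolding open_stratum_def closed_stratum_def by blast
qed

theorem proposition3p24:
  fixes n :: nat and X :: "mline set fspace"
  assumes "moduli_variety n X"
  shows "(\<forall>\<rho>. partition_on {1..n} \<rho> \<longrightarrow>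
            closed_subvariety X (closed_stratum n \<rho>) \<and>
            locally_closed_in (ztop X) (open_stratum n \<rho>) \<and>
            dense_in (ztop X) (open_stratum n \<rho>) (closed_stratum n \<rho>)) \<and>
         stratification (ztop X) {\<rho>. partition_on {1..n} \<rho>} (open_stratum n)"
proof (intro conjI allI impI)
  have X: "variety X" "points X = moduli n" using assms unfolding moduli_variety_def by blast+
  have sub: "open_stratum n \<rho> \<subseteq> closed_stratum n \<rho>" for \<rho> by (auto simp: open_stratum_eq)
  show "closed_subvariety X (closed_stratum n \<rho>)" for \<rho>
    unfolding closed_subvariety_def
    using closedin_closed_stratum[OF assms] variety_closed_subset[OF X(1)] by blast
  show lc: "locally_closed_in (ztop X) (open_stratum n \<rho>)" for \<rho>
    by (rule locally_closed_open_stratum[OF assms])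
  show "dense_in (ztop X) (open_stratum n \<rho>) (closed_stratum n \<rho>)" if "partition_on {1..n} \<rho>" for \<rho>
    unfolding dense_in_def closure_of_subtopology
    using closure_of_open_stratum[OF assms that] sub[of \<rho>] by (simp add: Int_absorb1)
  show "stratification (ztop X) {\<rho>. partition_on {1..n} \<rho>} (open_stratum n)"
    unfolding stratification_def
  proof (intro conjI ballI impI)
    show "open_stratum n \<rho> \<inter> open_stratum n \<sigma> = {}"
      if "\<rho> \<in> {\<rho>. partition_on {1..n} \<rho>}" "\<sigma> \<in> {\<rho>. partition_on {1..n} \<rho>}" "\<rho> \<noteq> \<sigma>" for \<rho> \<sigma>
      using open_stratum_disjoint that by blast
    show "(\<Union>\<rho>\<in>{\<rho>. partition_on {1..n} \<rho>}. open_stratum n \<rho>) = topspace (ztop X)"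
    proof
      show "(\<Union>\<rho>\<in>{\<rho>. partition_on {1..n} \<rho>}. open_stratum n \<rho>) \<subseteq> topspace (ztop X)"
        unfolding X(2) open_stratum_def by blast
      show "topspace (ztop X) \<subseteq> (\<Union>\<rho>\<in>{\<rho>. partition_on {1..n} \<rho>}. open_stratum n \<rho>)"
      proof
        fix C assume "C \<in> points X"
        then obtain \<rho> where "partition_on {1..n} \<rho>" "C \<in> open_stratum n \<rho>"
          using X(2) open_stratum_cover by blast
        then show "C \<in> (\<Union>\<rho>\<in>{\<rho>. partition_on {1..n} \<rho>}. open_stratum n \<rho>)" by blast
      qed
    qed
    show "open_stratum n \<rho> \<subseteq> ztop X closure_of open_stratum n \<sigma>"
      if "\<rho> \<in> {\<rho>. partition_on {1..n} \<rho>}" "\<sigma> \<in> {\<rho>. partition_on {1..n} \<rho>}"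
        "open_stratum n \<rho> \<inter> ztop X closure_of open_stratum n \<sigma> \<noteq> {}" for \<rho> \<sigma>
      using closure_of_open_stratum[OF assms, of \<sigma>] open_stratum_frontier that by blast
  qed (rule lc)
qed

end
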